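(* Let $G_m$ be a bounded Vilenkin group. (a) The maximal operator $\widetilde R^{\ast}f:=\sup_{n\in\mathbf{P}_+}\dfrac{|R_nf|}{\log(n+1)}$ is bounded from the martingale Hardy space $H_{1/2}(G_m)$ to the space $L_{1/2}(G_m)$; that is, there is a constant $c$ (depending only on $m$) such that $\|\widetilde R^{\ast}f\|_{1/2}\le c\,\|f\|_{H_{1/2}}$ for every martingale $f\in H_{1/2}(G_m)$. (b) Let $\varphi:\mathbf{P}_+\to[1,\infty)$ be a nondecreasing function satisfying $$\limsup_{n\to\infty}\frac{\log(n+1)}{\varphi(n)}=+\infty .$$ Then the maximal operator $f\mapsto\sup_{n\in\mathbf{P}_+}\dfrac{|R_nf|}{\varphi(n)}$ is not bounded from $H_{1/2}(G_m)$ to $L_{1/2}(G_m)$; that is, there is no constant $C<\infty$ such that $\left\|\sup_{n\in\mathbf{P}_+}\frac{|R_nf|}{\varphi(n)}\right\|_{1/2}\le C\|f\|_{H_{1/2}}$ for all $f\in H_{1/2}(G_m)$.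
   Context: $\mathbf{P}_+$ is the set of positive integers and $\mathbf{P}:=\mathbf{P}_+\cup\{0\}$. Let $m=(m_0,m_1,\dots)$ be a sequence of integers $\ge 2$ with $\sup_n m_n<\infty$. $Z_{m_k}=\{0,1,\dots,m_k-1\}$ is the additive group of integers modulo $m_k$ (discrete topology), and $G_m:=\prod_{k\ge 0}Z_{m_k}$ is the complete direct product with the product topology, called a bounded Vilenkin group because $\sup_n m_n<\infty$. $\mu$ is the product of the uniform probability measures on the $Z_{m_k}$, i.e. the normalized Haar measure on $G_m$. Elements are $x=(x_0,x_1,\dots)$ with $x_k\in Z_{m_k}$. Put $I_0(x):=G_m$ and $I_n(x):=\{y\in G_m: y_0=x_0,\dots,y_{n-1}=x_{n-1}\}$. Generalized number system: $M_0:=1$, $M_{k+1}:=m_kM_k$; every $n\in\mathbf{P}$ is uniquely $n=\sum_{j\ge0}n_jM_j$ with $n_j\in Z_{m_j}$, only finitely many nonzero. Generalized Rademacher functions: $r_k(x):=\exp(2\pi i x_k/m_k)$. Vilenkin system: $\psi_n(x):=\prod_{k\ge0}r_k^{n_k}(x)$, $n\in\mathbf{P}$. $\mathcal F_n$ is the $\sigma$-algebra generated by $\{I_n(x):x\in G_m\}$. Martingales $f=(f^{(n)},n\in\mathbf{P})$ are with respect to $(\mathcal F_n)$. The maximal function is $f^{\ast}:=\sup_{n\in\mathbf{P}}|f^{(n)}|$, and for $0<p<\infty$ the Hardy space $H_p(G_m)$ consists of all martingales with $\|f\|_{H_p}:=\|f^{\ast}\|_p<\infty$, where $\|g\|_p:=\left(\int_{G_m}|g|^pd\mu\right)^{1/p}$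 is the (quasi-)norm of $L_p(G_m)$. For a martingale $f$: the Vilenkin–Fourier coefficients are $\widehat f(i):=\lim_{k\to\infty}\int_{G_m}f^{(k)}\overline{\psi_i}\,d\mu$; the partial sums are $S_nf:=\sum_{k=0}^{n-1}\widehat f(k)\psi_k$; the $n$-th Riesz logarithmic mean is $R_nf:=\frac1{l_n}\sum_{k=1}^n\frac{S_kf}{k}$ with $l_n:=\sum_{k=1}^n\frac1k$, for $n\in\mathbf{P}_+$. *)

theory Defs
  imports "HOL-Probability.Probability"
begin

text \<open>
  A point of the Vilenkin group \<open>G\<^sub>m\<close> is a function \<open>x :: nat \<Rightarrow> nat\<close> with \<open>x k < m k\<close> for all \<open>k\<close>.
  The product of the uniform probability measures on the factors is its normalized Haar measure.
\<close>

definition vil_measure :: "(nat \<Rightarrow> nat) \<Rightarrow> (nat \<Rightarrow> nat) measure" where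
  "vil_measure m = PiM UNIV (\<lambda>k. uniform_count_measure {..<m k})"

definition vil_interval :: "(nat \<Rightarrow> nat) \<Rightarrow> nat \<Rightarrow> (nat \<Rightarrow> nat) \<Rightarrow> (nat \<Rightarrow> nat) set" where
  "vil_interval m n x = {y \<in> space (vil_measure m). \<forall>j<n. y j = x j}"

definition vil_filtration :: "(nat \<Rightarrow> nat) \<Rightarrow> nat \<Rightarrow> (nat \<Rightarrow> nat) measure" where
  "vil_filtration m n =
     sigma (space (vil_measure m)) (vil_interval m n ` space (vil_measure m))"

definition vil_M :: "(nat \<Rightarrow> nat) \<Rightarrow> nat \<Rightarrow> nat" where
  "vil_M m k = (\<Prod>i<k. m i)"

text \<open>
  The digits \<open>n\<^sub>j\<close> of \<open>n\<close> in the generalized number system based on \<open>m\<close>; the lemma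
  \<open>vil_digit_iff\<close> below shows that they are the unique digits representing \<open>n\<close>.
\<close>

definition vil_digit :: "(nat \<Rightarrow> nat) \<Rightarrow> nat \<Rightarrow> nat \<Rightarrow> nat" where
  "vil_digit m n j = (n div vil_M m j) mod m j"

definition vil_rademacher :: "(nat \<Rightarrow> nat) \<Rightarrow> nat \<Rightarrow> (nat \<Rightarrow> nat) \<Rightarrow> complex" where
  "vil_rademacher m k x = exp (2 * of_real pi * \<i> * of_nat (x k) / of_nat (m k))"

definition vil_psi :: "(nat \<Rightarrow> nat) \<Rightarrow> nat \<Rightarrow> (nat \<Rightarrow> nat) \<Rightarrow> complex" where
  "vil_psi m n x = (\<Prod>k. vil_rademacher m k x ^ vil_digit m n k)"

text \<open>
  Martingales are complex valued, with conditional expectations taken separately in the real and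
  the imaginary part.
\<close>

definition vil_martingale ::
    "(nat \<Rightarrow> nat) \<Rightarrow> (nat \<Rightarrow> (nat \<Rightarrow> nat) \<Rightarrow> complex) \<Rightarrow> bool" where
  "vil_martingale m f \<longleftrightarrow>
     (\<forall>n. f n \<in> borel_measurable (vil_filtration m n)) \<and>
     (\<forall>n. integrable (vil_measure m) (f n)) \<and>
     (\<forall>n k. n \<le> k \<longrightarrow>
        (AE x in vil_measure m.
           f n x = Complex (real_cond_exp (vil_measure m) (vil_filtration m n) (\<lambda>y. Re (f k y)) x)
                           (real_cond_exp (vil_measure m) (vil_filtration m n) (\<lambda>y. Im (f k y)) x)))"

text \<open>Powers with positive exponent on \<open>[0, \<infinity>]\<close>, with \<open>\<infinity>\<^sup>p = \<infinity>\<close>.\<close>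

definition epowr :: "ennreal \<Rightarrow> real \<Rightarrow> ennreal" where
  "epowr a p = (if a = \<top> then \<top> else ennreal (enn2real a powr p))"

text \<open>
  The maximal functions may take the value \<open>\<infinity>\<close>, so the \<open>L\<^sub>p\<close> quasi-norm is defined for
  \<open>[0, \<infinity>]\<close>-valued functions (moduli of the functions in question) and may itself be \<open>\<infinity>\<close>.
\<close>

definition vil_Lp_norm :: "(nat \<Rightarrow> nat) \<Rightarrow> real \<Rightarrow> ((nat \<Rightarrow> nat) \<Rightarrow> ennreal) \<Rightarrow> ennreal" where
  "vil_Lp_norm m p g = epowr (\<integral>\<^sup>+x. epowr (g x) p \<partial>vil_measure m) (1 / p)"

definition martingale_maximal ::
    "(nat \<Rightarrow> (nat \<Rightarrow> nat) \<Rightarrow> complex) \<Rightarrow> (nat \<Rightarrow> nat) \<Rightarrow> ennreal" where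
  "martingale_maximal f x = (SUP n. ennreal (cmod (f n x)))"

definition vil_Hp_norm ::
    "(nat \<Rightarrow> nat) \<Rightarrow> real \<Rightarrow> (nat \<Rightarrow> (nat \<Rightarrow> nat) \<Rightarrow> complex) \<Rightarrow> ennreal" where
  "vil_Hp_norm m p f = vil_Lp_norm m p (martingale_maximal f)"

definition vil_Hp :: "(nat \<Rightarrow> nat) \<Rightarrow> real \<Rightarrow> (nat \<Rightarrow> (nat \<Rightarrow> nat) \<Rightarrow> complex) set" where
  "vil_Hp m p = {f. vil_martingale m f \<and> vil_Hp_norm m p f < \<infinity>}"

definition vil_coeff ::
    "(nat \<Rightarrow> nat) \<Rightarrow> (nat \<Rightarrow> (nat \<Rightarrow> nat) \<Rightarrow> complex) \<Rightarrow> nat \<Rightarrow> complex" where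
  "vil_coeff m f i = lim (\<lambda>k. LINT x|vil_measure m. f k x * cnj (vil_psi m i x))"

definition vil_partial_sum ::
    "(nat \<Rightarrow> nat) \<Rightarrow> (nat \<Rightarrow> (nat \<Rightarrow> nat) \<Rightarrow> complex) \<Rightarrow> nat \<Rightarrow> (nat \<Rightarrow> nat) \<Rightarrow> complex" where
  "vil_partial_sum m f n x = (\<Sum>k<n. vil_coeff m f k * vil_psi m k x)"

definition riesz_mean ::
    "(nat \<Rightarrow> nat) \<Rightarrow> (nat \<Rightarrow> (nat \<Rightarrow> nat) \<Rightarrow> complex) \<Rightarrow> nat \<Rightarrow> (nat \<Rightarrow> nat) \<Rightarrow> complex" where
  "riesz_mean m f n x =
     (\<Sum>k=1..n. vil_partial_sum m f k x / of_nat k) / of_real (\<Sum>k=1..n. 1 / real k)"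

definition riesz_maximal ::
    "(nat \<Rightarrow> nat) \<Rightarrow> (nat \<Rightarrow> real) \<Rightarrow> (nat \<Rightarrow> (nat \<Rightarrow> nat) \<Rightarrow> complex) \<Rightarrow> (nat \<Rightarrow> nat) \<Rightarrow> ennreal" where
  "riesz_maximal m w f x = (SUP n\<in>{1..}. ennreal (cmod (riesz_mean m f n x) / w n))"

lemma vil_M_0: "vil_M m 0 = 1" and vil_M_Suc: "vil_M m (Suc k) = m k * vil_M m k"
  by (simp_all add: vil_M_def)

lemma vil_M_gt:
  assumes "\<And>k. 2 \<le> m k"
  shows "k < vil_M m k"
proof (induction k)
  case (Suc k)
  have "2 * vil_M m k \<le> m k * vil_M m k"
    using assms by (rule mult_right_mono) simp
  then show ?case unfolding vil_M_Suc using Suc by linarith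
qed (simp add: vil_M_0)

lemma vil_M_dvd: "i \<le> j \<Longrightarrow> vil_M m i dvd vil_M m j"
  unfolding vil_M_def by (rule prod_dvd_prod_subset) auto

lemma vil_digit_sum:
  "n = (\<Sum>j<k. vil_digit m n j * vil_M m j) + (n div vil_M m k) * vil_M m k"
proof (induction k)
  case (Suc k)
  define q where "q = n div vil_M m k"
  have "n div vil_M m (Suc k) = q div m k"
    by (simp only: q_def vil_M_Suc mult.commute[of "m k"] div_mult2_eq)
  then have "vil_digit m n k * vil_M m k + (n div vil_M m (Suc k)) * vil_M m (Suc k)
      = (q mod m k + q div m k * m k) * vil_M m k"
    by (simp only: vil_digit_def q_def vil_M_Suc distrib_right mult.assoc)
  also have "\<dots> = n div vil_M m k * vil_M m k"
    by (simp only: mod_div_mult_eq q_def)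
  finally show ?case using Suc by simp
qed (simp add: vil_M_0)

lemma vil_sum_less:
  assumes "\<And>j. a j < m j"
  shows "(\<Sum>j<k. a j * vil_M m j) < vil_M m k"
proof (induction k)
  case (Suc k)
  have "(\<Sum>j<Suc k. a j * vil_M m j) < Suc (a k) * vil_M m k"
    using Suc by simp
  also have "\<dots> \<le> m k * vil_M m k"
    using assms[of k] by (intro mult_right_mono) (simp_all only: Suc_le_eq zero_le)
  finally show ?case by (simp add: vil_M_Suc)
qed (simp add: vil_M_0)

lemma vil_digit_iff:
  assumes m: "\<And>k. 2 \<le> m k"
  shows "(\<forall>j. a j < m j) \<and> finite {j. a j \<noteq> 0} \<and> n = (\<Sum>j | a j \<noteq> 0. a j * vil_M m j)
         \<longleftrightarrow> a = vil_digit m n"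
proof (intro iffI conjI allI)
  assume "(\<forall>j. a j < m j) \<and> finite {j. a j \<noteq> 0} \<and> n = (\<Sum>j | a j \<noteq> 0. a j * vil_M m j)"
  then have a: "\<And>j. a j < m j" and fin: "finite {j. a j \<noteq> 0}"
    and n: "n = (\<Sum>j | a j \<noteq> 0. a j * vil_M m j)" by auto
  show "a = vil_digit m n"
  proof
    fix k
    obtain K0 where K0: "{j. a j \<noteq> 0} \<subseteq> {..<K0}"
      using fin finite_nat_iff_bounded by blast
    define K where "K = max K0 (Suc k)"
    have K: "{j. a j \<noteq> 0} \<subseteq> {..<K}" "k < K" using K0 by (auto simp: K_def)
    have "n = (\<Sum>j<K. a j * vil_M m j)"
      unfolding n using K by (intro sum.mono_neutral_left) auto
    also have "{..<K} = {..<k} \<union> ({k} \<union> {Suc k..<K})" using K by auto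
    also have "(\<Sum>j\<in>\<dots>. a j * vil_M m j)
        = (\<Sum>j<k. a j * vil_M m j) + (a k * vil_M m k + (\<Sum>j=Suc k..<K. a j * vil_M m j))"
      by (subst sum.union_disjoint; auto)
    finally have n': "n = \<dots>" .
    have "vil_M m (Suc k) dvd (\<Sum>j=Suc k..<K. a j * vil_M m j)"
      by (intro dvd_sum dvd_mult vil_M_dvd) auto
    then obtain q where q: "(\<Sum>j=Suc k..<K. a j * vil_M m j) = m k * vil_M m k * q"
      by (auto simp: vil_M_Suc dvd_def)
    have less: "(\<Sum>j<k. a j * vil_M m j) < vil_M m k"
      by (rule vil_sum_less[OF a])
    have "n = (\<Sum>j<k. a j * vil_M m j) + (a k + m k * q) * vil_M m k"
      using n' q by (simp add: algebra_simps)
    then have "n div vil_M m k = a k + m k * q"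
      using less by simp
    then show "a k = vil_digit m n k"
      using a[of k] by (simp add: vil_digit_def)
  qed
next
  assume a: "a = vil_digit m n"
  show "a j < m j" for j
    using m[of j] by (simp add: a vil_digit_def)
  have zero: "vil_digit m n j = 0" if "n \<le> j" for j
    using vil_M_gt[of m j, OF m] that by (simp add: vil_digit_def)
  then have sub: "{j. a j \<noteq> 0} \<subseteq> {..<n}"
    unfolding a by (metis (mono_tags, lifting) lessThan_iff mem_Collect_eq not_le subsetI)
  then show "finite {j. a j \<noteq> 0}" by (rule finite_subset) simp
  have "n = (\<Sum>j<n. a j * vil_M m j)"
    using vil_digit_sum[of n m n] vil_M_gt[of m n, OF m] by (simp add: a)
  also have "\<dots> = (\<Sum>j | a j \<noteq> 0. a j * vil_M m j)"
    using sub by (intro sum.mono_neutral_right) auto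
  finally show "n = (\<Sum>j | a j \<noteq> 0. a j * vil_M m j)" .
qed

lemma space_vil_measure: "space (vil_measure m) = {x. \<forall>k. x k < m k}"
  by (auto simp: vil_measure_def space_PiM space_uniform_count_measure PiE_def Pi_def)

lemma prob_space_vil_measure:
  assumes "\<And>k. 2 \<le> m k"
  shows "prob_space (vil_measure m)"
  unfolding vil_measure_def
proof (rule prob_space_PiM)
  show "prob_space (uniform_count_measure {..<m k})" for k
    using assms[of k] by (intro prob_space_uniform_count_measure) (auto simp: lessThan_empty_iff)
qed

lemma sets_vil_interval: "vil_interval m n x \<in> sets (vil_measure m)"
proof -
  have *: "(\<lambda>y. y j) \<in> measurable (vil_measure m) (count_space UNIV)" for j
  proof -
    have "(\<lambda>y. y j) \<in> measurable (vil_measure m) (uniform_count_measure {..<m j})"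
      unfolding vil_measure_def by (rule measurable_component_singleton) simp
    moreover have "id \<in> measurable (uniform_count_measure {..<m j}) (count_space UNIV)"
      by (simp add: measurable_def sets_uniform_count_measure space_uniform_count_measure)
    ultimately have "id \<circ> (\<lambda>y. y j) \<in> measurable (vil_measure m) (count_space UNIV)"
      by (rule measurable_comp)
    then show ?thesis by (simp add: comp_def)
  qed
  show ?thesis
    unfolding vil_interval_def using * by measurable
qed

lemma subalgebra_vil_filtration: "subalgebra (vil_measure m) (vil_filtration m n)"
proof -
  have sub: "vil_interval m n ` space (vil_measure m) \<subseteq> sets (vil_measure m)"
    using sets_vil_interval by blast
  with sets.space_closed have "vil_interval m n ` space (vil_measure m) \<subseteq> Pow (space (vil_measure m))"
    by blast
  with sub show ?thesis
    unfolding subalgebra_def vil_filtration_def by (simp add: sets.sigma_sets_subset)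
qed

end

theory Submission
  imports Defs
begin

text \<open>
  For (a), the \<open>n\<close>-th Riesz mean only sees a martingale at a finite level, where it splits into
  atoms: functions of mean zero supported in a cell \<open>I\<^sub>N(z)\<close>. On the cell, the weight \<open>log(n+1)\<close>
  absorbs the \<open>L\<^sub>1\<close> norms of the Dirichlet kernels. At a point \<open>x\<close> off the cell, the
  partial sums of index \<open>Q M\<^sub>N + \<rho>\<close>, \<open>0 \<le> \<rho> < M\<^sub>N\<close>, are a unimodular factor times the Fourier
  coefficient of index \<open>Q M\<^sub>N\<close> times \<open>D\<^sub>\<rho>(x - z)\<close>, so that summation by parts over \<open>\<rho>\<close> reduces the
  logarithmic mean to Fejer sums of length at most \<open>M\<^sub>N\<close>. If \<open>x\<close> and \<open>z\<close> differ first in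
  coordinate \<open>s\<close> and next in coordinate \<open>l < N\<close>, these sums are \<open>O(M\<^sub>s M\<^sub>l)\<close> and the complete one vanishes;
  if \<open>s\<close> is the only such coordinate below \<open>N\<close>, they are \<open>O(M\<^sub>s M\<^sub>N)\<close>. The weight and \<open>l\<^sub>n\<close>
  contribute a factor \<open>1 / N\<^sup>2\<close>, whose square root compensates the number of possible \<open>l\<close>.

  For (b), the martingale that is \<open>0\<close> up to level \<open>N\<close> and \<open>M\<^sub>N r\<^sub>N\<close> on \<open>I\<^sub>N(0)\<close> afterwards has
  \<open>H\<^sub>1\<^sub>/\<^sub>2\<close> quasi-norm \<open>1 / M\<^sub>N\<close>, while its Riesz mean of index \<open>M\<^sub>N + M\<^sub>s\<close> is at least of order
  \<open>M\<^sub>s\<^sup>2 / (N M\<^sub>N)\<close> on \<open>I\<^sub>s(0)\<close>. The levels \<open>s \<le> N\<close> contribute equally to the \<open>L\<^sub>1\<^sub>/\<^sub>2\<close>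
  quasi-norm of the maximal function, whose ratio to the \<open>H\<^sub>1\<^sub>/\<^sub>2\<close> quasi-norm is therefore at least
  of order \<open>N / \<phi>(M\<^sub>N\<^sub>+\<^sub>1)\<close>.
\<close>

section \<open>Characters and kernels in the generalized number system\<close>

lemma sum_lessThan_add: "(\<Sum>j<a + b. f j) = (\<Sum>j<a. f j) + (\<Sum>j<b. f (a + j))"
  for f :: "nat \<Rightarrow> 'b::comm_monoid_add"
  by (induction b) (simp_all add: add.assoc)

locale bounded_vilenkin =
  fixes m :: "nat \<Rightarrow> nat" and B :: nat
  assumes m_ge: "2 \<le> m k" and m_le: "m k \<le> B"
begin

abbreviation M where "M \<equiv> vil_M m"

lemma m_pos [simp]: "0 < m k"
  using m_ge[of k] by simp

lemma M_pos [simp]: "0 < M k"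
  by (simp add: vil_M_def prod_pos)

lemma M_neq_0 [simp]: "M k \<noteq> 0"
  using M_pos[of k] by linarith

lemma M_mono: "i \<le> j \<Longrightarrow> M i \<le> M j"
  by (meson M_pos dvd_imp_le vil_M_dvd)

lemma M_Suc_le: "M (Suc k) \<le> B * M k"
  by (simp add: vil_M_Suc m_le)

lemma M_Suc_ge: "2 * M k \<le> M (Suc k)"
  by (simp add: vil_M_Suc m_ge)

lemma B_ge: "2 \<le> B"
  using m_ge[of 0] m_le[of 0] by linarith

lemma less_M: "k < M k"
  by (rule vil_M_gt) (rule m_ge)

lemma two_power_le_M: "2 ^ k \<le> M k"
proof (induction k)
  case (Suc k)
  then show ?case using M_Suc_ge[of k] by simp
qed (simp add: vil_M_0)

section \<open>Digits of \<open>q * M s + r\<close> and the resulting factorization of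
  characters\<close>

lemma digit_eq_0: "n < M K \<Longrightarrow> K \<le> k \<Longrightarrow> vil_digit m n k = 0"
  using M_mono[of K k] by (simp add: vil_digit_def)

lemma digit_less [simp]: "vil_digit m n k < m k"
  by (simp add: vil_digit_def)

lemma digit_mult_add_low:
  assumes "k < s"
  shows "vil_digit m (q * M s + r) k = vil_digit m r k"
proof -
  have "M (Suc k) dvd M s" using assms by (intro vil_M_dvd) simp
  then obtain c where "M s = M k * (m k * c)" by (auto simp: vil_M_Suc dvd_def ac_simps)
  then have "q * M s + r = r + M k * (q * (m k * c))" by (simp add: ac_simps)
  then have "(q * M s + r) div M k = q * (m k * c) + r div M k"
    by (simp only: div_mult_self2[OF M_neq_0])
  then have "(q * M s + r) div M k = r div M k + m k * (q * c)" by (simp add: ac_simps)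
  then show ?thesis by (simp only: vil_digit_def mod_mult_self2)
qed

lemma digit_mult_low: "k < s \<Longrightarrow> vil_digit m (q * M s) k = 0"
  using digit_mult_add_low[of k s q 0] by (simp add: vil_digit_def)

lemma digit_mult_add_high:
  assumes "s \<le> k" "r < M s"
  shows "vil_digit m (q * M s + r) k = vil_digit m (q * M s) k"
proof -
  obtain c where c: "M k = M s * c" using vil_M_dvd[OF assms(1)] by (auto simp: dvd_def)
  show ?thesis using assms(2) by (simp add: vil_digit_def c div_mult2_eq)
qed

text \<open>Characters with the values of the Rademacher functions replaced by free phases \<open>w\<close>: with
  \<open>w k = r\<^sub>k(x) \<cdot> cnj (r\<^sub>k(t))\<close> this is \<open>\<psi>\<^sub>n(x - t)\<close>, without subtraction in \<open>G\<^sub>m\<close>.\<close>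

definition chi :: "(nat \<Rightarrow> complex) \<Rightarrow> nat \<Rightarrow> complex" where
  "chi w n = (\<Prod>k<n. w k ^ vil_digit m n k)"

text \<open>The range \<open>k < n\<close> in \<open>chi\<close> is only one convenient cut-off:
  every \<open>K\<close> with \<open>n < M K\<close> gives the same product, because all digits from
  position \<open>K\<close> on vanish.\<close>

lemma chi_eq:
  assumes "n < M K"
  shows "chi w n = (\<Prod>k<K. w k ^ vil_digit m n k)"
proof (cases "n \<le> K")
  case True
  show ?thesis unfolding chi_def
    by (rule prod.mono_neutral_left) (use True digit_eq_0[OF less_M] in auto)
next
  case False
  show ?thesis unfolding chi_def
    by (rule prod.mono_neutral_right) (use False digit_eq_0[OF assms] in auto)
qed

lemma chi_0 [simp]: "chi w 0 = 1"
  by (simp add: chi_def)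

lemma chi_cong: "n < M K \<Longrightarrow> (\<And>k. k < K \<Longrightarrow> w k = v k) \<Longrightarrow> chi w n = chi v n"
  by (simp add: chi_eq)

lemma chi_mult: "chi (\<lambda>k. w k * v k) n = chi w n * chi v n"
  by (simp add: chi_def power_mult_distrib prod.distrib)

lemma chi_cnj: "chi (\<lambda>k. cnj (w k)) n = cnj (chi w n)"
  by (simp add: chi_def)

text \<open>The nonzero digits of \<open>q * M s\<close> sit at positions from \<open>s\<close> on
  and those of \<open>r\<close> below \<open>s\<close>, so the addition has no carries and the
  product splits.\<close>

lemma chi_mult_add:
  assumes "r < M s"
  shows "chi w (q * M s + r) = chi w (q * M s) * chi w r"
proof -
  define K where "K = q * M s + r"
  have less: "K < M K" "q * M s < M K" "r < M K"
    using less_M[of K] by (auto simp: K_def)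
  have "w k ^ vil_digit m K k = w k ^ vil_digit m (q * M s) k * w k ^ vil_digit m r k" for k
  proof (cases "k < s")
    case True
    then show ?thesis by (simp add: K_def digit_mult_add_low digit_mult_low)
  next
    case False
    then show ?thesis using assms by (simp add: K_def digit_mult_add_high digit_eq_0)
  qed
  then show ?thesis
    unfolding K_def[symmetric] using less by (simp add: chi_eq prod.distrib)
qed

lemma chi_digit:
  assumes "u < m s"
  shows "chi w (u * M s) = w s ^ u"
proof -
  have "u * M s < M (Suc s)" using assms by (simp add: vil_M_Suc)
  moreover have "vil_digit m (u * M s) s = u" using assms by (simp add: vil_digit_def)
  ultimately show ?thesis by (simp add: chi_eq digit_mult_low)
qed

lemma chi_high_cong:
  assumes "\<And>k. s \<le> k \<Longrightarrow> w k = v k"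
  shows "chi w (q * M s) = chi v (q * M s)"
  unfolding chi_def
proof (rule prod.cong[OF refl])
  fix k show "w k ^ vil_digit m (q * M s) k = v k ^ vil_digit m (q * M s) k"
    using assms[of k] digit_mult_low[of k s q] by (cases "k < s") auto
qed

section \<open>Dirichlet kernels\<close>

definition unit_roots :: "(nat \<Rightarrow> complex) \<Rightarrow> bool" where
  "unit_roots w \<longleftrightarrow> (\<forall>k. w k ^ m k = 1)"

lemma unit_rootsD: "unit_roots w \<Longrightarrow> w k ^ m k = 1"
  by (simp add: unit_roots_def)

lemma norm_unit_roots: "unit_roots w \<Longrightarrow> norm (w k) = 1"
  using power_eq_imp_eq_base[of "norm (w k)" "m k" 1] unit_rootsD[of w k]
  by (simp add: norm_power[symmetric])

lemma norm_chi: "unit_roots w \<Longrightarrow> norm (chi w n) = 1"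
  by (simp add: chi_def prod_norm[symmetric] norm_power norm_unit_roots)

definition dir :: "(nat \<Rightarrow> complex) \<Rightarrow> nat \<Rightarrow> complex" where
  "dir w n = (\<Sum>j<n. chi w j)"

lemma dir_mult_add:
  assumes "r \<le> M s"
  shows "dir w (q * M s + r) = dir w (q * M s) + chi w (q * M s) * dir w r"
  unfolding dir_def sum_lessThan_add using assms
  by (simp add: chi_mult_add sum_distrib_left)

lemma dir_mult: "dir w (q * M s) = (\<Sum>i<q. chi w (i * M s)) * dir w (M s)"
proof (induction q)
  case (Suc q)
  have "dir w (Suc q * M s) = dir w (q * M s + M s)" by (simp add: add.commute)
  then show ?case by (simp only: dir_mult_add[OF order_refl] Suc sum.lessThan_Suc distrib_right)
qed (simp add: dir_def)

lemma dir_M_Suc: "dir w (M (Suc s)) = (\<Sum>u<m s. w s ^ u) * dir w (M s)"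
  by (simp add: vil_M_Suc dir_mult chi_digit)

text \<open>The complete geometric sum of a nontrivial \<open>m k\<close>-th root of unity is zero,
  which kills the kernel of index \<open>M (Suc k)\<close>; \<open>dir_M_Suc\<close> then propagates
  the zero to every higher level.\<close>

lemma dir_M_eq_0:
  assumes "unit_roots w" "w k \<noteq> 1" "k < s"
  shows "dir w (M s) = 0"
proof -
  have "(\<Sum>u<m k. w k ^ u) = 0"
    unfolding geometric_sum[OF assms(2)] using unit_rootsD[OF assms(1), of k] by simp
  then have *: "dir w (M (Suc k)) = 0" by (simp only: dir_M_Suc mult_zero_left)
  have "dir w (M (Suc k + d)) = 0" for d
    using * by (induction d) (simp_all add: dir_M_Suc[of _ "Suc (k + _)"])
  from this[of "s - Suc k"] show ?thesis using assms(3) by simp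
qed

text \<open>The \<open>q\<close> complete blocks of length \<open>M s\<close> cancel, so only the
  rest \<open>r\<close> survives.\<close>

lemma dir_split:
  assumes "unit_roots w" "w k \<noteq> 1" "k < s" "r \<le> M s"
  shows "dir w (q * M s + r) = chi w (q * M s) * dir w r"
  using dir_mult_add[OF assms(4), of w q] dir_M_eq_0[OF assms(1-3)] by (simp add: dir_mult)

lemma norm_dir_le: "unit_roots w \<Longrightarrow> norm (dir w n) \<le> real n"
  unfolding dir_def by (rule order_trans[OF norm_sum]) (simp add: norm_chi)

lemma norm_dir_le_M:
  assumes "unit_roots w" "w k \<noteq> 1" "k < s"
  shows "norm (dir w n) \<le> M s"
proof -
  have "dir w (n div M s * M s + n mod M s) = chi w (n div M s * M s) * dir w (n mod M s)"
    by (rule dir_split[OF assms]) (simp add: less_imp_le)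
  then have "norm (dir w n) = norm (dir w (n mod M s))"
    by (simp only: div_mult_mod_eq) (simp add: norm_mult norm_chi[OF assms(1)])
  also have "\<dots> \<le> real (n mod M s)" by (rule norm_dir_le[OF assms(1)])
  also have "\<dots> \<le> M s" by (simp add: less_imp_le)
  finally show ?thesis .
qed

section \<open>Fejer sums\<close>

definition fej :: "(nat \<Rightarrow> complex) \<Rightarrow> nat \<Rightarrow> complex" where
  "fej w n = (\<Sum>j<n. dir w j)"

lemma fej_mult_add:
  assumes "unit_roots w" "w k \<noteq> 1" "k < s" "r \<le> M s"
  shows "fej w (q * M s + r) = fej w (q * M s) + chi w (q * M s) * fej w r"
  unfolding fej_def sum_lessThan_add using assms
  by (simp add: dir_split[OF assms(1-3)] sum_distrib_left)

lemma fej_mult: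
  assumes "unit_roots w" "w k \<noteq> 1" "k < s"
  shows "fej w (q * M s) = (\<Sum>i<q. chi w (i * M s)) * fej w (M s)"
proof (induction q)
  case (Suc q)
  have "fej w (Suc q * M s) = fej w (q * M s + M s)" by (simp add: add.commute)
  then show ?case
    by (simp only: fej_mult_add[OF assms order_refl] Suc sum.lessThan_Suc distrib_right)
qed (simp add: fej_def)

lemma norm_fej_le:
  assumes "unit_roots w" "w k \<noteq> 1" "k < s"
  shows "norm (fej w n) \<le> real n * M s"
proof -
  have "norm (fej w n) \<le> (\<Sum>j<n. norm (dir w j))"
    unfolding fej_def by (rule norm_sum)
  also have "\<dots> \<le> (\<Sum>j<n. real (M s))"
    by (intro sum_mono norm_dir_le_M[OF assms])
  finally show ?thesis by simp
qed

text \<open>Setting the first \<open>s\<close> phases to 1 turns a sum of characters over the multiples of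
  \<open>M s\<close> into a Dirichlet kernel.\<close>

lemma sum_chi_mult:
  defines "w' \<equiv> \<lambda>w s k. if k < s then 1 else w k"
  shows "(\<Sum>i<q. chi w (i * M s)) * M s = dir (w' w s) (q * M s)"
proof -
  have "chi (w' w s) (i * M s) = chi w (i * M s)" for i
    by (rule chi_high_cong) (simp add: w'_def)
  moreover have "dir (w' w s) (M s) = M s"
    by (simp add: dir_def chi_eq w'_def)
  ultimately show ?thesis by (simp add: dir_mult)
qed

lemma unit_roots_tail: "unit_roots w \<Longrightarrow> unit_roots (\<lambda>k. if k < s then 1 else w k)"
  by (simp add: unit_roots_def)

text \<open>Cut \<open>n\<close> into \<open>q\<close> blocks of length \<open>M (Suc s)\<close> and
  a rest. The blocks contribute \<open>fej w (M (Suc s))\<close>, at most the square of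
  \<open>M (Suc s)\<close>, times a character sum over multiples of \<open>M (Suc s)\<close>. That
  sum is a tail kernel which still sees \<open>w l \<noteq> 1\<close>, hence is at most
  \<open>M (Suc l) / M (Suc s)\<close>. The rest is bounded termwise.\<close>

lemma norm_fej_two_le:
  assumes w: "unit_roots w" and s: "w s \<noteq> 1" and l: "w l \<noteq> 1" "s < l"
  shows "norm (fej w n) \<le> 2 * real (M (Suc s)) * M (Suc l)"
proof -
  let ?M = "M (Suc s)"
  define q r where "q = n div ?M" and "r = n mod ?M"
  have r: "r < ?M" by (simp add: r_def)
  have n: "n = q * ?M + r" unfolding q_def r_def by (rule div_mult_mod_eq[symmetric])
  have "norm (\<Sum>i<q. chi w (i * ?M)) * ?M = norm ((\<Sum>i<q. chi w (i * ?M)) * ?M)"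
    by (simp add: norm_mult)
  also have "\<dots> \<le> M (Suc l)"
    unfolding sum_chi_mult
    by (rule norm_dir_le_M[where k = l]) (use unit_roots_tail[OF w] l in auto)
  finally have 1: "norm (\<Sum>i<q. chi w (i * ?M)) * ?M \<le> M (Suc l)" .
  have "norm (fej w (q * ?M)) = norm (\<Sum>i<q. chi w (i * ?M)) * norm (fej w ?M)"
    by (simp add: fej_mult[OF w s] norm_mult)
  also have "\<dots> \<le> norm (\<Sum>i<q. chi w (i * ?M)) * (?M * ?M)"
    by (intro mult_left_mono) (use norm_fej_le[OF w s lessI, of ?M] in auto)
  also have "\<dots> \<le> M (Suc l) * real ?M"
    using mult_right_mono[OF 1, of ?M] by (simp add: mult.assoc)
  finally have 2: "norm (fej w (q * ?M)) \<le> M (Suc l) * real ?M" .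
  have "norm (chi w (q * ?M) * fej w r) \<le> real r * ?M"
    using norm_fej_le[OF w s lessI, of r] by (simp add: norm_mult norm_chi[OF w])
  also have "\<dots> \<le> M (Suc l) * real ?M"
    using r M_mono[of "Suc s" "Suc l"] l by (intro mult_right_mono) simp_all
  finally have "norm (chi w (q * ?M) * fej w r) \<le> M (Suc l) * real ?M" .
  with 2 show ?thesis
    unfolding n fej_mult_add[OF w s lessI less_imp_le[OF r]]
    using norm_triangle_ineq[of "fej w (q * ?M)" "chi w (q * ?M) * fej w r"]
    by (simp add: algebra_simps)
qed

text \<open>Here the blocks fill \<open>M N\<close> exactly, and the character sum over them is a
  tail kernel of index \<open>M N\<close>, which vanishes because \<open>l < N\<close>.\<close>

lemma fej_M_eq_0:
  assumes w: "unit_roots w" and s: "w s \<noteq> 1" and l: "w l \<noteq> 1" "s < l" "l < N"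
  shows "fej w (M N) = 0"
proof -
  obtain q where q: "M N = q * M (Suc s)"
    using vil_M_dvd[of "Suc s" N m] l by (auto simp: dvd_def mult.commute)
  have "(\<Sum>i<q. chi w (i * M (Suc s))) * M (Suc s) = 0"
    unfolding sum_chi_mult q[symmetric]
    by (rule dir_M_eq_0[where k = l]) (use unit_roots_tail[OF w] l in auto)
  then show ?thesis by (simp add: q fej_mult[OF w s lessI])
qed

end

section \<open>Averages over the cells of a level\<close>

definition agree :: "nat \<Rightarrow> (nat \<Rightarrow> nat) \<Rightarrow> (nat \<Rightarrow> nat) \<Rightarrow> bool" where
  "agree n x y \<longleftrightarrow> (\<forall>j<n. x j = y j)"

lemma agree_refl [simp]: "agree n x x"
  by (simp add: agree_def)

lemma agree_0 [simp]: "agree 0 x y"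
  by (simp add: agree_def)

lemma agree_sym: "agree n x y \<Longrightarrow> agree n y x"
  by (simp add: agree_def)

lemma agree_trans: "agree n x y \<Longrightarrow> agree n y z \<Longrightarrow> agree n x z"
  by (simp add: agree_def)

lemma agree_mono: "agree n x y \<Longrightarrow> k \<le> n \<Longrightarrow> agree k x y"
  by (simp add: agree_def)

lemma agree_cong: "agree n y z \<Longrightarrow> k \<le> n \<Longrightarrow> agree k x y \<longleftrightarrow> agree k x z"
  by (auto simp: agree_def)

context bounded_vilenkin
begin

abbreviation X where "X \<equiv> space (vil_measure m)"

lemma X_iff: "x \<in> X \<longleftrightarrow> (\<forall>k. x k < m k)"
  by (simp add: space_vil_measure)

lemma digit_in_X [simp]: "vil_digit m t \<in> X"
  by (simp add: X_iff)

text \<open>The digit sequences of the numbers \<open>t < M L\<close> are representatives of the cells of level \<open>L\<close>.\<close>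

definition avg :: "nat \<Rightarrow> ((nat \<Rightarrow> nat) \<Rightarrow> 'b::real_vector) \<Rightarrow> 'b" where
  "avg L g = (\<Sum>t<M L. g (vil_digit m t)) /\<^sub>R real (M L)"

text \<open>Pointwise form of measurability at level \<open>L\<close>, tested at points of the group
  only because functions are total on sequences. \<open>lev_of_measurable\<close> and
  \<open>measurable_of_lev\<close> connect it with the filtration.\<close>

definition lev :: "nat \<Rightarrow> ((nat \<Rightarrow> nat) \<Rightarrow> 'b) \<Rightarrow> bool" where
  "lev L g \<longleftrightarrow> (\<forall>x\<in>X. \<forall>y\<in>X. agree L x y \<longrightarrow> g x = g y)"

lemma levD: "lev L g \<Longrightarrow> agree L x y \<Longrightarrow> x \<in> X \<Longrightarrow> y \<in> X \<Longrightarrow> g x = g y"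
  unfolding lev_def by blast

lemma lev_mono:
  assumes "lev k g" "k \<le> L"
  shows "lev L g"
  unfolding lev_def
proof safe
  fix x y assume "x \<in> X" "y \<in> X" "agree L x y"
  then show "g x = g y"
    by (intro levD[OF assms(1)] agree_mono[OF _ assms(2)])
qed

lemma lev_agree:
  assumes "n \<le> L"
  shows "lev L (\<lambda>y. F (agree n x y))"
  unfolding lev_def
proof safe
  fix y z assume "agree L y z"
  from agree_cong[OF this assms] show "F (agree n x y) = F (agree n x z)" by (simp only:)
qed

lemma lev_comp: "lev L g \<Longrightarrow> lev L (\<lambda>x. F (g x))"
  unfolding lev_def by presburger

lemma lev_mult: "lev L g \<Longrightarrow> lev L h \<Longrightarrow> lev L (\<lambda>x. g x * h x)"
  unfolding lev_def by presburger

lemma lev_const: "lev L (\<lambda>x. c)"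
  by (simp add: lev_def)

text \<open>Cutting \<open>x\<close> off after \<open>L\<close> coordinates leaves an admissible
  digit sequence, hence the digits of a number below \<open>M L\<close>.\<close>

lemma digit_exists:
  assumes "x \<in> X"
  obtains t where "t < M L" "agree L x (vil_digit m t)"
proof -
  define a where "a j = (if j < L then x j else 0)" for j
  have a: "a j < m j" for j using assms by (auto simp: a_def X_iff)
  define t where "t = (\<Sum>j<L. a j * M j)"
  have "{j. a j \<noteq> 0} \<subseteq> {..<L}" by (auto simp: a_def split: if_splits)
  then have "finite {j. a j \<noteq> 0}" "t = (\<Sum>j | a j \<noteq> 0. a j * M j)"
    by (auto simp: t_def intro: finite_subset intro!: sum.mono_neutral_right)
  then have "a = vil_digit m t"
    using vil_digit_iff[of m a t, OF m_ge] a by blast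
  then have "agree L x (vil_digit m t)" by (metis agree_def a_def)
  moreover have "t < M L" unfolding t_def by (rule vil_sum_less[OF a])
  ultimately show ?thesis using that by blast
qed

lemma digit_unique:
  assumes "t < M L" "u < M L" "agree L (vil_digit m t) (vil_digit m u)"
  shows "t = u"
  using vil_digit_sum[of t m L] vil_digit_sum[of u m L] assms by (simp add: agree_def)

text \<open>Exactly one representative lies in the cell of \<open>x\<close>. The expansion into
  indicators of cells reduces integrability, measurability and orthogonality to single
  cells.\<close>

lemma lev_expand:
  fixes g :: "(nat \<Rightarrow> nat) \<Rightarrow> 'b::real_vector"
  assumes "lev L g" "x \<in> X"
  shows "g x = (\<Sum>t<M L. of_bool (agree L (vil_digit m t) x) *\<^sub>R g (vil_digit m t))"
proof -
  obtain t where t: "t < M L" "agree L x (vil_digit m t)"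
    using digit_exists[OF assms(2)] .
  have "agree L (vil_digit m u) x \<longleftrightarrow> u = t" if "u < M L" for u
    using digit_unique[OF that t(1)] t(2) agree_sym agree_trans by blast
  then have "(\<Sum>u<M L. of_bool (agree L (vil_digit m u) x) *\<^sub>R g (vil_digit m u))
      = (\<Sum>u<M L. if u = t then g (vil_digit m u) else 0)"
    by (intro sum.cong) auto
  also have "\<dots> = g x"
    using t levD[OF assms(1) t(2) assms(2)] by simp
  finally show ?thesis ..
qed

section \<open>Measure of the cells, and integrals as averages\<close>

lemma vil_interval_eq: "vil_interval m n x = {y \<in> X. agree n x y}"
  unfolding vil_interval_def agree_def by (rule Collect_cong) metis

lemma measure_interval:
  assumes "x \<in> X"
  shows "measure (vil_measure m) (vil_interval m n x) = 1 / M n"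
proof -
  let ?U = "\<lambda>k. uniform_count_measure {..<m k}"
  have "vil_interval m n x = prod_emb UNIV ?U {..<n} (\<Pi>\<^sub>E j\<in>{..<n}. {x j})"
    using assms by (auto simp: vil_interval_def X_iff prod_emb_def space_uniform_count_measure
      PiE_def Pi_def extensional_def)
  also have "emeasure (vil_measure m) \<dots> = (\<Prod>j<n. emeasure (?U j) {x j})"
    unfolding vil_measure_def
  proof (rule emeasure_PiM_emb)
    show "prob_space (?U k)" for k
      by (rule prob_space_uniform_count_measure) (simp_all add: lessThan_empty_iff)
  qed (use assms in \<open>auto simp: X_iff sets_uniform_count_measure\<close>)
  also have "\<dots> = (\<Prod>j<n. ennreal (1 / m j))"
    using assms by (intro prod.cong) (auto simp: X_iff emeasure_uniform_count_measure)
  also have "\<dots> = ennreal (1 / M n)"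
    by (simp add: prod_ennreal vil_M_def prod_dividef)
  finally show ?thesis by (simp add: measure_def)
qed

sublocale prob_space "vil_measure m"
  by (rule prob_space_vil_measure) (rule m_ge)

lemma
  fixes g :: "(nat \<Rightarrow> nat) \<Rightarrow> 'b::{banach, second_countable_topology}"
  assumes "lev L g"
  shows integrable_lev: "integrable (vil_measure m) g"
    and integral_lev: "integral\<^sup>L (vil_measure m) g = avg L g"
proof -
  let ?h = "\<lambda>x. \<Sum>t<M L. indicator (vil_interval m L (vil_digit m t)) x *\<^sub>R g (vil_digit m t)"
  have eq: "g x = ?h x" if "x \<in> X" for x
    using lev_expand[OF assms that] that
    by (simp add: vil_interval_eq indicator_def)
  have int: "integrable (vil_measure m)
      (\<lambda>x. indicator (vil_interval m L (vil_digit m t)) x *\<^sub>R g (vil_digit m t))" for t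
    by (intro integrable_scaleR_left) (simp add: sets_vil_interval emeasure_eq_measure)
  have "integrable (vil_measure m) g \<longleftrightarrow> integrable (vil_measure m) ?h"
    by (rule Bochner_Integration.integrable_cong[OF refl eq])
  then show "integrable (vil_measure m) g"
    by (simp only:) (rule Bochner_Integration.integrable_sum, rule int)
  have "integral\<^sup>L (vil_measure m) g = integral\<^sup>L (vil_measure m) ?h"
    by (rule Bochner_Integration.integral_cong[OF refl eq])
  also have "\<dots> = (\<Sum>t<M L. measure (vil_measure m) (vil_interval m L (vil_digit m t))
      *\<^sub>R g (vil_digit m t))"
  proof (subst Bochner_Integration.integral_sum[OF int], rule sum.cong[OF refl])
    fix t
    show "(\<integral>x. indicator (vil_interval m L (vil_digit m t)) x *\<^sub>R g (vil_digit m t) \<partial>vil_measure m)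
        = measure (vil_measure m) (vil_interval m L (vil_digit m t)) *\<^sub>R g (vil_digit m t)"
      using sets.sets_into_space[OF sets_vil_interval]
      by (simp add: emeasure_eq_measure Int_absorb2 sets_vil_interval)
  qed
  also have "\<dots> = avg L g"
    by (simp add: measure_interval avg_def scaleR_sum_right divide_inverse)
  finally show "integral\<^sup>L (vil_measure m) g = avg L g" .
qed

lemma nn_integral_lev:
  fixes g :: "(nat \<Rightarrow> nat) \<Rightarrow> real"
  assumes "lev L g" "\<And>x. x \<in> X \<Longrightarrow> 0 \<le> g x"
  shows "(\<integral>\<^sup>+x. ennreal (g x) \<partial>vil_measure m) = ennreal (avg L g)"
  unfolding integral_lev[OF assms(1), symmetric]
  by (rule nn_integral_eq_integral[OF integrable_lev[OF assms(1)]]) (simp add: assms(2))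

section \<open>Calculus of averages\<close>

lemma avg_add: "avg L (\<lambda>x. f x + g x) = avg L f + avg L g"
  by (simp add: avg_def sum.distrib scaleR_right_distrib)

lemma avg_diff: "avg L (\<lambda>x. f x - g x) = avg L f - avg L g"
  by (simp add: avg_def sum_subtractf scaleR_right_diff_distrib)

lemma avg_sum: "avg L (\<lambda>x. \<Sum>i\<in>I. f i x) = (\<Sum>i\<in>I. avg L (f i))"
  unfolding avg_def by (subst sum.swap) (simp only: scaleR_sum_right)

lemma avg_mult_left: "avg L (\<lambda>x. c * f x) = c * avg L f" for c :: "'b::real_algebra"
  by (simp add: avg_def sum_distrib_left)

lemma avg_mult_right: "avg L (\<lambda>x. f x * c) = avg L f * c" for c :: "'b::real_algebra"
  by (simp add: avg_def sum_distrib_right)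

lemma avg_const [simp]: "avg L (\<lambda>x. c) = c"
  by (simp add: avg_def sum_constant_scaleR)

lemma avg_cong: "(\<And>x. x \<in> X \<Longrightarrow> f x = g x) \<Longrightarrow> avg L f = avg L g"
  by (simp add: avg_def)

lemma avg_mono: "(\<And>x. x \<in> X \<Longrightarrow> f x \<le> g x) \<Longrightarrow> avg L f \<le> avg L (g :: _ \<Rightarrow> real)"
  by (auto simp: avg_def intro!: mult_left_mono sum_mono)

lemma avg_nonneg: "(\<And>x. x \<in> X \<Longrightarrow> 0 \<le> f x) \<Longrightarrow> 0 \<le> avg L (f :: _ \<Rightarrow> real)"
  using avg_mono[of "\<lambda>_. 0" f L] by simp

lemma norm_avg: "norm (avg L f) \<le> avg L (\<lambda>x. norm (f x))" for f :: "_ \<Rightarrow> 'b::real_normed_vector"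
  by (auto simp: avg_def intro!: mult_left_mono norm_sum)

lemma avg_lev_eq:
  fixes g :: "_ \<Rightarrow> 'b::{banach, second_countable_topology}"
  assumes "lev k g" "k \<le> L"
  shows "avg L g = avg k g"
  using integral_lev[OF assms(1)] integral_lev[OF lev_mono[OF assms]] by simp

lemma avg_agree:
  assumes "x \<in> X" "n \<le> L"
  shows "avg L (\<lambda>y. of_bool (agree n x y) :: real) = 1 / M n"
proof -
  have "avg L (\<lambda>y. of_bool (agree n x y) :: real)
      = (\<integral>y. of_bool (agree n x y) \<partial>vil_measure m)"
    by (rule integral_lev[symmetric, OF lev_agree[OF assms(2)]])
  also have "\<dots> = (\<integral>y. indicator (vil_interval m n x) y \<partial>vil_measure m)"
    by (rule Bochner_Integration.integral_cong) (auto simp: vil_interval_eq)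
  also have "\<dots> = 1 / M n"
    using sets.sets_into_space[OF sets_vil_interval]
    by (simp add: measure_interval[OF assms(1)] Int_absorb2)
  finally show ?thesis .
qed

text \<open>\<open>h\<close> is a linear combination of indicators of cells of level
  \<open>n\<close>, against each of which \<open>d\<close> averages to zero. In this way martingale
  increments become orthogonal to all functions of the past.\<close>

lemma avg_lev_mult_eq_0:
  fixes h d :: "_ \<Rightarrow> complex"
  assumes "lev n h" and "\<And>x. x \<in> X \<Longrightarrow> avg L (\<lambda>y. of_bool (agree n x y) * d y) = 0"
  shows "avg L (\<lambda>y. h y * d y) = 0"
proof -
  have "avg L (\<lambda>y. h y * d y)
      = avg L (\<lambda>y. \<Sum>t<M n. h (vil_digit m t) * (of_bool (agree n (vil_digit m t) y) * d y))"
  proof (rule avg_cong)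
    fix x assume "x \<in> X"
    then have "h x * d x = (\<Sum>t<M n. of_bool (agree n (vil_digit m t) x) *\<^sub>R h (vil_digit m t)) * d x"
      by (simp only: lev_expand[OF assms(1)])
    also have "\<dots> = (\<Sum>t<M n. h (vil_digit m t) * (of_bool (agree n (vil_digit m t) x) * d x))"
      unfolding sum_distrib_right by (intro sum.cong) auto
    finally show "h x * d x = (\<Sum>t<M n. h (vil_digit m t) * (of_bool (agree n (vil_digit m t) x) * d x))" .
  qed
  also have "\<dots> = 0"
    by (subst avg_sum, subst avg_mult_left) (simp add: assms(2))
  finally show ?thesis .
qed

end

section \<open>Partial sums and Riesz means of functions of finitely many coordinates\<close>

lemma abel_summation:
  fixes d :: "nat \<Rightarrow> complex" and b :: "nat \<Rightarrow> real"
  shows "(\<Sum>i<R. d i * b i) = (\<Sum>i<R. d i) * b R + (\<Sum>j<R. (\<Sum>i<Suc j. d i) * (b j - b (Suc j)))"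
  by (induction R) (simp_all add: algebra_simps)

text \<open>The complete sum is kept as a separate term instead of being absorbed into
  \<open>H\<close>, so that it drops out when it vanishes.\<close>

lemma norm_abel_le:
  fixes d :: "nat \<Rightarrow> complex" and b :: "nat \<Rightarrow> real"
  assumes b: "\<And>j. j < R \<Longrightarrow> b (Suc j) \<le> b j" and "0 \<le> b R"
    and H: "\<And>n. n \<le> R \<Longrightarrow> norm (\<Sum>i<n. d i) \<le> H"
  shows "norm (\<Sum>i<R. d i * b i) \<le> norm (\<Sum>i<R. d i) * b R + H * (b 0 - b R)"
proof -
  have "norm (\<Sum>i<R. d i * b i)
      \<le> norm ((\<Sum>i<R. d i) * b R) + norm (\<Sum>j<R. (\<Sum>i<Suc j. d i) * (b j - b (Suc j)))"
    by (subst abel_summation) (rule norm_triangle_ineq)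
  also have "norm (\<Sum>j<R. (\<Sum>i<Suc j. d i) * (b j - b (Suc j))) \<le> (\<Sum>j<R. H * (b j - b (Suc j)))"
  proof (rule sum_norm_le)
    fix j assume "j \<in> {..<R}"
    then have "0 \<le> b j - b (Suc j)" "norm (\<Sum>i<Suc j. d i) \<le> H"
      using b[of j] H[of "Suc j"] by auto
    moreover from this(1) have "norm ((b j :: complex) - b (Suc j)) = b j - b (Suc j)"
      by (simp only: of_real_diff[symmetric] norm_of_real abs_of_nonneg)
    ultimately show "norm ((\<Sum>i<Suc j. d i) * (b j - b (Suc j))) \<le> H * (b j - b (Suc j))"
      unfolding norm_mult by (simp add: mult_right_mono)
  qed
  also have "(\<Sum>j<R. H * (b j - b (Suc j))) = H * (b 0 - b R)"
    by (simp only: sum_distrib_left[symmetric] sum_lessThan_telescope')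
  finally show ?thesis using assms(2) by (simp add: norm_mult)
qed

lemma norm_abel_block_le:
  fixes d :: "nat \<Rightarrow> complex"
  assumes H: "\<And>n. n \<le> R \<Longrightarrow> norm (\<Sum>i<n. d i) \<le> H" and a: "1 \<le> a"
  shows "norm (\<Sum>i<R. d i / of_nat (a + i))
           \<le> norm (\<Sum>i<R. d i) / real (a + R) + H * (1 / real a - 1 / real (a + R))"
proof -
  have "(\<Sum>i<R. d i / of_nat (a + i)) = (\<Sum>i<R. d i * of_real (1 / real (a + i)))"
    by (simp add: field_simps)
  also have "norm \<dots> \<le> norm (\<Sum>i<R. d i) * (1 / real (a + R)) + H * (1 / real (a + 0) - 1 / real (a + R))"
    by (rule norm_abel_le) (use a H in \<open>auto simp: field_simps\<close>)
  finally show ?thesis by simp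
qed

lemma norm_abel_block_le':
  fixes d :: "nat \<Rightarrow> complex"
  assumes H: "\<And>n. n \<le> R \<Longrightarrow> norm (\<Sum>i<n. d i) \<le> H" and a: "1 \<le> a"
  shows "norm (\<Sum>i<R. d i / of_nat (a + i)) \<le> H / a"
proof -
  have "norm (\<Sum>i<R. d i) / real (a + R) \<le> H / real (a + R)"
    using H[of R] by (intro divide_right_mono) auto
  with norm_abel_block_le[of R d H a, OF H a] show ?thesis
    by (simp add: algebra_simps)
qed

lemma sum_mult_add:
  fixes f :: "nat \<Rightarrow> 'b::comm_monoid_add"
  shows "(\<Sum>k<q * M + R. f k) = (\<Sum>Q<q. \<Sum>i<M. f (Q * M + i)) + (\<Sum>i<R. f (q * M + i))"
proof -
  have "(\<Sum>k<q * M. f k) = (\<Sum>Q<q. \<Sum>i<M. f (Q * M + i))"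
    using sum_lessThan_add[of f _ M] by (induction q) (simp_all add: add.commute[of M])
  then show ?thesis by (simp add: sum_lessThan_add)
qed

text \<open>Within block \<open>Q\<close> the factor \<open>c\<close> is constant. Block 0 drops out
  because \<open>c 0 = 0\<close>, the other complete blocks are controlled by \<open>v\<close>, and
  the incomplete last one by summation by parts with denominators at least \<open>M\<close>.\<close>

lemma norm_block_sum_le:
  fixes c d :: "nat \<Rightarrow> complex" and v :: "nat \<Rightarrow> real"
  assumes M: "0 < M" and c0: "c 0 = 0" and c: "\<And>Q. norm (c Q) \<le> K"
    and H: "\<And>n. n \<le> M \<Longrightarrow> norm (\<Sum>i<n. d i) \<le> H"
    and v: "\<And>Q. 1 \<le> Q \<Longrightarrow> norm (\<Sum>i<M. d i / of_nat (Q * M + i)) \<le> v Q"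
  shows "norm (\<Sum>k<n. c (k div M) * d (k mod M) / of_nat k)
           \<le> K * ((\<Sum>Q\<in>{1..<n div M}. v Q) + H / M)"
proof -
  define q R where "q = n div M" and "R = n mod M"
  have n: "n = q * M + R" unfolding q_def R_def by (rule div_mult_mod_eq[symmetric])
  have R: "R < M" using M by (simp add: R_def)
  have K: "0 \<le> K" using c[of 0] c0 by simp
  have H0: "0 \<le> H" using H[of 0] by simp
  let ?V = "\<lambda>Q R. \<Sum>i<R. d i / of_nat (Q * M + i)"
  have V: "(\<Sum>i<R. c ((Q * M + i) div M) * d ((Q * M + i) mod M) / of_nat (Q * M + i)) = c Q * ?V Q R"
    if "R \<le> M" for Q R
    unfolding sum_distrib_left using M that by (intro sum.cong) auto
  have "(\<Sum>k<n. c (k div M) * d (k mod M) / of_nat k) = (\<Sum>Q<q. c Q * ?V Q M) + c q * ?V q R"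
    unfolding n sum_mult_add using V[OF order_refl] V[OF less_imp_le[OF R]] by simp
  also have "(\<Sum>Q<q. c Q * ?V Q M) = (\<Sum>Q\<in>{1..<q}. c Q * ?V Q M)"
    by (rule sum.mono_neutral_right) (use c0 in \<open>auto simp: not_le\<close>)
  also have "norm (\<dots> + c q * ?V q R) \<le> (\<Sum>Q\<in>{1..<q}. K * v Q) + K * (H / M)"
  proof (intro norm_triangle_mono sum_norm_le)
    fix Q assume "Q \<in> {1..<q}"
    then show "norm (c Q * ?V Q M) \<le> K * v Q"
      unfolding norm_mult using v[of Q] by (intro mult_mono c K) auto
  next
    show "norm (c q * ?V q R) \<le> K * (H / M)"
    proof (cases "q = 0")
      case True
      then show ?thesis using c0 K H0 by simp
    next
      case False
      then have "M \<le> q * M" by (cases q) auto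
      then have "1 \<le> q * M" using M by linarith
      then have "norm (?V q R) \<le> H / real (q * M)"
        by (intro norm_abel_block_le' H) (use R in auto)
      also have "\<dots> \<le> H / M"
        using M H0 \<open>M \<le> q * M\<close> by (intro divide_left_mono) (auto simp flip: of_nat_mult)
      finally show ?thesis unfolding norm_mult by (intro mult_mono c K) auto
    qed
  qed
  finally show ?thesis
    by (simp add: q_def sum_distrib_left distrib_left)
qed

lemma sum_telescope_inverse:
  "(\<Sum>Q\<in>{1..<q}. 1 / real Q - 1 / (real Q + 1)) \<le> 1"
proof (cases "1 \<le> q")
  case True
  have "(\<Sum>Q\<in>{1..<q}. 1 / real Q - 1 / (real Q + 1)) = 1 - 1 / real q"
    using True by (induction q rule: dec_induct) simp_all
  then show ?thesis by simp
qed simp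

lemma sum_inverse_eq_harm: "(\<Sum>k=1..n. 1 / real k) = harm n"
  by (simp add: harm_def divide_inverse)

section \<open>Vilenkin characters, partial sums and the logarithmic bound\<close>

context bounded_vilenkin
begin

abbreviation \<psi> where "\<psi> \<equiv> vil_psi m"
abbreviation rad where "rad \<equiv> vil_rademacher m"

lemma rad_power: "rad k x ^ m k = 1"
proof -
  have "rad k x ^ m k = exp (of_nat (m k) * (2 * of_real pi * \<i> * of_nat (x k) / of_nat (m k)))"
    unfolding vil_rademacher_def by (rule exp_of_nat_mult[symmetric])
  also have "\<dots> = exp (of_nat (x k) * (2 * of_real pi * \<i>))"
    using m_ge[of k] by (auto simp: mult_ac)
  also have "\<dots> = 1"
    unfolding exp_of_nat_mult by simp
  finally show ?thesis .
qed

lemma psi_eq_chi: "\<psi> n x = chi (\<lambda>k. rad k x) n"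
  unfolding vil_psi_def chi_def
  by (rule prodinf_finite) (use digit_eq_0[OF less_M] in auto)

lemma norm_psi [simp]: "norm (\<psi> n x) = 1"
  unfolding psi_eq_chi by (rule norm_chi) (simp add: unit_roots_def rad_power)

lemma psi_0 [simp]: "\<psi> 0 x = 1"
  by (simp add: psi_eq_chi)

lemma psi_agree:
  assumes "agree L x y" "j < M L"
  shows "\<psi> j x = \<psi> j y"
  unfolding psi_eq_chi using assms(1)
  by (intro chi_cong[OF assms(2)]) (simp add: agree_def vil_rademacher_def)

lemma lev_psi: "j < M L \<Longrightarrow> lev L (\<psi> j)"
  unfolding lev_def using psi_agree by blast

definition phase :: "(nat \<Rightarrow> nat) \<Rightarrow> (nat \<Rightarrow> nat) \<Rightarrow> nat \<Rightarrow> complex" where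
  "phase x t k = rad k x * cnj (rad k t)"

lemma unit_roots_phase: "unit_roots (phase x t)"
  by (simp add: unit_roots_def phase_def power_mult_distrib rad_power flip: complex_cnj_power)

lemma chi_phase: "chi (phase x t) j = \<psi> j x * cnj (\<psi> j t)"
  unfolding phase_def chi_mult chi_cnj psi_eq_chi ..

text \<open>Equality of the two roots of unity would make the coordinates congruent modulo
  \<open>m k\<close>, and both lie below \<open>m k\<close>.\<close>

lemma phase_neq_1:
  assumes "x \<in> X" "t \<in> X" "x k \<noteq> t k"
  shows "phase x t k \<noteq> 1"
proof
  assume 1: "phase x t k = 1"
  have n: "norm (rad k t) = 1"
    using norm_unit_roots[of "\<lambda>k. rad k t" k] by (simp add: unit_roots_def rad_power)
  have "rad k x = rad k x * (cnj (rad k t) * rad k t)"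
    using n by (simp add: complex_norm_square[symmetric] mult.commute)
  also have "\<dots> = rad k t" using 1 by (simp add: phase_def mult.assoc[symmetric])
  finally have "rad k x = rad k t" .
  then obtain n :: int where "2 * of_real pi * \<i> * of_nat (x k) / of_nat (m k)
      = 2 * of_real pi * \<i> * of_nat (t k) / of_nat (m k) + (of_int (2 * n) * pi) * \<i>"
    unfolding vil_rademacher_def exp_eq by blast
  then have "(2 * of_real pi * \<i>) * (of_nat (x k) / of_nat (m k))
      = (2 * of_real pi * \<i>) * (of_nat (t k) / of_nat (m k) + of_int n)"
    by (simp add: algebra_simps)
  then have "of_nat (x k) / of_nat (m k) = (of_nat (t k) / of_nat (m k) + of_int n :: complex)"
    by (subst (asm) mult_cancel_left) simp
  then have "of_nat (x k) = (of_nat (t k) + of_int n * of_nat (m k) :: complex)"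
    using m_pos[of k] by (simp add: field_simps)
  then have "(of_int (int (x k)) :: complex) = of_int (int (t k) + n * int (m k))"
    by simp
  then have "int (x k) = int (t k) + n * int (m k)"
    by (simp only: of_int_eq_iff)
  then have "int (x k) mod int (m k) = int (t k) mod int (m k)" by simp
  then show False using assms by (simp add: X_iff)
qed

text \<open>\<open>coef\<close>, \<open>psum\<close> and \<open>riesz\<close> are finite-level
  counterparts of the coefficients, partial sums and Riesz means of a martingale, free of integrals
  and limits; \<open>riesz_mean_eq\<close> shows that they agree for indices up to
  \<open>L\<close>.\<close>

definition coef :: "nat \<Rightarrow> ((nat \<Rightarrow> nat) \<Rightarrow> complex) \<Rightarrow> nat \<Rightarrow> complex" where
  "coef L a j = avg L (\<lambda>t. a t * cnj (\<psi> j t))"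

definition psum :: "nat \<Rightarrow> ((nat \<Rightarrow> nat) \<Rightarrow> complex) \<Rightarrow> nat \<Rightarrow> (nat \<Rightarrow> nat) \<Rightarrow> complex" where
  "psum L a n x = (\<Sum>k<n. coef L a k * \<psi> k x)"

definition riesz :: "nat \<Rightarrow> ((nat \<Rightarrow> nat) \<Rightarrow> complex) \<Rightarrow> nat \<Rightarrow> (nat \<Rightarrow> nat) \<Rightarrow> complex" where
  "riesz L a n x = (\<Sum>k=1..n. psum L a k x / of_nat k) / of_real (\<Sum>k=1..n. 1 / real k)"

lemma coef_add: "coef L (\<lambda>x. f x + g x) j = coef L f j + coef L g j"
  unfolding coef_def distrib_right by (rule avg_add)

lemma riesz_add: "riesz L (\<lambda>x. f x + g x) n x = riesz L f n x + riesz L g n x"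
  by (simp add: riesz_def psum_def coef_add distrib_right sum.distrib add_divide_distrib)

lemma riesz_0: "riesz L (\<lambda>x. 0) n x = 0"
  by (simp add: riesz_def psum_def coef_def)

text \<open>Convolution with the Dirichlet kernel, the difference of \<open>x\<close> and
  \<open>t\<close> being encoded by \<open>phase x t\<close>.\<close>

lemma psum_eq_avg: "psum L a n x = avg L (\<lambda>t. a t * dir (phase x t) n)"
  unfolding psum_def coef_def dir_def chi_phase sum_distrib_left avg_sum avg_mult_right[symmetric]
  by (simp add: mult_ac)

lemma riesz_eq: "riesz L a n x = (\<Sum>k=1..n. psum L a k x / of_nat k) / of_real (harm n)"
  by (simp only: riesz_def sum_inverse_eq_harm)

lemma norm_riesz_eq: "norm (riesz L a n x) = norm (\<Sum>k=1..n. psum L a k x / of_nat k) / harm n"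
  unfolding riesz_eq norm_divide norm_of_real abs_harm ..

text \<open>The term that counts is the one for the first coordinate \<open>s\<close> where
  \<open>x\<close> and \<open>t\<close> differ, or \<open>s = K\<close> if there is none below
  \<open>K\<close>. Summing over all levels gives a majorant whose average in \<open>t\<close> is
  explicit.\<close>

lemma dir_phase_le:
  assumes "x \<in> X" "t \<in> X" "n \<le> M K"
  shows "norm (dir (phase x t) n) \<le> (\<Sum>s\<le>K. real B * M s * of_bool (agree s x t))"
proof -
  obtain s where s: "s \<le> K" "agree s x t" "norm (dir (phase x t) n) \<le> real B * M s"
  proof (cases "agree K x t")
    case True
    have "norm (dir (phase x t) n) \<le> real n"
      by (rule norm_dir_le[OF unit_roots_phase])
    also have "\<dots> \<le> M K" using assms(3) by simp
    also have "\<dots> \<le> real B * M K" using B_ge by simp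
    finally show ?thesis using that True by blast
  next
    case False
    define s where "s = (LEAST j. x j \<noteq> t j)"
    obtain j where j: "j < K" "x j \<noteq> t j" using False by (auto simp: agree_def)
    have s: "x s \<noteq> t s" unfolding s_def by (rule LeastI[of _ j]) (rule j)
    have "s \<le> j" unfolding s_def by (rule Least_le) (rule j)
    moreover have "agree s x t"
      unfolding agree_def s_def using not_less_Least by blast
    moreover have "norm (dir (phase x t) n) \<le> M (Suc s)"
      by (rule norm_dir_le_M[OF unit_roots_phase phase_neq_1[OF assms(1,2) s]]) simp
    moreover have "real (M (Suc s)) \<le> real B * M s"
      using M_Suc_le[of s] by (simp flip: of_nat_mult)
    ultimately show ?thesis using that[of s] j by linarith
  qed
  have "real B * M s * of_bool (agree s x t) \<le> (\<Sum>s\<le>K. real B * M s * of_bool (agree s x t))"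
    by (rule member_le_sum) (use s in auto)
  with s show ?thesis by simp
qed

lemma norm_avg_le_bound:
  assumes "\<And>x. x \<in> X \<Longrightarrow> norm (f x) \<le> g x"
  shows "norm (avg L f) \<le> avg L g"
  using norm_avg[of L f] avg_mono[of "\<lambda>x. norm (f x)" g L] assms by fastforce

text \<open>Each of the \<open>K + 1\<close> levels in the majorant of the kernel contributes
  \<open>M s * (1 / M s) = 1\<close>, up to the factor \<open>B\<close>: the L1 norms of the kernels
  grow at most logarithmically.\<close>

lemma norm_psum_le:
  assumes "x \<in> X" and a: "\<And>t. t \<in> X \<Longrightarrow> norm (a t) \<le> A" and n: "n \<le> M K" "K \<le> L"
  shows "norm (psum L a n x) \<le> A * (B * (K + 1))"
proof -
  have A: "0 \<le> A" using a[OF assms(1)] norm_ge_zero order_trans by blast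
  have "norm (psum L a n x) \<le> avg L (\<lambda>t. A * (\<Sum>s\<le>K. real B * M s * of_bool (agree s x t)))"
    unfolding psum_eq_avg
  proof (rule norm_avg_le_bound)
    fix t assume "t \<in> X"
    then show "norm (a t * dir (phase x t) n) \<le> A * (\<Sum>s\<le>K. real B * M s * of_bool (agree s x t))"
      unfolding norm_mult by (intro mult_mono a dir_phase_le assms A) auto
  qed
  also have "\<dots> = A * (\<Sum>s\<le>K. real B * M s * (1 / M s))"
    unfolding avg_mult_left avg_sum using assms by (simp add: avg_agree)
  also have "\<dots> = A * (B * (K + 1))"
    by (simp add: algebra_simps)
  finally show ?thesis .
qed

lemma ln_ge_level:
  assumes "M K \<le> n"
  shows "2 / 3 * real K \<le> ln (real n + 1)"
proof -
  have "2 / 3 * real K \<le> ln 2 * real K"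
    using ln2_ge_two_thirds by (intro mult_right_mono) auto
  also have "\<dots> = ln (2 ^ K)" by (simp add: ln_realpow)
  also have "\<dots> \<le> ln (real n + 1)"
  proof -
    have "real (2 ^ K) \<le> real n" using two_power_le_M[of K] assms by (simp only: of_nat_le_iff)
    moreover have "real (2 ^ K) = 2 ^ K" by simp
    ultimately have "2 ^ K \<le> real n + 1" by linarith
    then show ?thesis by (intro ln_mono) auto
  qed
  finally show ?thesis .
qed

lemma ln_ge_two_thirds: "1 \<le> n \<Longrightarrow> 2 / 3 \<le> ln (real n + 1)"
  by (rule order_trans[OF ln2_ge_two_thirds ln_mono]) auto

lemma norm_psum_le_ln:
  fixes A :: real
  assumes "x \<in> X" and a: "\<And>t. t \<in> X \<Longrightarrow> norm (a t) \<le> A" and n: "1 \<le> k" "k \<le> n" "n \<le> L"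
  shows "norm (psum L a k x) \<le> 5 * real B * A * ln (real n + 1)"
proof -
  define K where "K = (LEAST K. k \<le> M K)"
  have K: "k \<le> M K" unfolding K_def by (rule LeastI[of _ k]) (simp add: less_M less_imp_le)
  have "K \<le> k" unfolding K_def by (rule Least_le) (simp add: less_M less_imp_le)
  then have KL: "K \<le> L" using n by simp
  have "2 / 3 * real (K - 1) \<le> ln (real n + 1)"
  proof (cases "K = 0")
    case True
    then show ?thesis using n by simp
  next
    case False
    then have "\<not> k \<le> M (K - 1)" unfolding K_def by (intro not_less_Least) simp
    then show ?thesis using n by (intro ln_ge_level) simp
  qed
  \<comment> \<open>\<open>K - 1\<close> is at most \<open>3 / 2\<close> times the logarithm and the
    remaining \<open>2\<close> at most \<open>3\<close> times it, together
    \<open>9 / 2 \<le> 5\<close>.\<close>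
  then have "real K + 1 \<le> 5 * ln (real n + 1)"
    using ln_ge_two_thirds[of n] n by (cases K) auto
  moreover have "0 \<le> A" using a[OF assms(1)] norm_ge_zero order_trans by blast
  ultimately have "A * (B * (real K + 1)) \<le> A * (B * (5 * ln (real n + 1)))"
    by (intro mult_left_mono) auto
  with norm_psum_le[OF assms(1) _ K KL, of a A] a show ?thesis by (simp add: algebra_simps)
qed

text \<open>A Riesz mean is a weighted average of partial sums and inherits their common
  bound.\<close>

lemma norm_riesz_le_ln:
  fixes A :: real
  assumes "x \<in> X" and a: "\<And>t. t \<in> X \<Longrightarrow> norm (a t) \<le> A" and n: "1 \<le> n" "n \<le> L"
  shows "norm (riesz L a n x) \<le> 5 * real B * A * ln (real n + 1)"
proof -
  let ?C = "5 * real B * A * ln (real n + 1)"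
  have "norm (\<Sum>k=1..n. psum L a k x / of_nat k) \<le> (\<Sum>k=1..n. ?C * inverse (real k))"
  proof (rule sum_norm_le)
    fix k assume "k \<in> {1..n}"
    then have "norm (psum L a k x) \<le> ?C" using n by (intro norm_psum_le_ln assms) auto
    then show "norm (psum L a k x / of_nat k) \<le> ?C * inverse (real k)"
      by (simp only: norm_mult norm_inverse norm_of_nat divide_inverse) (intro mult_right_mono, auto)
  qed
  also have "\<dots> = ?C * harm n" unfolding harm_def sum_distrib_left ..
  finally show ?thesis
    using n by (simp add: norm_riesz_eq divide_le_eq)
qed

text \<open>Every \<open>t\<close> in the cell of \<open>z\<close> differs from \<open>x\<close>
  below \<open>N\<close>, so the complete blocks of the kernel vanish. What remains is a character
  of index a multiple of \<open>M N\<close>, which integrates to a Fourier coefficient, and a kernel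
  of index below \<open>M N\<close>, which cannot distinguish \<open>t\<close> from
  \<open>z\<close>.\<close>

lemma psum_off_support:
  assumes x: "x \<in> X" and z: "z \<in> X" and N: "\<not> agree N z x"
    and supp: "\<And>t. t \<in> X \<Longrightarrow> \<not> agree N z t \<Longrightarrow> a t = 0"
  shows "psum L a k x = (\<psi> (k div M N * M N) x * coef L a (k div M N * M N)) * dir (phase x z) (k mod M N)"
proof -
  let ?q = "k div M N * M N" and ?r = "k mod M N"
  have "psum L a k x = avg L (\<lambda>t. \<psi> ?q x * (a t * cnj (\<psi> ?q t)) * dir (phase x z) ?r)"
    unfolding psum_eq_avg
  proof (rule avg_cong)
    fix t assume t: "t \<in> X"
    show "a t * dir (phase x t) k = \<psi> ?q x * (a t * cnj (\<psi> ?q t)) * dir (phase x z) ?r"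
    proof (cases "agree N z t")
      case True
      obtain j where j: "j < N" "x j \<noteq> t j"
        using N True by (auto simp: agree_def)
      have "dir (phase x t) (?q + ?r) = chi (phase x t) ?q * dir (phase x t) ?r"
        by (rule dir_split[OF unit_roots_phase phase_neq_1[OF x t j(2)] j(1)]) (simp add: less_imp_le)
      also have "dir (phase x t) ?r = dir (phase x z) ?r"
        unfolding dir_def
      proof (rule sum.cong[OF refl], rule chi_cong[where K = N])
        fix j assume "j \<in> {..<?r}"
        then show "j < M N" using mod_less_divisor[OF M_pos[of N], of k] by (simp only: lessThan_iff)
      next
        fix j k assume "k < N"
        then show "phase x t k = phase x z k"
          using True by (simp add: phase_def vil_rademacher_def agree_def)
      qed
      finally show ?thesis unfolding div_mult_mod_eq by (simp add: chi_phase)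
    qed (simp add: supp t)
  qed
  also have "\<dots> = (\<psi> ?q x * coef L a ?q) * dir (phase x z) ?r"
    unfolding avg_mult_right avg_mult_left coef_def ..
  finally show ?thesis .
qed

lemma norm_coef_le:
  assumes z: "z \<in> X" "N \<le> L"
    and supp: "\<And>t. t \<in> X \<Longrightarrow> \<not> agree N z t \<Longrightarrow> a t = 0"
    and a: "\<And>t. t \<in> X \<Longrightarrow> norm (a t) \<le> A"
  shows "norm (coef L a j) \<le> A / M N"
proof -
  have "norm (coef L a j) \<le> avg L (\<lambda>t. A * of_bool (agree N z t))"
    unfolding coef_def
    by (rule norm_avg_le_bound) (use supp a in \<open>auto simp: norm_mult\<close>)
  then show ?thesis using z by (simp add: avg_mult_left avg_agree)
qed

lemma sum_sqrt_M_le: "(\<Sum>s<l. sqrt (M s)) \<le> 3 * sqrt (M l)"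
proof (induction l)
  case (Suc l)
  \<comment> \<open>Since \<open>16 / 9 \<le> 2\<close>, square roots grow at least by
    \<open>4 / 3\<close> per level, and \<open>3 + 1 = 3 * (4 / 3)\<close> closes the
    induction.\<close>
  have "(4 / 3)\<^sup>2 * real (M l) \<le> M (Suc l)"
    using M_Suc_ge[of l] by (simp add: power2_eq_square)
  then have "4 / 3 * sqrt (M l) \<le> sqrt (M (Suc l))"
    by (intro real_le_rsqrt) (simp add: power_mult_distrib power_divide)
  then show ?case using Suc by simp
qed simp

end

section \<open>Riesz means of atoms\<close>

context bounded_vilenkin
begin

text \<open>The mean value zero removes the block of indices below \<open>M N\<close>; this gives
  both the value 0 for \<open>n < M N\<close> and the start of the block sum at
  \<open>Q = 1\<close>. The bounds \<open>H\<close> and \<open>v\<close> are left open because they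
  depend on how \<open>x\<close> and \<open>z\<close> differ.\<close>

lemma norm_riesz_off_support:
  fixes A H :: real
  assumes x: "x \<in> X" and z: "z \<in> X" and N: "N \<le> L" "\<not> agree N z x"
    and supp: "\<And>t. t \<in> X \<Longrightarrow> \<not> agree N z t \<Longrightarrow> a t = 0"
    and a: "\<And>t. t \<in> X \<Longrightarrow> norm (a t) \<le> A"
    and mean: "avg L a = 0"
    and H: "\<And>j. j \<le> M N \<Longrightarrow> norm (fej (phase x z) j) \<le> H"
    and v: "\<And>Q. 1 \<le> Q \<Longrightarrow>
      norm (\<Sum>i<M N. dir (phase x z) i / of_nat (Q * M N + i)) \<le> v Q"
  shows "norm (riesz L a n x)
      \<le> (if n < M N then 0 else A / M N * ((\<Sum>Q\<in>{1..<Suc n div M N}. v Q) + H / M N) / harm n)"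
proof -
  define c where "c Q = \<psi> (Q * M N) x * coef L a (Q * M N)" for Q
  have psum: "psum L a k x = c (k div M N) * dir (phase x z) (k mod M N)" for k
    unfolding c_def by (rule psum_off_support[OF x z N(2) supp])
  have c0: "c 0 = 0" using mean by (simp add: c_def coef_def)
  show ?thesis
  proof (cases "n < M N")
    case True
    then have "psum L a k x = 0" if "k \<in> {1..n}" for k using that by (simp add: psum c0)
    then have "(\<Sum>k=1..n. psum L a k x / of_nat k) = 0" by (intro sum.neutral) auto
    then show ?thesis using True by (simp add: norm_riesz_eq)
  next
    case False
    \<comment> \<open>The added index \<open>k = 0\<close> contributes nothing, division by zero
      being zero.\<close>
    have eq: "(\<Sum>k=1..n. psum L a k x / of_nat k)
        = (\<Sum>k<Suc n. c (k div M N) * dir (phase x z) (k mod M N) / of_nat k)"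
      unfolding psum by (rule sum.mono_neutral_left) (auto simp: not_le)
    have "norm (\<Sum>k=1..n. psum L a k x / of_nat k)
        \<le> A / M N * ((\<Sum>Q\<in>{1..<Suc n div M N}. v Q) + H / M N)"
      unfolding eq
    proof (rule norm_block_sum_le)
      show "norm (c Q) \<le> A / M N" for Q
        unfolding c_def norm_mult using norm_coef_le[OF z N(1) supp a] by simp
    qed (use c0 H v in \<open>auto simp: fej_def\<close>)
    then have "norm (\<Sum>k=1..n. psum L a k x / of_nat k) / harm n
        \<le> A / M N * ((\<Sum>Q\<in>{1..<Suc n div M N}. v Q) + H / M N) / harm n"
      by (rule divide_right_mono) (rule harm_nonneg)
    then show ?thesis
      unfolding norm_riesz_eq using False by (simp only: if_False)
  qed
qed

lemma harm_ge_level: "M N \<le> n \<Longrightarrow> 2 / 3 * real N \<le> harm n"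
  using ln_ge_level[of N n] ln_le_harm[of n] by linarith

lemma M_Suc_real_le: "real (M (Suc s)) \<le> real B * M s"
  using M_Suc_le[of s] by (simp flip: of_nat_mult)

text \<open>The complete Fejer sum vanishes, so block \<open>Q\<close> costs only
  \<open>H / M N * (1 / Q - 1 / (Q + 1))\<close> and the blocks telescope with no logarithmic loss.
  Both \<open>harm n\<close> and the weight are then free to supply a factor of order
  \<open>N\<close> each. The bound is written as a square because its root is taken later.\<close>

lemma norm_riesz_two_le:
  fixes A :: real
  assumes x: "x \<in> X" and z: "z \<in> X" and N: "N \<le> L" "\<not> agree N z x"
    and supp: "\<And>t. t \<in> X \<Longrightarrow> \<not> agree N z t \<Longrightarrow> a t = 0"
    and a: "\<And>t. t \<in> X \<Longrightarrow> norm (a t) \<le> A"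
    and mean: "avg L a = 0"
    and s: "x s \<noteq> z s" and l: "x l \<noteq> z l" "s < l" "l < N"
  shows "norm (riesz L a n x)
      \<le> A * (4 * real B * sqrt (real (M s) * M l) / (real (M N) * N))\<^sup>2 * ln (real n + 1)"
proof -
  let ?w = "phase x z"
  have w: "unit_roots ?w" "?w s \<noteq> 1" "?w l \<noteq> 1"
    using unit_roots_phase phase_neq_1[OF x z] s l by auto
  have A: "0 \<le> A" using a[OF x] norm_ge_zero order_trans by blast
  define H where "H = 2 * (real B * M s) * (real B * M l)"
  have H0: "0 \<le> H" by (simp add: H_def)
  have H: "norm (fej ?w j) \<le> H" for j
  proof -
    have "norm (fej ?w j) \<le> 2 * real (M (Suc s)) * M (Suc l)"
      by (rule norm_fej_two_le) (use w l in auto)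
    also have "\<dots> \<le> H"
      unfolding H_def by (intro mult_mono M_Suc_real_le mult_left_mono) auto
    finally show ?thesis .
  qed
  have zero: "(\<Sum>i<M N. dir ?w i) = 0"
    using fej_M_eq_0[OF w(1,2,3) l(2,3)] by (simp add: fej_def)
  define v where "v Q = H / M N * (1 / real Q - 1 / (real Q + 1))" for Q :: nat
  have v: "norm (\<Sum>i<M N. dir ?w i / of_nat (Q * M N + i)) \<le> v Q" if Q: "1 \<le> Q" for Q
  proof -
    have "1 \<le> Q * M N" using Q M_pos[of N] by (simp add: Suc_le_eq)
    have "norm (\<Sum>i<M N. dir ?w i / of_nat (Q * M N + i))
        \<le> norm (\<Sum>i<M N. dir ?w i) / real (Q * M N + M N)
          + H * (1 / real (Q * M N) - 1 / real (Q * M N + M N))"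
      by (rule norm_abel_block_le) (use H \<open>1 \<le> Q * M N\<close> in \<open>auto simp: fej_def\<close>)
    also have "real (Q * M N + M N) = (real Q + 1) * M N"
      by (simp add: algebra_simps)
    also have "norm (\<Sum>i<M N. dir ?w i) / ((real Q + 1) * M N)
        + H * (1 / real (Q * M N) - 1 / ((real Q + 1) * M N)) = v Q"
      unfolding zero v_def by (simp add: right_diff_distrib mult_ac)
    finally show ?thesis .
  qed
  have sum_v: "(\<Sum>Q\<in>{1..<q}. v Q) \<le> H / M N" for q
    unfolding v_def sum_distrib_left[symmetric]
    using mult_left_mono[OF sum_telescope_inverse[of q], of "H / M N"] H0 by simp
  have "norm (riesz L a n x)
      \<le> (if n < M N then 0 else A / M N * ((\<Sum>Q\<in>{1..<Suc n div M N}. v Q) + H / M N) / harm n)"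
    by (rule norm_riesz_off_support[OF x z N supp a mean H v])
  also have "\<dots> \<le> A * (4 * real B * sqrt (real (M s) * M l) / (real (M N) * N))\<^sup>2 * ln (real n + 1)"
  proof (cases "n < M N")
    case True
    then show ?thesis using A by (simp add: mult_nonneg_nonneg)
  next
    case False
    have N0: "0 < real N" using l by simp
    have ln: "2 / 3 * real N \<le> ln (real n + 1)" "2 / 3 * real N \<le> harm n"
      using False ln_ge_level[of N n] harm_ge_level[of N n] by auto
    \<comment> \<open>The product of the two lower bounds is \<open>4 / 9\<close> of the square of
      \<open>N\<close>; since \<open>1 / 4 \<le> 4 / 9\<close>, the reciprocal of
      \<open>harm n\<close> is at most \<open>4 * ln (n + 1)\<close> divided by that square.\<close>
    have "(2 / 3 * real N) * (2 / 3 * real N) \<le> ln (real n + 1) * harm n"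
      by (rule mult_mono) (use ln N0 in auto)
    moreover have "(2 / 3 * real N) * (2 / 3 * real N) = 4 / 9 * real N ^ 2"
      by (simp add: power2_eq_square)
    ultimately have 1: "real N ^ 2 \<le> 4 * (ln (real n + 1) * harm n)"
      using zero_le_power2[of "real N"] by linarith
    have harm: "0 < (harm n :: real)" using ln N0 by linarith
    have "A / M N * ((\<Sum>Q\<in>{1..<Suc n div M N}. v Q) + H / M N) / harm n
        \<le> A / M N * (H / M N + H / M N) / harm n"
      by (intro divide_right_mono mult_left_mono add_mono sum_v) (use A in \<open>auto simp: harm_nonneg\<close>)
    also have "\<dots> = (4 * A * real B ^ 2 * M s * M l / real (M N) ^ 2) * (1 / harm n)"
      by (simp add: H_def power2_eq_square)
    also have "\<dots> \<le> (4 * A * real B ^ 2 * M s * M l / real (M N) ^ 2)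
        * (4 * ln (real n + 1) / real N ^ 2)"
      using 1 harm N0 A by (intro mult_left_mono) (auto simp: field_simps)
    also have "\<dots> = A * (4 * real B * sqrt (real (M s) * M l) / (real (M N) * N))\<^sup>2 * ln (real n + 1)"
      by (simp add: power_mult_distrib power_divide)
    finally show ?thesis using False by simp
  qed
  finally show ?thesis .
qed

text \<open>With only one difference available the complete Fejer sum need not vanish. Block
  \<open>Q\<close> costs \<open>H / (Q * M N)\<close>, the sum over \<open>Q\<close> uses up
  \<open>harm n\<close>, and only the weight supplies a factor of order \<open>N\<close>.\<close>

lemma norm_riesz_one_le:
  fixes A :: real
  assumes x: "x \<in> X" and z: "z \<in> X" and N: "N \<le> L" "\<not> agree N z x"
    and supp: "\<And>t. t \<in> X \<Longrightarrow> \<not> agree N z t \<Longrightarrow> a t = 0"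
    and a: "\<And>t. t \<in> X \<Longrightarrow> norm (a t) \<le> A"
    and mean: "avg L a = 0"
    and s: "x s \<noteq> z s" "s < N"
  shows "norm (riesz L a n x)
      \<le> A * (2 * real B * sqrt (M s / (real (M N) * N)))\<^sup>2 * ln (real n + 1)"
proof -
  let ?w = "phase x z"
  have A: "0 \<le> A" using a[OF x] norm_ge_zero order_trans by blast
  define H where "H = real (M N) * (real B * M s)"
  have H0: "0 \<le> H" by (simp add: H_def)
  have H: "norm (fej ?w j) \<le> H" if "j \<le> M N" for j
  proof -
    have "norm (fej ?w j) \<le> real j * M (Suc s)"
      by (rule norm_fej_le[OF unit_roots_phase phase_neq_1[OF x z s(1)]]) simp
    also have "\<dots> \<le> H"
      unfolding H_def by (intro mult_mono M_Suc_real_le) (use that in auto)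
    finally show ?thesis .
  qed
  define v where "v Q = H / real (Q * M N)" for Q :: nat
  have v: "norm (\<Sum>i<M N. dir ?w i / of_nat (Q * M N + i)) \<le> v Q" if Q: "1 \<le> Q" for Q
    unfolding v_def
    by (rule norm_abel_block_le') (use H Q M_pos[of N] in \<open>auto simp: fej_def Suc_le_eq\<close>)
  have "2 ^ 1 \<le> (2::nat) ^ N" by (rule power_increasing) (use s in auto)
  then have MN: "2 \<le> M N" using two_power_le_M[of N] by simp
  have sum_v: "(\<Sum>Q\<in>{1..<Suc n div M N}. v Q) \<le> H / M N * harm n"
  proof -
    have "(\<Sum>Q\<in>{1..<Suc n div M N}. v Q) = H / M N * (\<Sum>Q\<in>{1..<Suc n div M N}. inverse (real Q))"
      unfolding v_def sum_distrib_left by (intro sum.cong) (auto simp: divide_inverse)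
    also have "\<dots> \<le> H / M N * harm n"
      unfolding harm_def
    proof (intro mult_left_mono sum_mono2)
      define q where "q = Suc n div M N"
      have "q \<le> Suc n" unfolding q_def by (rule div_le_dividend)
      then show "{1..<Suc n div M N} \<subseteq> {1..n}" unfolding q_def[symmetric] by auto
    qed (use H0 in auto)
    finally show ?thesis .
  qed
  have "norm (riesz L a n x)
      \<le> (if n < M N then 0 else A / M N * ((\<Sum>Q\<in>{1..<Suc n div M N}. v Q) + H / M N) / harm n)"
    by (rule norm_riesz_off_support[OF x z N supp a mean H v])
  also have "\<dots> \<le> A * (2 * real B * sqrt (M s / (real (M N) * N)))\<^sup>2 * ln (real n + 1)"
  proof (cases "n < M N")
    case True
    then show ?thesis using A by (simp add: mult_nonneg_nonneg)
  next
    case False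
    have N0: "0 < real N" using s by simp
    have ln: "2 / 3 * real N \<le> ln (real n + 1)"
      using False ln_ge_level[of N n] by auto
    have n: "1 \<le> n" using False MN by linarith
    then have harm: "1 \<le> (harm n :: real)" using harm_mono[of 1 n, where 'a=real] by (simp add: harm_expand)
    have "A / M N * ((\<Sum>Q\<in>{1..<Suc n div M N}. v Q) + H / M N) / harm n
        \<le> A / M N * (H / M N * harm n + H / M N * harm n) / harm n"
    proof (intro divide_right_mono mult_left_mono add_mono sum_v)
      show "H / M N \<le> H / M N * harm n"
        using mult_left_mono[OF harm, of "H / M N"] H0 by simp
    qed (use A harm in auto)
    also have "\<dots> = 2 * A * real B * M s / M N"
      using harm by (simp add: H_def)
    \<comment> \<open>One more factor \<open>B\<close> is spent so that
      \<open>4 / 3 * B \<ge> 1\<close> exposes the \<open>2 / 3\<close> needed for the lower bound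
      on the logarithm.\<close>
    also have "\<dots> \<le> (4 * A * real B ^ 2 * M s / M N) * (2 / 3)"
    proof -
      have "2 * A * real B * M s / M N * 1 \<le> 2 * A * real B * M s / M N * (4 / 3 * real B)"
        using B_ge A by (intro mult_left_mono) auto
      then show ?thesis by (simp add: power2_eq_square mult_ac)
    qed
    also have "\<dots> \<le> (4 * A * real B ^ 2 * M s / M N) * (ln (real n + 1) / N)"
      using A N0 ln by (intro mult_left_mono) (auto simp: field_simps)
    also have "\<dots> = A * (2 * real B * sqrt (M s / (real (M N) * N)))\<^sup>2 * ln (real n + 1)"
      by (simp add: power_mult_distrib)
    finally show ?thesis using False by simp
  qed
  finally show ?thesis .
qed

section \<open>A majorant for the Riesz means of an atom\<close>

definition near :: "nat \<Rightarrow> nat \<Rightarrow> (nat \<Rightarrow> nat) \<Rightarrow> (nat \<Rightarrow> nat) \<Rightarrow> bool" where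
  "near s l z x \<longleftrightarrow> (\<forall>j<l. j \<noteq> s \<longrightarrow> x j = z j)"

text \<open>Coordinate \<open>s\<close> is free and the others below \<open>l\<close> are fixed, so
  at most \<open>m s \<le> B\<close> cells of level \<open>l\<close> are involved.\<close>

lemma avg_near:
  assumes z: "z \<in> X" and "s < l" "l \<le> L"
  shows "avg L (\<lambda>x. of_bool (near s l z x)) \<le> real B / M l"
proof -
  have "avg L (\<lambda>x. of_bool (near s l z x))
      \<le> avg L (\<lambda>x. \<Sum>c<m s. of_bool (agree l (z(s := c)) x) :: real)"
  proof (rule avg_mono)
    fix x assume x: "x \<in> X"
    show "of_bool (near s l z x) \<le> (\<Sum>c<m s. of_bool (agree l (z(s := c)) x) :: real)"
    proof (cases "near s l z x")
      case True
      have "x s \<in> {..<m s}" using x by (simp add: X_iff)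
      then have "of_bool (agree l (z(s := x s)) x) \<le> (\<Sum>c<m s. of_bool (agree l (z(s := c)) x) :: real)"
        by (intro member_le_sum) auto
      moreover have "agree l (z(s := x s)) x" using True by (simp add: agree_def near_def)
      ultimately show ?thesis by simp
    qed (simp add: sum_nonneg)
  qed
  also have "\<dots> = (\<Sum>c<m s. 1 / M l)"
    unfolding avg_sum using z assms(3)
    by (intro sum.cong refl avg_agree) (auto simp: X_iff)
  also have "\<dots> \<le> real B / M l"
    using m_le[of s] by (simp add: divide_right_mono)
  finally show ?thesis .
qed

text \<open>The three terms dominate the Riesz means of an atom on its cell, at points that differ from
  \<open>z\<close> in one coordinate \<open>s < N\<close> only, and at points whose first two differences are \<open>s < l < N\<close>.\<close>

definition bump :: "nat \<Rightarrow> (nat \<Rightarrow> nat) \<Rightarrow> (nat \<Rightarrow> nat) \<Rightarrow> real" where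
  "bump N z x = sqrt (5 * B) * of_bool (agree N z x)
     + (\<Sum>s<N. 2 * real B * sqrt (M s / (real (M N) * N)) * of_bool (near s N z x))
     + (\<Sum>l<N. \<Sum>s<l. 4 * real B * sqrt (real (M s) * M l) / (real (M N) * N) * of_bool (near s l z x))"

lemma bump_nonneg: "0 \<le> bump N z x"
  unfolding bump_def by (intro add_nonneg_nonneg sum_nonneg mult_nonneg_nonneg) auto

lemma bump_ge_agree: "agree N z x \<Longrightarrow> sqrt (5 * B) \<le> bump N z x"
  unfolding bump_def
  by (intro order_trans[OF _ add_increasing2] add_increasing2 sum_nonneg) auto

lemma bump_ge_one:
  assumes "s < N" "near s N z x"
  shows "2 * real B * sqrt (M s / (real (M N) * N)) \<le> bump N z x"
proof -
  let ?f = "\<lambda>s. 2 * real B * sqrt (M s / (real (M N) * N)) * of_bool (near s N z x)"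
  have "?f s \<le> (\<Sum>s<N. ?f s)" using assms by (intro member_le_sum) auto
  moreover have "0 \<le> (\<Sum>l<N. \<Sum>s<l. 4 * real B * sqrt (real (M s) * M l) / (real (M N) * N)
      * of_bool (near s l z x))"
    by (intro sum_nonneg) auto
  moreover have "0 \<le> sqrt (5 * B) * of_bool (agree N z x)" by simp
  moreover have "?f s = 2 * real B * sqrt (M s / (real (M N) * N))" using assms by simp
  ultimately show ?thesis unfolding bump_def by linarith
qed

lemma bump_ge_two:
  assumes "s < l" "l < N" "near s l z x"
  shows "4 * real B * sqrt (real (M s) * M l) / (real (M N) * N) \<le> bump N z x"
proof -
  let ?f = "\<lambda>s l. 4 * real B * sqrt (real (M s) * M l) / (real (M N) * N) * of_bool (near s l z x)"
  have "?f s l \<le> (\<Sum>s<l. ?f s l)" using assms by (intro member_le_sum) auto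
  also have "\<dots> \<le> (\<Sum>l<N. \<Sum>s<l. ?f s l)" using assms by (intro member_le_sum sum_nonneg) auto
  finally have "?f s l \<le> (\<Sum>l<N. \<Sum>s<l. ?f s l)" .
  moreover have "0 \<le> (\<Sum>s<N. 2 * real B * sqrt (M s / (real (M N) * N)) * of_bool (near s N z x))"
    by (intro sum_nonneg) auto
  moreover have "0 \<le> sqrt (5 * B) * of_bool (agree N z x)" by simp
  moreover have "?f s l = 4 * real B * sqrt (real (M s) * M l) / (real (M N) * N)"
    using assms by simp
  ultimately show ?thesis unfolding bump_def by linarith
qed

text \<open>All sums over \<open>s\<close> are geometric. The second term even keeps a spare factor
  \<open>1 / sqrt N\<close>. In the third, each of the \<open>N\<close> values of \<open>l\<close>
  contributes order \<open>1 / (M N * N)\<close>, which uses up the factor \<open>1 / N\<close>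
  completely.\<close>

lemma avg_bump:
  assumes z: "z \<in> X" and N: "N \<le> L"
  shows "avg L (bump N z) \<le> (5 * real B + 18 * real B ^ 2) / M N"
proof -
  have "avg L (bump N z) = sqrt (5 * B) * (1 / M N)
     + (\<Sum>s<N. 2 * real B * sqrt (M s / (real (M N) * N)) * avg L (\<lambda>x. of_bool (near s N z x)))
     + (\<Sum>l<N. \<Sum>s<l. 4 * real B * sqrt (real (M s) * M l) / (real (M N) * N)
         * avg L (\<lambda>x. of_bool (near s l z x)))"
    unfolding bump_def avg_add avg_sum avg_mult_left avg_agree[OF z N] ..
  also have "\<dots> \<le> 5 * real B / M N + 6 * real B ^ 2 / M N + 12 * real B ^ 2 / M N"
  proof (intro add_mono)
    have "5 * real B \<le> (5 * real B) * (5 * real B)" using B_ge by simp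
    then have "sqrt (5 * B) \<le> 5 * real B"
      by (intro real_le_lsqrt) (auto simp: power2_eq_square)
    then show "sqrt (5 * B) * (1 / M N) \<le> 5 * real B / M N"
      by (simp add: divide_right_mono)
  next
    have "(\<Sum>s<N. 2 * real B * sqrt (M s / (real (M N) * N)) * avg L (\<lambda>x. of_bool (near s N z x)))
        \<le> (\<Sum>s<N. 2 * real B * sqrt (M s / (real (M N) * N)) * (real B / M N))"
      by (intro sum_mono mult_left_mono avg_near z N) auto
    also have "\<dots> = 2 * real B ^ 2 / (M N * sqrt (M N) * sqrt N) * (\<Sum>s<N. sqrt (M s))"
      unfolding sum_distrib_left
      by (intro sum.cong) (auto simp: real_sqrt_divide real_sqrt_mult power2_eq_square mult_ac)
    also have "\<dots> \<le> 2 * real B ^ 2 / (M N * sqrt (M N) * sqrt N) * (3 * sqrt (M N))"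
      by (intro mult_left_mono sum_sqrt_M_le) auto
    also have "\<dots> = 6 * real B ^ 2 / M N * (1 / sqrt N)"
      by (simp add: field_simps)
    also have "\<dots> \<le> 6 * real B ^ 2 / M N * 1"
      by (intro mult_left_mono) (cases N, auto simp: divide_le_eq)
    finally show "(\<Sum>s<N. 2 * real B * sqrt (M s / (real (M N) * N)) * avg L (\<lambda>x. of_bool (near s N z x)))
        \<le> 6 * real B ^ 2 / M N" by simp
  next
    have "(\<Sum>l<N. \<Sum>s<l. 4 * real B * sqrt (real (M s) * M l) / (real (M N) * N)
         * avg L (\<lambda>x. of_bool (near s l z x)))
       \<le> (\<Sum>l<N. 12 * real B ^ 2 / (real (M N) * N))"
    proof (rule sum_mono)
      fix l assume "l \<in> {..<N}"
      then have l: "l \<le> L" using N by simp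
      have "(\<Sum>s<l. 4 * real B * sqrt (real (M s) * M l) / (real (M N) * N)
           * avg L (\<lambda>x. of_bool (near s l z x)))
         \<le> (\<Sum>s<l. 4 * real B * sqrt (real (M s) * M l) / (real (M N) * N) * (real B / M l))"
        by (intro sum_mono mult_left_mono avg_near z l) auto
      also have "\<dots> = 4 * real B ^ 2 / (real (M N) * N) * (sqrt (M l) / M l) * (\<Sum>s<l. sqrt (M s))"
        unfolding sum_distrib_left
        by (intro sum.cong) (auto simp: real_sqrt_mult power2_eq_square)
      also have "\<dots> \<le> 4 * real B ^ 2 / (real (M N) * N) * (sqrt (M l) / M l) * (3 * sqrt (M l))"
        by (intro mult_left_mono sum_sqrt_M_le) auto
      also have "\<dots> = 12 * real B ^ 2 / (real (M N) * N)"
        by simp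
      finally show "(\<Sum>s<l. 4 * real B * sqrt (real (M s) * M l) / (real (M N) * N)
           * avg L (\<lambda>x. of_bool (near s l z x))) \<le> 12 * real B ^ 2 / (real (M N) * N)" .
    qed
    also have "\<dots> \<le> 12 * real B ^ 2 / M N"
      by (cases "N = 0") auto
    finally show "(\<Sum>l<N. \<Sum>s<l. 4 * real B * sqrt (real (M s) * M l) / (real (M N) * N)
         * avg L (\<lambda>x. of_bool (near s l z x))) \<le> 12 * real B ^ 2 / M N" .
  qed
  also have "\<dots> = (5 * real B + 18 * real B ^ 2) / M N"
    by (simp add: add_divide_distrib)
  finally show ?thesis .
qed

text \<open>The cases are: \<open>x\<close> in the cell, exactly one difference below
  \<open>N\<close>, and first differences \<open>s < l < N\<close>. After division by the logarithm
  the bound no longer depends on \<open>n\<close>, as a maximal estimate requires.\<close>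

lemma norm_riesz_atom_le:
  fixes A :: real
  assumes x: "x \<in> X" and z: "z \<in> X" and N: "N \<le> L"
    and supp: "\<And>t. t \<in> X \<Longrightarrow> \<not> agree N z t \<Longrightarrow> a t = 0"
    and a: "\<And>t. t \<in> X \<Longrightarrow> norm (a t) \<le> A"
    and mean: "avg L a = 0" and n: "1 \<le> n" "n \<le> L"
  shows "norm (riesz L a n x) \<le> A * (bump N z x)\<^sup>2 * ln (real n + 1)"
proof -
  have A: "0 \<le> A" using a[OF x] norm_ge_zero order_trans by blast
  have weaken: "A * b\<^sup>2 * ln (real n + 1) \<le> A * (bump N z x)\<^sup>2 * ln (real n + 1)"
    if "b \<le> bump N z x" "0 \<le> b" for b
    using that A by (intro mult_right_mono mult_left_mono power_mono) auto
  show ?thesis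
  proof (cases "agree N z x")
    case True
    have "norm (riesz L a n x) \<le> 5 * real B * A * ln (real n + 1)"
      by (rule norm_riesz_le_ln[OF x a n])
    also have "\<dots> = A * (sqrt (5 * B))\<^sup>2 * ln (real n + 1)" by simp
    also have "\<dots> \<le> A * (bump N z x)\<^sup>2 * ln (real n + 1)"
      by (intro weaken bump_ge_agree True) simp
    finally show ?thesis .
  next
    case False
    then obtain j where j: "j < N" "x j \<noteq> z j" by (auto simp: agree_def)
    define s where "s = (LEAST j. x j \<noteq> z j)"
    have "x s \<noteq> z s" unfolding s_def by (rule LeastI[of _ j]) (rule j)
    moreover have "s \<le> j" unfolding s_def by (rule Least_le) (rule j)
    moreover have "x i = z i" if "i < s" for i using that not_less_Least unfolding s_def by blast
    ultimately have s: "s < N" "x s \<noteq> z s" "\<And>i. i < s \<Longrightarrow> x i = z i"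
      using j by auto
    show ?thesis
    proof (cases "near s N z x")
      case True
      have "norm (riesz L a n x)
          \<le> A * (2 * real B * sqrt (M s / (real (M N) * N)))\<^sup>2 * ln (real n + 1)"
        by (rule norm_riesz_one_le[OF x z N False supp a mean s(2,1)])
      also have "\<dots> \<le> A * (bump N z x)\<^sup>2 * ln (real n + 1)"
        by (intro weaken bump_ge_one True s) simp
      finally show ?thesis .
    next
      case F: False
      define l where "l = (LEAST l. l \<noteq> s \<and> x l \<noteq> z l)"
      obtain l' where l': "l' < N" "l' \<noteq> s \<and> x l' \<noteq> z l'" using F by (auto simp: near_def)
      have "l \<noteq> s \<and> x l \<noteq> z l" unfolding l_def by (rule LeastI[of _ l']) (rule l'(2))
      then have "l \<noteq> s" "x l \<noteq> z l" by auto
      moreover have "l \<le> l'" unfolding l_def by (rule Least_le) (rule l'(2))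
      moreover have "near s l z x"
        unfolding near_def l_def using not_less_Least by blast
      moreover have "\<not> l < s" using s(3) \<open>x l \<noteq> z l\<close> by blast
      ultimately have l: "s < l" "l < N" "x l \<noteq> z l" "near s l z x"
        using l'(1) by auto
      have "norm (riesz L a n x)
          \<le> A * (4 * real B * sqrt (real (M s) * M l) / (real (M N) * N))\<^sup>2 * ln (real n + 1)"
        by (rule norm_riesz_two_le[OF x z N False supp a mean s(2) l(3,1,2)])
      also have "\<dots> \<le> A * (bump N z x)\<^sup>2 * ln (real n + 1)"
        by (intro weaken bump_ge_two l) simp
      finally show ?thesis .
    qed
  qed
qed

end

section \<open>Atomic decomposition\<close>

text \<open>The active terms form an initial segment of a geometric series, so they sum to at most
  twice the largest of them, which is below \<open>y\<close>.\<close>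

lemma sum_dyadic_le:
  fixes e y :: real
  assumes "0 \<le> y" "0 \<le> e"
  shows "(\<Sum>k<K. of_bool (e * 2 ^ k < y) * (e * 2 ^ k)) \<le> 2 * y"
proof (induction K)
  case (Suc K)
  show ?case
  proof (cases "e * 2 ^ K < y")
    case True
    have "(\<Sum>k<Suc K. of_bool (e * 2 ^ k < y) * (e * 2 ^ k)) \<le> (\<Sum>k<Suc K. e * 2 ^ k)"
      using assms by (intro sum_mono) auto
    also have "\<dots> = e * (2 ^ Suc K - 1)"
      by (induction K) (simp_all add: algebra_simps)
    also have "\<dots> \<le> 2 * (e * 2 ^ K)" using assms by (simp add: algebra_simps)
    finally show ?thesis using True by linarith
  qed (use Suc in simp)
qed (use assms in simp)

context bounded_vilenkin
begin

lemma riesz_cong: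
  assumes "\<And>x. x \<in> X \<Longrightarrow> f x = g x"
  shows "riesz L f n x = riesz L g n x"
proof -
  have "coef L f j = coef L g j" for j
    unfolding coef_def by (rule avg_cong) (simp add: assms)
  then show ?thesis by (simp add: riesz_def psum_def)
qed

text \<open>The square root makes the action on sums subadditive, although \<open>L\<^sub>p\<close> with \<open>p = 1/2\<close> is
  not normed.\<close>

definition sqr :: "nat \<Rightarrow> nat \<Rightarrow> (nat \<Rightarrow> nat) \<Rightarrow> ((nat \<Rightarrow> nat) \<Rightarrow> complex) \<Rightarrow> real" where
  "sqr L n x g = sqrt (norm (riesz L g n x) / ln (real n + 1))"

lemma sqr_add: "sqr L n x (\<lambda>x. f x + g x) \<le> sqr L n x f + sqr L n x g"
proof -
  have "norm (riesz L f n x + riesz L g n x) / ln (real n + 1)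
      \<le> norm (riesz L f n x) / ln (real n + 1) + norm (riesz L g n x) / ln (real n + 1)"
    unfolding add_divide_distrib[symmetric] by (intro divide_right_mono norm_triangle_ineq) simp
  then show ?thesis
    unfolding sqr_def riesz_add
    by (intro order_trans[OF real_sqrt_le_mono sqrt_add_le_add_sqrt]) auto
qed

lemma sqr_sum:
  assumes "finite I"
  shows "sqr L n x (\<lambda>x. \<Sum>i\<in>I. g i x) \<le> (\<Sum>i\<in>I. sqr L n x (g i))"
  using assms
proof (induction I rule: finite_induct)
  case empty
  then show ?case by (simp add: sqr_def riesz_0)
next
  case (insert i I)
  have "sqr L n x (\<lambda>x. g i x + (\<Sum>i\<in>I. g i x)) \<le> sqr L n x (g i) + sqr L n x (\<lambda>x. \<Sum>i\<in>I. g i x)"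
    by (rule sqr_add)
  then show ?case using insert by simp
qed

lemma sqr_cong: "(\<And>x. x \<in> X \<Longrightarrow> f x = g x) \<Longrightarrow> sqr L n x f = sqr L n x g"
  unfolding sqr_def using riesz_cong[of f g L n x] by simp

lemma sqr_leI:
  assumes "norm (riesz L g n x) \<le> c * ln (real n + 1)" "1 \<le> n"
  shows "sqr L n x g \<le> sqrt c"
  unfolding sqr_def using assms ln_ge_two_thirds[of n] by (intro real_sqrt_le_mono) (simp add: divide_le_eq)

end

text \<open>A martingale seen up to level \<open>L\<close>, with conditional expectations replaced
  by averages over cells. As cells have positive measure, the condition holds at every point rather
  than almost everywhere.\<close>

locale finite_martingale = bounded_vilenkin +
  fixes L :: nat and f :: "nat \<Rightarrow> (nat \<Rightarrow> nat) \<Rightarrow> complex"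
  assumes lev_f: "n \<le> L \<Longrightarrow> lev n (f n)"
    and mean_diff: "n < L \<Longrightarrow> x \<in> X \<Longrightarrow>
      avg L (\<lambda>y. of_bool (agree n x y) * (f (Suc n) y - f n y)) = 0"
begin

section \<open>Stopping at a threshold\<close>

definition fmax :: "(nat \<Rightarrow> nat) \<Rightarrow> real" where
  "fmax x = Max ((\<lambda>n. norm (f n x)) ` {..L})"

lemma fmax_ge: "n \<le> L \<Longrightarrow> norm (f n x) \<le> fmax x"
  unfolding fmax_def by (rule Max_ge) auto

lemma fmax_nonneg: "0 \<le> fmax x"
  using fmax_ge[of 0 x] norm_ge_zero[of "f 0 x"] by linarith

text \<open>Crossings are predictable: a cell is stopped when some child cell exceeds the threshold, so
  stopped values stay below it.\<close>

definition crossed :: "nat \<Rightarrow> real \<Rightarrow> (nat \<Rightarrow> nat) \<Rightarrow> bool" where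
  "crossed n c x \<longleftrightarrow> (\<exists>y\<in>X. agree n x y \<and> (c < norm (f n y) \<or> c < norm (f (Suc n) y)))"

definition alive :: "nat \<Rightarrow> real \<Rightarrow> (nat \<Rightarrow> nat) \<Rightarrow> bool" where
  "alive n c x \<longleftrightarrow> (\<forall>i\<le>n. \<not> crossed i c x)"

definition first_crossed :: "nat \<Rightarrow> real \<Rightarrow> (nat \<Rightarrow> nat) \<Rightarrow> bool" where
  "first_crossed n c x \<longleftrightarrow> crossed n c x \<and> (\<forall>i<n. \<not> crossed i c x)"

text \<open>The martingale stopped at its first crossing, written through its increments. A crossing
  at level 0 still leaves the value \<open>f 0 x\<close>, which may exceed \<open>c\<close>; hence
  the assumption \<open>alive 0\<close> in the next bounds.\<close>

definition stopped :: "real \<Rightarrow> (nat \<Rightarrow> nat) \<Rightarrow> complex" where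
  "stopped c x = f 0 x + (\<Sum>n<L. of_bool (alive n c x) * (f (Suc n) x - f n x))"

lemma crossed_agree:
  assumes "agree k x y" "n \<le> k"
  shows "crossed n c x = crossed n c y"
proof -
  have "agree n x y" using assms by (rule agree_mono)
  then have "agree n x z \<longleftrightarrow> agree n y z" for z
    using agree_sym agree_trans by blast
  then show ?thesis by (simp add: crossed_def)
qed

lemma alive_agree: "agree k x y \<Longrightarrow> n \<le> k \<Longrightarrow> alive n c x = alive n c y"
  using crossed_agree[of k x y] by (simp add: alive_def)

lemma first_crossed_agree: "agree k x y \<Longrightarrow> n \<le> k \<Longrightarrow> first_crossed n c x = first_crossed n c y"
  using crossed_agree[of k x y] by (simp add: first_crossed_def)

lemma alive_mono: "alive n c x \<Longrightarrow> c \<le> c' \<Longrightarrow> alive n c' x"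
  unfolding alive_def crossed_def by (meson le_less_trans)

lemma aliveD: "alive n c x \<Longrightarrow> k \<le> n \<Longrightarrow> x \<in> X \<Longrightarrow> norm (f k x) \<le> c \<and> norm (f (Suc k) x) \<le> c"
  unfolding alive_def crossed_def by (meson agree_refl not_le)

lemma stopped_not_alive: "\<not> alive 0 c x \<Longrightarrow> stopped c x = f 0 x"
  by (auto simp: stopped_def alive_def intro!: sum.neutral)

text \<open>The stopped value is \<open>f \<nu> x\<close> with \<open>\<nu>\<close> the first
  crossing, capped at \<open>L\<close>. If \<open>\<nu> = Suc n\<close>, the point is alive at
  \<open>n\<close>, and the look-ahead built into \<open>crossed\<close> has already tested level
  \<open>Suc n\<close>.\<close>

lemma norm_stopped_le:
  assumes "alive 0 c x" "x \<in> X"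
  shows "norm (stopped c x) \<le> c"
proof -
  define \<nu> where "\<nu> = (LEAST n. n = L \<or> \<not> alive n c x)"
  have "\<nu> = L \<or> \<not> alive \<nu> c x" unfolding \<nu>_def by (rule LeastI[of _ L]) simp
  then have dead: "\<not> alive n c x" if "\<nu> \<le> n" "n < L" for n
  proof -
    have "\<not> alive \<nu> c x" using \<open>\<nu> = L \<or> \<not> alive \<nu> c x\<close> that by auto
    then show ?thesis using that(1) unfolding alive_def by (meson le_trans)
  qed
  have le: "\<nu> \<le> L" unfolding \<nu>_def by (rule Least_le) simp
  have live: "alive n c x" if "n < \<nu>" for n
    using not_less_Least[OF that[unfolded \<nu>_def]] by simp
  have "(\<Sum>n<L. of_bool (alive n c x) * (f (Suc n) x - f n x)) = (\<Sum>n<\<nu>. f (Suc n) x - f n x)"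
    by (rule sum.mono_neutral_cong_right) (use le live dead in auto)
  then have eq: "stopped c x = f \<nu> x"
    by (simp add: stopped_def sum_lessThan_telescope[of "\<lambda>n. f n x"])
  show ?thesis
  proof (cases \<nu>)
    case 0
    then show ?thesis using aliveD[OF assms(1), of 0] assms(2) eq by simp
  next
    case (Suc n)
    then show ?thesis using aliveD[OF live[of n], of n] assms(2) eq by simp
  qed
qed

lemma norm_stopped_le_initial:
  assumes "x \<in> X" "0 \<le> c"
  shows "norm (stopped c x) \<le> c + norm (f 0 x)"
  using norm_stopped_le[of c x] stopped_not_alive[of c x] assms
  by (cases "alive 0 c x") (auto intro: order_trans)

text \<open>If even \<open>c'\<close> is crossed at level 0, both stopped values are
  \<open>f 0 x\<close> and cancel; otherwise both are bounded by \<open>c'\<close>.\<close>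

lemma norm_stopped_diff_le:
  assumes "x \<in> X" "c \<le> c'" "0 \<le> c'"
  shows "norm (stopped c' x - stopped c x) \<le> 2 * c'"
proof (cases "alive 0 c' x")
  case True
  have "norm (stopped c x) \<le> c'"
  proof (cases "alive 0 c x")
    case True
    then show ?thesis using norm_stopped_le[OF True assms(1)] assms by simp
  next
    case False
    then show ?thesis using aliveD[OF True, of 0] stopped_not_alive assms by simp
  qed
  then show ?thesis
    using norm_stopped_le[OF True assms(1)] norm_triangle_ineq4[of "stopped c' x" "stopped c x"]
    by linarith
next
  case False
  moreover from this have "\<not> alive 0 c x" using alive_mono assms(2) by blast
  ultimately show ?thesis using stopped_not_alive assms by simp
qed

section \<open>Splitting the difference of two stopped martingales into atoms\<close>

lemma stopped_diff:
  "stopped c' x - stopped c x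
     = (\<Sum>n<L. (of_bool (alive n c' x) - of_bool (alive n c x)) * (f (Suc n) x - f n x))"
  by (simp add: stopped_def sum_subtractf left_diff_distrib)

text \<open>The difference of the two stopped martingales on the cell of level \<open>i\<close>
  represented by \<open>t\<close>, kept only if that cell crosses \<open>c\<close> for the first
  time at level \<open>i\<close>.\<close>

definition atom :: "real \<Rightarrow> real \<Rightarrow> nat \<Rightarrow> nat \<Rightarrow> (nat \<Rightarrow> nat) \<Rightarrow> complex" where
  "atom c c' i t x = of_bool (first_crossed i c (vil_digit m t)) *
     (of_bool (agree i (vil_digit m t) x) * (stopped c' x - stopped c x))"

lemma sum_first_crossed:
  "(\<Sum>i<L. of_bool (first_crossed i c x)) = (of_bool (\<exists>i<L. crossed i c x) :: 'b::semiring_1)"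
proof (cases "\<exists>i<L. crossed i c x")
  case True
  define i where "i = (LEAST i. crossed i c x)"
  obtain j where j: "j < L" "crossed j c x" using True by blast
  have i: "crossed i c x" unfolding i_def by (rule LeastI[of _ j]) (rule j)
  have "i \<le> j" unfolding i_def by (rule Least_le) (rule j)
  moreover have less: "\<not> crossed k c x" if "k < i" for k
    using that not_less_Least unfolding i_def by blast
  moreover have "first_crossed k c x \<longleftrightarrow> k = i" for k
    using i less unfolding first_crossed_def by (metis linorder_neqE_nat)
  ultimately show ?thesis using True j by (simp add: of_bool_def)
next
  case False
  then show ?thesis by (auto simp: first_crossed_def)
qed

lemma lev_first_crossed: "lev i (\<lambda>x. of_bool (first_crossed i c x))"
  unfolding lev_def using first_crossed_agree[OF _ order_refl] by simp

lemma sum_first_crossed_cells: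
  fixes x
  assumes "x \<in> X"
  shows "(\<Sum>t<M i. of_bool (first_crossed i c (vil_digit m t)) * of_bool (agree i (vil_digit m t) x))
      = (of_bool (first_crossed i c x) :: 'b::real_algebra_1)"
proof -
  have "(of_bool (first_crossed i c x) :: 'b)
      = (\<Sum>t<M i. of_bool (agree i (vil_digit m t) x) *\<^sub>R of_bool (first_crossed i c (vil_digit m t)))"
    by (rule lev_expand[OF lev_first_crossed assms])
  also have "\<dots> = (\<Sum>t<M i. of_bool (first_crossed i c (vil_digit m t)) * of_bool (agree i (vil_digit m t) x))"
    by (intro sum.cong) auto
  finally show ?thesis by simp
qed

text \<open>The first crossed cells partition the set where \<open>c\<close> is crossed before level
  \<open>L\<close>. Off that set neither threshold stops anything, so the difference is zero
  there.\<close>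

lemma sum_atom:
  assumes x: "x \<in> X" and c: "c \<le> c'"
  shows "(\<Sum>i<L. \<Sum>t<M i. atom c c' i t x) = stopped c' x - stopped c x"
proof -
  have "(\<Sum>i<L. \<Sum>t<M i. atom c c' i t x)
      = (\<Sum>i<L. \<Sum>t<M i. of_bool (first_crossed i c (vil_digit m t)) * of_bool (agree i (vil_digit m t) x))
        * (stopped c' x - stopped c x)"
    unfolding atom_def sum_distrib_right by (simp add: mult.assoc)
  also have "\<dots> = of_bool (\<exists>i<L. crossed i c x) * (stopped c' x - stopped c x)"
    by (simp only: sum_first_crossed_cells[OF x] sum_first_crossed)
  also have "\<dots> = stopped c' x - stopped c x"
  proof (cases "\<exists>i<L. crossed i c x")
    case False
    then have "alive n c x" if "n < L" for n using that by (auto simp: alive_def)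
    then have "stopped c' x - stopped c x = 0"
      unfolding stopped_diff using alive_mono[OF _ c] by (intro sum.neutral) auto
    then show ?thesis by simp
  qed simp
  finally show ?thesis .
qed

text \<open>Increments from level \<open>i\<close> on are multiplied by a function of the past and
  average to zero. Before level \<open>i\<close> the cell is alive for \<open>c\<close>, hence for
  \<open>c'\<close>, and the two indicators cancel.\<close>

lemma avg_atom:
  assumes i: "i < L" and c: "c \<le> c'"
  shows "avg L (atom c c' i t) = 0"
proof (cases "first_crossed i c (vil_digit m t)")
  case True
  let ?z = "vil_digit m t"
  have "avg L (atom c c' i t) = avg L (\<lambda>x. \<Sum>n<L.
      (of_bool (agree i ?z x) * (of_bool (alive n c' x) - of_bool (alive n c x))) * (f (Suc n) x - f n x))"
    unfolding atom_def stopped_diff sum_distrib_left using True by (simp add: mult.assoc)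
  also have "\<dots> = (\<Sum>n<L. avg L (\<lambda>x.
      (of_bool (agree i ?z x) * (of_bool (alive n c' x) - of_bool (alive n c x))) * (f (Suc n) x - f n x)))"
    by (rule avg_sum)
  also have "\<dots> = 0"
  proof (rule sum.neutral, rule ballI)
    fix n assume "n \<in> {..<L}"
    then have n: "n < L" by simp
    show "avg L (\<lambda>x. (of_bool (agree i ?z x) * (of_bool (alive n c' x) - of_bool (alive n c x)))
        * (f (Suc n) x - f n x)) = 0"
    proof (cases "i \<le> n")
      case True
      have "lev n (\<lambda>x. of_bool (agree i ?z x) * (of_bool (alive n c' x) - of_bool (alive n c x)) :: complex)"
        unfolding lev_def
      proof (intro ballI impI)
        fix x y assume xy: "agree n x y"
        show "of_bool (agree i ?z x) * (of_bool (alive n c' x) - of_bool (alive n c x))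
          = (of_bool (agree i ?z y) * (of_bool (alive n c' y) - of_bool (alive n c y)) :: complex)"
          by (simp only: alive_agree[OF xy order_refl] agree_cong[OF xy True])
      qed
      then show ?thesis by (rule avg_lev_mult_eq_0) (rule mean_diff[OF n])
    next
      case False
      have zero: "(of_bool (agree i ?z x) * (of_bool (alive n c' x) - of_bool (alive n c x)))
          * (f (Suc n) x - f n x) = 0" for x
      proof (cases "agree i ?z x")
        case True
        have "alive n c ?z"
          using \<open>first_crossed i c ?z\<close> False by (auto simp: first_crossed_def alive_def)
        then have "alive n c x" using alive_agree[OF True, of n c] False by simp
        then show ?thesis using alive_mono[OF _ c] by simp
      qed simp
      show ?thesis unfolding zero by simp
    qed
  qed
  finally show ?thesis .
qed (simp add: atom_def[abs_def])

text \<open>A first crossed cell contains a child, of relative measure at least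
  \<open>1 / B\<close>, on which \<open>fmax\<close> exceeds \<open>c\<close>, and these cells are
  disjoint. Boundedness of \<open>m\<close> thus pays for the look-ahead in
  \<open>crossed\<close>.\<close>

lemma sum_cells_le:
  "(\<Sum>i<L. \<Sum>t<M i. of_bool (first_crossed i c (vil_digit m t)) * (1 / M i))
     \<le> real B * avg L (\<lambda>x. of_bool (c < fmax x))"
proof -
  have cell: "of_bool (first_crossed i c (vil_digit m t)) * (1 / M i)
      \<le> real B * avg L (\<lambda>x. of_bool (first_crossed i c (vil_digit m t)) *
          of_bool (agree i (vil_digit m t) x) * of_bool (c < fmax x))" if i: "i < L" for i t
  proof (cases "first_crossed i c (vil_digit m t)")
    case True
    then obtain y where y: "y \<in> X" "agree i (vil_digit m t) y" "c < norm (f i y) \<or> c < norm (f (Suc i) y)"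
      by (auto simp: first_crossed_def crossed_def)
    have "1 / real (M (Suc i)) = avg L (\<lambda>x. of_bool (agree (Suc i) y x))"
      using avg_agree[OF y(1), of "Suc i" L] i by simp
    also have "\<dots> \<le> avg L (\<lambda>x. of_bool (agree i (vil_digit m t) x) * of_bool (c < fmax x))"
    proof (rule avg_mono)
      fix x assume x: "x \<in> X"
      show "of_bool (agree (Suc i) y x) \<le> (of_bool (agree i (vil_digit m t) x) * of_bool (c < fmax x) :: real)"
      proof (cases "agree (Suc i) y x")
        case True
        have "agree i y x" using True by (rule agree_mono) simp
        then have "f i x = f i y" "agree i (vil_digit m t) x"
          using levD[OF lev_f _ y(1) x, of i] i agree_trans[OF y(2)] by auto
        moreover have "f (Suc i) x = f (Suc i) y"
          using levD[OF lev_f True y(1) x] i by simp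
        ultimately have "c < fmax x"
          using y(3) fmax_ge[of i x] fmax_ge[of "Suc i" x] i by auto
        then show ?thesis using \<open>agree i (vil_digit m t) x\<close> by simp
      qed simp
    qed
    finally have "real B * (1 / real (M (Suc i)))
        \<le> real B * avg L (\<lambda>x. of_bool (agree i (vil_digit m t) x) * of_bool (c < fmax x))"
      by (rule mult_left_mono) simp
    moreover have "1 / real (M i) \<le> real B * (1 / real (M (Suc i)))"
      using M_Suc_real_le[of i] by (simp add: field_simps)
    ultimately show ?thesis using True by simp
  qed simp
  have "(\<Sum>i<L. \<Sum>t<M i. of_bool (first_crossed i c (vil_digit m t)) * (1 / M i))
      \<le> (\<Sum>i<L. \<Sum>t<M i. real B * avg L (\<lambda>x. of_bool (first_crossed i c (vil_digit m t)) *
          of_bool (agree i (vil_digit m t) x) * of_bool (c < fmax x)))"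
    by (intro sum_mono cell) simp
  also have "\<dots> = real B * avg L (\<lambda>x. \<Sum>i<L. \<Sum>t<M i. of_bool (first_crossed i c (vil_digit m t)) *
          of_bool (agree i (vil_digit m t) x) * of_bool (c < fmax x))"
    by (simp only: avg_sum sum_distrib_left)
  also have "\<dots> = real B * avg L (\<lambda>x. of_bool (\<exists>i<L. crossed i c x) * of_bool (c < fmax x))"
    by (intro arg_cong2[where f = "(*)"] refl avg_cong)
      (simp only: sum_distrib_right[symmetric] sum_first_crossed_cells sum_first_crossed)
  also have "\<dots> \<le> real B * avg L (\<lambda>x. of_bool (c < fmax x))"
    by (intro mult_left_mono avg_mono) auto
  finally show ?thesis .
qed

lemma sqr_atom_le:
  assumes x: "x \<in> X" and i: "i < L" and c: "c \<le> c'" "0 \<le> c'" and n: "1 \<le> n" "n \<le> L"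
  shows "sqr L n x (atom c c' i t)
    \<le> of_bool (first_crossed i c (vil_digit m t)) * (sqrt (2 * c') * bump i (vil_digit m t) x)"
proof (cases "first_crossed i c (vil_digit m t)")
  case True
  let ?z = "vil_digit m t"
  have "norm (riesz L (atom c c' i t) n x) \<le> 2 * c' * (bump i ?z x)\<^sup>2 * ln (real n + 1)"
  proof (rule norm_riesz_atom_le[OF x digit_in_X less_imp_le[OF i] _ _ avg_atom[OF i c(1)] n])
    fix y assume "y \<in> X"
    then show "norm (atom c c' i t y) \<le> 2 * c'"
      using norm_stopped_diff_le[of y c c'] c by (auto simp: atom_def of_bool_def)
  qed (simp add: atom_def)
  then have "sqr L n x (atom c c' i t) \<le> sqrt (2 * c' * (bump i ?z x)\<^sup>2)"
    by (rule sqr_leI) (rule n)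
  then show ?thesis using True by (simp add: real_sqrt_mult bump_nonneg)
next
  case False
  then show ?thesis by (simp add: atom_def[abs_def] sqr_def riesz_0)
qed

section \<open>Summation over the thresholds\<close>

lemma f_bounded: "\<exists>C\<ge>0. \<forall>n\<le>L. \<forall>x\<in>X. norm (f n x) \<le> C"
proof (intro exI conjI allI impI ballI)
  let ?C = "\<Sum>n\<le>L. \<Sum>t<M L. norm (f n (vil_digit m t))"
  show "0 \<le> ?C" by (intro sum_nonneg) simp
  fix n x assume n: "n \<le> L" and x: "x \<in> X"
  obtain t where t: "t < M L" "agree L x (vil_digit m t)" using digit_exists[OF x] .
  have "norm (f n x) = norm (f n (vil_digit m t))"
    using levD[OF lev_mono[OF lev_f[OF n] n] t(2) x] by simp
  also have "\<dots> \<le> (\<Sum>t<M L. norm (f n (vil_digit m t)))"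
    by (rule member_le_sum) (use t in auto)
  also have "\<dots> \<le> ?C"
    by (rule member_le_sum) (use n in \<open>auto intro: sum_nonneg\<close>)
  finally show "norm (f n x) \<le> ?C" .
qed

text \<open>The first term comes from the martingale stopped at the lowest threshold. In the second,
  \<open>6\<close> is \<open>3 \<ge> sqrt 8\<close> times the dyadic factor 2, \<open>B\<close>
  comes from \<open>sum_cells_le\<close> and the bracket from \<open>avg_bump\<close>.\<close>

definition bound_const :: real where
  "bound_const = sqrt (5 * B) + 6 * real B * (5 * real B + 18 * real B ^ 2)"

lemma sqrt_initial_le: "sqrt (norm (f 0 (vil_digit m 0))) \<le> avg L (\<lambda>x. sqrt (fmax x))"
proof -
  have "avg L (\<lambda>x. sqrt (norm (f 0 (vil_digit m 0)))) \<le> avg L (\<lambda>x. sqrt (fmax x))"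
  proof (intro avg_mono real_sqrt_le_mono)
    fix x assume x: "x \<in> X"
    then show "norm (f 0 (vil_digit m 0)) \<le> fmax x"
      using levD[OF lev_f, of 0 x "vil_digit m 0"] fmax_ge[of 0 x] by simp
  qed
  then show ?thesis by simp
qed

text \<open>The thresholds are chosen so that their square roots \<open>e * 2 ^ k\<close> are
  dyadic. The lowest is positive, so finitely many suffice; what remains below it is bounded by
  \<open>c 0\<close> plus the modulus of the constant \<open>f 0\<close>. The majorant does not
  involve \<open>n\<close>, and the weighted measures of the sets where \<open>fmax\<close> exceeds
  \<open>c k\<close> sum to at most \<open>2 * sqrt (fmax x)\<close> in the average.\<close>

lemma maximal_bound_eps:
  assumes e: "0 < e"
  obtains \<Phi> where "\<And>x n. x \<in> X \<Longrightarrow> 1 \<le> n \<Longrightarrow> n \<le> L \<Longrightarrow> sqr L n x (f L) \<le> \<Phi> x"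
    and "avg L \<Phi> \<le> bound_const * (e + avg L (\<lambda>x. sqrt (fmax x)))"
proof -
  define c where "c k = e\<^sup>2 * 4 ^ k" for k :: nat
  have c0: "0 \<le> c k" for k by (simp add: c_def)
  have c_Suc: "c (Suc k) = 4 * c k" for k by (simp add: c_def)
  have c_mono: "c k \<le> c (Suc k)" for k using c0[of k] by (simp add: c_Suc)
  have sqrt_c: "sqrt (c k) = e * 2 ^ k" for k
    using e real_sqrt_power[of 4 k] by (simp add: c_def real_sqrt_mult)
  obtain C where C: "\<And>n x. n \<le> L \<Longrightarrow> x \<in> X \<Longrightarrow> norm (f n x) \<le> C"
    using f_bounded by blast
  \<comment> \<open>The top threshold dominates \<open>f\<close> on all levels up to
    \<open>L\<close>, so stopping there changes nothing.\<close>
  obtain K where K: "C \<le> c K"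
  proof -
    obtain K where "C / e\<^sup>2 < 4 ^ K" using real_arch_pow[of 4 "C / e\<^sup>2"] by auto
    then show ?thesis using that[of K] e by (simp add: c_def field_simps)
  qed
  have stopped_K: "stopped (c K) x = f L x" if x: "x \<in> X" for x
  proof -
    have "alive n (c K) x" if "n < L" for n
      unfolding alive_def crossed_def
    proof clarify
      fix i y assume "i \<le> n" "y \<in> X" "c K < norm (f i y) \<or> c K < norm (f (Suc i) y)"
      then show False using C[of i y] C[of "Suc i" y] K \<open>n < L\<close> by auto
    qed
    then have "stopped (c K) x = f 0 x + (\<Sum>n<L. f (Suc n) x - f n x)"
      by (simp add: stopped_def)
    then show ?thesis by (simp add: sum_lessThan_telescope[of "\<lambda>n. f n x"])
  qed
  have decomp: "f L x = stopped (c 0) x + (\<Sum>k<K. \<Sum>i<L. \<Sum>t<M i. atom (c k) (c (Suc k)) i t x)"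
    if x: "x \<in> X" for x
    using sum_atom[OF x c_mono] stopped_K[OF x]
    by (simp add: sum_lessThan_telescope[of "\<lambda>k. stopped (c k) x"])
  let ?fc = "\<lambda>k i t. of_bool (first_crossed i (c k) (vil_digit m t)) :: real"
  define F0 where "F0 = norm (f 0 (vil_digit m 0))"
  define \<Phi> where "\<Phi> x = sqrt (5 * B * (c 0 + F0))
    + (\<Sum>k<K. \<Sum>i<L. \<Sum>t<M i. ?fc k i t * (sqrt (2 * c (Suc k)) * bump i (vil_digit m t) x))" for x
  show ?thesis
  proof
    fix x n assume x: "x \<in> X" and n: "1 \<le> n" "n \<le> L"
    have "sqr L n x (f L) = sqr L n x (\<lambda>x. stopped (c 0) x
        + (\<Sum>k<K. \<Sum>i<L. \<Sum>t<M i. atom (c k) (c (Suc k)) i t x))"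
      by (rule sqr_cong) (rule decomp)
    also have "\<dots> \<le> sqr L n x (stopped (c 0))
        + (\<Sum>k<K. \<Sum>i<L. \<Sum>t<M i. sqr L n x (atom (c k) (c (Suc k)) i t))"
      by (rule order_trans[OF sqr_add] add_left_mono order_trans[OF sqr_sum] sum_mono sqr_sum
          finite_lessThan)+
    also have "\<dots> \<le> \<Phi> x"
      unfolding \<Phi>_def
    proof (intro add_mono sum_mono sqr_atom_le x c_mono c0 n)
      have "norm (riesz L (stopped (c 0)) n x) \<le> 5 * real B * (c 0 + F0) * ln (real n + 1)"
      proof (rule norm_riesz_le_ln[OF x _ n])
        fix t assume t: "t \<in> X"
        then have "f 0 t = f 0 (vil_digit m 0)"
          using levD[OF lev_f, of 0 t "vil_digit m 0"] by simp
        then show "norm (stopped (c 0) t) \<le> c 0 + F0"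
          using norm_stopped_le_initial[OF t c0[of 0]] by (simp add: F0_def)
      qed
      then show "sqr L n x (stopped (c 0)) \<le> sqrt (5 * B * (c 0 + F0))"
        using sqr_leI[OF _ n(1)] by simp
    qed auto
    finally show "sqr L n x (f L) \<le> \<Phi> x" .
  next
    let ?Cb = "5 * real B + 18 * real B ^ 2"
    let ?Y = "avg L (\<lambda>x. sqrt (fmax x))"
    have "avg L \<Phi> = sqrt (5 * B * (c 0 + F0))
      + (\<Sum>k<K. \<Sum>i<L. \<Sum>t<M i. ?fc k i t * (sqrt (2 * c (Suc k)) * avg L (bump i (vil_digit m t))))"
      unfolding \<Phi>_def[abs_def] avg_add avg_sum avg_mult_left by simp
    also have "\<dots> \<le> sqrt (5 * B) * (e + ?Y) + (\<Sum>k<K. 3 * real B * ?Cb * (e * 2 ^ k * avg L (\<lambda>x. of_bool (c k < fmax x))))"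
    proof (intro add_mono sum_mono)
      have "sqrt (c 0 + F0) \<le> sqrt (c 0) + sqrt F0"
        by (rule sqrt_add_le_add_sqrt) (simp_all add: c0 F0_def)
      also have "\<dots> \<le> e + ?Y"
        using sqrt_initial_le by (simp add: sqrt_c F0_def)
      finally show "sqrt (5 * B * (c 0 + F0)) \<le> sqrt (5 * B) * (e + ?Y)"
        unfolding real_sqrt_mult by (rule mult_left_mono) simp
    next
      fix k
      have "(\<Sum>i<L. \<Sum>t<M i. ?fc k i t * (sqrt (2 * c (Suc k)) * avg L (bump i (vil_digit m t))))
          \<le> (\<Sum>i<L. \<Sum>t<M i. ?fc k i t * (sqrt (2 * c (Suc k)) * (?Cb / M i)))"
        by (intro sum_mono mult_left_mono avg_bump) (auto simp: c0)
      also have "\<dots> = sqrt (2 * c (Suc k)) * ?Cb * (\<Sum>i<L. \<Sum>t<M i. ?fc k i t * (1 / M i))"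
        unfolding sum_distrib_left by (intro sum.cong) auto
      also have "\<dots> \<le> sqrt (2 * c (Suc k)) * ?Cb * (real B * avg L (\<lambda>x. of_bool (c k < fmax x)))"
        by (intro mult_left_mono sum_cells_le) (simp add: c0)
      also have "\<dots> = sqrt 8 * (?Cb * (e * 2 ^ k) * (real B * avg L (\<lambda>x. of_bool (c k < fmax x))))"
        by (simp add: c_Suc real_sqrt_mult sqrt_c)
      also have "\<dots> \<le> 3 * (?Cb * (e * 2 ^ k) * (real B * avg L (\<lambda>x. of_bool (c k < fmax x))))"
        by (intro mult_right_mono mult_nonneg_nonneg avg_nonneg real_le_lsqrt) (use e in auto)
      finally show "(\<Sum>i<L. \<Sum>t<M i. ?fc k i t * (sqrt (2 * c (Suc k)) * avg L (bump i (vil_digit m t))))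
          \<le> 3 * real B * ?Cb * (e * 2 ^ k * avg L (\<lambda>x. of_bool (c k < fmax x)))"
        by (simp only: mult_ac)
    qed
    also have "(\<Sum>k<K. 3 * real B * ?Cb * (e * 2 ^ k * avg L (\<lambda>x. of_bool (c k < fmax x))))
        = 3 * real B * ?Cb * avg L (\<lambda>x. \<Sum>k<K. e * 2 ^ k * of_bool (c k < fmax x))"
      by (simp only: avg_sum avg_mult_left sum_distrib_left)
    also have "\<dots> \<le> 3 * real B * ?Cb * avg L (\<lambda>x. 2 * sqrt (fmax x))"
    proof (intro mult_left_mono avg_mono)
      fix x
      have "c k < fmax x \<longleftrightarrow> e * 2 ^ k < sqrt (fmax x)" for k
        unfolding sqrt_c[symmetric] by simp
      then show "(\<Sum>k<K. e * 2 ^ k * of_bool (c k < fmax x)) \<le> 2 * sqrt (fmax x)"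
        using sum_dyadic_le[of "sqrt (fmax x)" e K] e by (simp add: fmax_nonneg mult.commute)
    qed simp
    also have "\<dots> = 6 * real B * ?Cb * ?Y"
      unfolding avg_mult_left by simp
    also have "\<dots> \<le> 6 * real B * ?Cb * (e + ?Y)"
      using e by (intro mult_left_mono) auto
    finally show "avg L \<Phi> \<le> bound_const * (e + ?Y)"
      by (simp add: bound_const_def distrib_right)
  qed
qed

end

section \<open>The maximal operator with logarithmic weight\<close>

text \<open>Trades a square root on \<open>[0, \<infinity>]\<close> for a product, so that suprema
  can be compared without continuity of the root; infinite values are covered.\<close>

lemma epowr_half_le_iff: "epowr a (1/2) \<le> b \<longleftrightarrow> a \<le> b * b"
proof (cases a)
  case (real r)
  note a = this
  show ?thesis
  proof (cases b)
    case (real s)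
    have "sqrt r \<le> s \<longleftrightarrow> r \<le> s * s"
      using a real real_sqrt_le_iff[of r "s * s"] by simp
    then show ?thesis
      using a real by (simp add: epowr_def powr_half_sqrt flip: ennreal_mult)
  qed (use a in \<open>simp add: ennreal_mult_top\<close>)
next
  case top
  then show ?thesis by (cases b) (simp_all add: epowr_def ennreal_mult_eq_top_iff top_unique flip: ennreal_mult)
qed

lemma epowr_half_ennreal: "0 \<le> r \<Longrightarrow> epowr (ennreal r) (1/2) = ennreal (sqrt r)"
  by (simp add: epowr_def powr_half_sqrt)

lemma epowr_half_mono:
  assumes "a \<le> b"
  shows "epowr a (1/2) \<le> epowr b (1/2)"
proof -
  have "b \<le> epowr b (1/2) * epowr b (1/2)"
    using epowr_half_le_iff[of b "epowr b (1/2)"] by simp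
  then show ?thesis unfolding epowr_half_le_iff using assms by (rule order_trans[rotated])
qed

lemma epowr_two: "epowr a 2 = a * a"
  by (cases a) (simp_all add: epowr_def power2_eq_square ennreal_mult_top flip: ennreal_mult)

lemma epowr_two_le:
  assumes "I \<le> ennreal C * J" "0 \<le> C"
  shows "epowr I 2 \<le> ennreal (C * C) * epowr J 2"
proof -
  have "I * I \<le> (ennreal C * J) * (ennreal C * J)"
    using assms(1) by (intro mult_mono) auto
  then show ?thesis
    using assms(2) by (simp add: epowr_two ennreal_mult mult_ac)
qed

section \<open>Vilenkin martingales at a finite level\<close>

context bounded_vilenkin
begin

lemma space_vil_filtration [simp]: "space (vil_filtration m n) = X"
  using subalgebra_vil_filtration[of m n] by (simp add: subalgebra_def)

lemma sets_vil_filtration: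
  "sets (vil_filtration m n) = sigma_sets X (vil_interval m n ` X)"
  unfolding vil_filtration_def by (rule sets_measure_of) (auto simp: vil_interval_eq)

text \<open>Sets that do not separate points of a common cell form a sigma-algebra containing the
  generating cells.\<close>

lemma vil_filtration_closed:
  assumes "A \<in> sets (vil_filtration m n)" "agree n x y" "x \<in> X" "y \<in> X"
  shows "x \<in> A \<longleftrightarrow> y \<in> A"
  using assms(1) unfolding sets_vil_filtration
proof (induction rule: sigma_sets.induct)
  case (Basic a)
  then obtain z where z: "a = {y \<in> X. agree n z y}" by (auto simp: vil_interval_eq)
  show ?case
    unfolding z using assms agree_trans[of n z x y] agree_trans[of n z y x] agree_sym[of n x y] by blast
qed (use assms in simp_all)

text \<open>The preimage of the single value \<open>g x\<close> is measurable, hence a union of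
  cells. Equality therefore holds at every point, with no exceptional null set.\<close>

lemma lev_of_measurable:
  fixes g :: "_ \<Rightarrow> 'b::t1_space"
  assumes "g \<in> borel_measurable (vil_filtration m n)"
  shows "lev n g"
  unfolding lev_def
proof (intro ballI impI)
  fix x y assume *: "x \<in> X" "y \<in> X" "agree n x y"
  have "g -` {g x} \<inter> space (vil_filtration m n) \<in> sets (vil_filtration m n)"
    by (rule measurable_sets[OF assms]) simp
  from vil_filtration_closed[OF this *(3,1,2)] * show "g x = g y" by simp
qed

lemma vil_interval_in_filtration: "x \<in> X \<Longrightarrow> vil_interval m n x \<in> sets (vil_filtration m n)"
  unfolding sets_vil_filtration by (intro sigma_sets.Basic imageI)

lemma avg_Re: "Re (avg L g) = avg L (\<lambda>x. Re (g x))"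
  by (simp add: avg_def)

lemma avg_Im: "Im (avg L g) = avg L (\<lambda>x. Im (g x))"
  by (simp add: avg_def)

text \<open>The defining property of conditional expectation is tested on one cell; the almost
  everywhere identity then becomes an exact identity of averages.\<close>

lemma avg_cond_exp:
  fixes u v :: "_ \<Rightarrow> real"
  assumes u: "lev L u" and v: "lev L v" and n: "n \<le> L" and x: "x \<in> X"
    and ae: "AE y in vil_measure m. u y = real_cond_exp (vil_measure m) (vil_filtration m n) v y"
  shows "avg L (\<lambda>y. of_bool (agree n x y) * (v y - u y)) = 0"
proof -
  interpret sub: finite_measure_subalgebra "vil_measure m" "vil_filtration m n"
    by unfold_locales (rule subalgebra_vil_filtration)
  let ?I = "vil_interval m n x"
  have "avg L (\<lambda>y. of_bool (agree n x y) * (v y - u y))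
      = avg L (\<lambda>y. of_bool (agree n x y) * v y) - avg L (\<lambda>y. of_bool (agree n x y) * u y)"
    by (simp add: right_diff_distrib avg_diff)
  also have "avg L (\<lambda>y. of_bool (agree n x y) * v y) = (\<integral>y. of_bool (agree n x y) * v y \<partial>vil_measure m)"
    by (rule integral_lev[symmetric]) (intro lev_mult lev_agree n v)
  also have "\<dots> = (\<integral>y\<in>?I. v y \<partial>vil_measure m)"
    unfolding set_lebesgue_integral_def
    by (rule Bochner_Integration.integral_cong) (auto simp: vil_interval_eq)
  also have "\<dots> = (\<integral>y\<in>?I. real_cond_exp (vil_measure m) (vil_filtration m n) v y \<partial>vil_measure m)"
    by (rule sub.real_cond_exp_intA) (use integrable_lev[OF v] vil_interval_in_filtration[OF x] in auto)
  also have "\<dots> = (\<integral>y. of_bool (agree n x y) * u y \<partial>vil_measure m)"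
    unfolding set_lebesgue_integral_def
  proof (rule integral_cong_AE)
    show "AE y in vil_measure m. indicat_real ?I y *\<^sub>R real_cond_exp (vil_measure m) (vil_filtration m n) v y
        = of_bool (agree n x y) * u y"
      using ae by (rule AE_mp) (rule AE_I2, auto simp: vil_interval_eq)
    show "(\<lambda>y. of_bool (agree n x y) * u y) \<in> borel_measurable (vil_measure m)"
      by (rule borel_measurable_integrable, rule integrable_lev[of L]) (intro lev_mult lev_agree n u)
    show "(\<lambda>y. indicat_real ?I y *\<^sub>R real_cond_exp (vil_measure m) (vil_filtration m n) v y)
        \<in> borel_measurable (vil_measure m)"
      using sets_vil_interval by measurable
  qed
  also have "\<dots> = avg L (\<lambda>y. of_bool (agree n x y) * u y)"
    by (rule integral_lev) (intro lev_mult lev_agree n u)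
  finally show ?thesis by simp
qed

lemma vil_martingale_finite:
  assumes f: "vil_martingale m f"
  shows "finite_martingale m B L f"
proof unfold_locales
  have lev: "lev n (f n)" for n
    using f by (intro lev_of_measurable) (simp add: vil_martingale_def)
  then show "lev n (f n)" for n .
  fix n x assume n: "n < L" and x: "x \<in> X"
  have AE: "AE y in vil_measure m. f n y =
      Complex (real_cond_exp (vil_measure m) (vil_filtration m n) (\<lambda>y. Re (f (Suc n) y)) y)
              (real_cond_exp (vil_measure m) (vil_filtration m n) (\<lambda>y. Im (f (Suc n) y)) y)"
    using f by (simp add: vil_martingale_def)
  have L: "lev L (f n)" "lev L (f (Suc n))"
    using n lev_mono[OF lev] by auto
  show "avg L (\<lambda>y. of_bool (agree n x y) * (f (Suc n) y - f n y)) = 0"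
  proof (rule complex_eqI)
    have "avg L (\<lambda>y. of_bool (agree n x y) * (Re (f (Suc n) y) - Re (f n y))) = 0"
      by (rule avg_cond_exp[OF lev_comp[OF L(1)] lev_comp[OF L(2)] less_imp_le[OF n] x])
        (use AE in eventually_elim, simp)
    then show "Re (avg L (\<lambda>y. of_bool (agree n x y) * (f (Suc n) y - f n y))) = Re 0"
      by (simp add: avg_Re of_bool_def if_distrib[of "\<lambda>c. c * _"] if_distrib[of Re] cong: if_cong)
    have "avg L (\<lambda>y. of_bool (agree n x y) * (Im (f (Suc n) y) - Im (f n y))) = 0"
      by (rule avg_cond_exp[OF lev_comp[OF L(1)] lev_comp[OF L(2)] less_imp_le[OF n] x])
        (use AE in eventually_elim, simp)
    then show "Im (avg L (\<lambda>y. of_bool (agree n x y) * (f (Suc n) y - f n y))) = Im 0"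
      by (simp add: avg_Im of_bool_def if_distrib[of "\<lambda>c. c * _"] if_distrib[of Im] cong: if_cong)
  qed
qed

lemma lev_coef_integrand: "lev L a \<Longrightarrow> j < M L \<Longrightarrow> lev L (\<lambda>t. a t * cnj (\<psi> j t))"
  by (intro lev_mult lev_comp[OF lev_psi])

text \<open>For \<open>j < M L\<close> the character has level \<open>L\<close>, so later increments
  are orthogonal to it. The sequence defining the coefficient is constant from \<open>L\<close>
  on.\<close>

lemma vil_coeff_eq:
  assumes f: "vil_martingale m f" and j: "j < M L"
  shows "vil_coeff m f j = coef L (f L) j"
proof -
  have "(LINT x|vil_measure m. f k x * cnj (\<psi> j x)) = coef L (f L) j" if k: "L \<le> k" for k
  proof -
    interpret finite_martingale m B k f by (rule vil_martingale_finite[OF f])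
    have jM: "j < M n" if "L \<le> n" for n using j M_mono[OF that] by simp
    have "(LINT x|vil_measure m. f k x * cnj (\<psi> j x)) = avg k (\<lambda>x. f k x * cnj (\<psi> j x))"
      by (rule integral_lev[OF lev_coef_integrand[OF lev_f[OF order_refl] jM[OF k]]])
    also have "\<dots> = avg k (\<lambda>x. f L x * cnj (\<psi> j x))"
    proof -
      have "avg k (\<lambda>x. f n x * cnj (\<psi> j x)) = avg k (\<lambda>x. f L x * cnj (\<psi> j x))" if "L \<le> n" "n \<le> k" for n
        using that
      proof (induction n rule: dec_induct)
        case (step n)
        have "avg k (\<lambda>x. cnj (\<psi> j x) * (f (Suc n) x - f n x)) = 0"
          by (rule avg_lev_mult_eq_0[of n])
            (use step in \<open>auto intro!: lev_comp[OF lev_psi] jM mean_diff\<close>)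
        then have "avg k (\<lambda>x. f (Suc n) x * cnj (\<psi> j x)) = avg k (\<lambda>x. f n x * cnj (\<psi> j x))"
          by (simp add: right_diff_distrib avg_diff mult.commute)
        then show ?case using step by simp
      qed simp
      from this[OF k order_refl] show ?thesis .
    qed
    also have "\<dots> = coef L (f L) j"
      unfolding coef_def by (rule avg_lev_eq[OF lev_coef_integrand[OF lev_f[OF k] j] k])
    finally show ?thesis .
  qed
  then have "(\<lambda>k. LINT x|vil_measure m. f k x * cnj (\<psi> j x)) \<longlonglongrightarrow> coef L (f L) j"
    by (intro tendsto_eventually eventually_sequentiallyI)
  then show ?thesis unfolding vil_coeff_def by (rule limI)
qed

lemma riesz_mean_eq:
  assumes f: "vil_martingale m f" and n: "n \<le> L"
  shows "riesz_mean m f n x = riesz L (f L) n x"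
proof -
  have "vil_partial_sum m f k x = psum L (f L) k x" if "k \<in> {1..n}" for k
    unfolding vil_partial_sum_def psum_def
    by (intro sum.cong) (use that n less_M[of L] in \<open>auto intro!: vil_coeff_eq[OF f]\<close>)
  then show ?thesis unfolding riesz_mean_def riesz_def by simp
qed

lemma lev_riesz:
  assumes "n \<le> L"
  shows "lev L (riesz L a n)"
  unfolding lev_def
proof (intro ballI impI)
  fix x y assume "agree L x y"
  then have "\<psi> k x = \<psi> k y" if "k < n" for k
    using that assms less_M[of L] by (intro psi_agree) auto
  then have "psum L a k x = psum L a k y" if "k \<in> {1..n}" for k
    using that unfolding psum_def by (intro sum.cong) auto
  then show "riesz L a n x = riesz L a n y" unfolding riesz_def by simp
qed

end

section \<open>Passage to the supremum over all indices\<close>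

context finite_martingale
begin

lemma lev_fmax: "lev L fmax"
  unfolding lev_def
proof (intro ballI impI)
  fix x y assume xy: "x \<in> X" "y \<in> X" "agree L x y"
  then have "f n x = f n y" if "n \<le> L" for n
    using levD[OF lev_mono[OF lev_f[OF that] that]] by blast
  then show "fmax x = fmax y" unfolding fmax_def by (intro arg_cong[where f = Max] image_cong) auto
qed

lemma sqrt_fmax_le: "ennreal (sqrt (fmax x)) \<le> epowr (martingale_maximal f x) (1/2)"
proof -
  have "fmax x \<in> (\<lambda>n. norm (f n x)) ` {..L}"
    unfolding fmax_def by (rule Max_in) auto
  then obtain n where "fmax x = norm (f n x)" by blast
  then have "ennreal (fmax x) \<le> martingale_maximal f x"
    unfolding martingale_maximal_def by (auto intro: SUP_upper)
  from epowr_half_mono[OF this] show ?thesis by (simp add: epowr_half_ennreal fmax_nonneg)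
qed

lemma avg_sqrt_fmax_le:
  "ennreal (avg L (\<lambda>x. sqrt (fmax x))) \<le> (\<integral>\<^sup>+x. epowr (martingale_maximal f x) (1/2) \<partial>vil_measure m)"
  by (subst nn_integral_lev[symmetric])
    (auto intro!: lev_comp[OF lev_fmax] nn_integral_mono sqrt_fmax_le simp: fmax_nonneg)

text \<open>The lowest threshold is sent to zero, scaled by \<open>bound_const\<close> so that the
  error is exactly \<open>e\<close>.\<close>

lemma maximal_bound:
  assumes L: "1 \<le> L"
  shows "avg L (\<lambda>x. Max ((\<lambda>n. sqr L n x (f L)) ` {1..L})) \<le> bound_const * avg L (\<lambda>x. sqrt (fmax x))"
    (is "?T \<le> _ * ?Y")
proof (rule field_le_epsilon)
  fix e :: real assume e: "0 < e"
  have C: "0 < bound_const" using B_ge by (simp add: bound_const_def add_pos_pos)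
  have "0 < e / bound_const" using e C by simp
  from maximal_bound_eps[OF this] obtain \<Phi> where
    \<Phi>: "\<And>x n. x \<in> X \<Longrightarrow> 1 \<le> n \<Longrightarrow> n \<le> L \<Longrightarrow> sqr L n x (f L) \<le> \<Phi> x"
    "avg L \<Phi> \<le> bound_const * (e / bound_const + ?Y)" by blast
  have "?T \<le> avg L \<Phi>"
    using L \<Phi>(1) by (intro avg_mono) auto
  also have "\<dots> \<le> bound_const * ?Y + e"
    using \<Phi>(2) C by (simp add: distrib_left)
  finally show "?T \<le> bound_const * ?Y + e" .
qed

end

context bounded_vilenkin
begin

lemma measurable_riesz_mean:
  assumes f: "vil_martingale m f"
  shows "riesz_mean m f n \<in> borel_measurable (vil_measure m)"
proof -
  have "riesz_mean m f n = riesz n (f n) n"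
    using riesz_mean_eq[OF f order_refl] by blast
  then show ?thesis
    using integrable_lev[OF lev_riesz[OF order_refl, of n "f n"]] by (simp add: borel_measurable_integrable)
qed

text \<open>The square root of the supremum is the increasing limit of the maxima over
  \<open>n \<le> Suc k\<close>. The estimate at level \<open>Suc k\<close> has a constant free of
  \<open>k\<close>, so monotone convergence finishes the proof.\<close>

lemma nn_integral_riesz_maximal_le:
  assumes f: "vil_martingale m f"
  shows "(\<integral>\<^sup>+x. epowr (riesz_maximal m (\<lambda>n. ln (real n + 1)) f x) (1/2) \<partial>vil_measure m)
     \<le> ennreal (sqrt (5 * B) + 6 * real B * (5 * real B + 18 * real B ^ 2))
        * (\<integral>\<^sup>+x. epowr (martingale_maximal f x) (1/2) \<partial>vil_measure m)"
    (is "_ \<le> ennreal ?C * ?J")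
proof -
  define r where "r n x = sqrt (norm (riesz_mean m f n x) / ln (real n + 1))" for n x
  define H where "H k x = (SUP n\<in>{1..Suc k}. ennreal (r n x))" for k x
  have r: "r n x = sqr L n x (f L)" if "n \<le> L" for n L x
    unfolding r_def sqr_def riesz_mean_eq[OF f that] ..
  have r0: "0 \<le> r n x" for n x
    by (simp add: r_def)
  have [measurable]: "r n \<in> borel_measurable (vil_measure m)" for n
    unfolding r_def using measurable_riesz_mean[OF f] by measurable
  have "(\<integral>\<^sup>+x. epowr (riesz_maximal m (\<lambda>n. ln (real n + 1)) f x) (1/2) \<partial>vil_measure m)
      \<le> (\<integral>\<^sup>+x. (SUP k. H k x) \<partial>vil_measure m)"
  proof (rule nn_integral_mono)
    fix x
    have "ennreal (norm (riesz_mean m f n x) / ln (real n + 1)) \<le> (SUP k. H k x) * (SUP k. H k x)"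
      if "n \<in> {1..}" for n
    proof -
      have "ennreal (r n x) \<le> H n x" unfolding H_def by (rule SUP_upper) (use that in auto)
      also have "\<dots> \<le> (SUP k. H k x)" by (rule SUP_upper) simp
      finally show ?thesis
        unfolding epowr_half_le_iff[symmetric] by (subst epowr_half_ennreal) (auto simp: r_def)
    qed
    then show "epowr (riesz_maximal m (\<lambda>n. ln (real n + 1)) f x) (1/2) \<le> (SUP k. H k x)"
      unfolding epowr_half_le_iff riesz_maximal_def by (rule SUP_least)
  qed
  also have "\<dots> = (SUP k. \<integral>\<^sup>+x. H k x \<partial>vil_measure m)"
  proof (rule nn_integral_monotone_convergence_SUP)
    show "incseq H"
      unfolding H_def by (intro incseq_SucI le_funI SUP_subset_mono) auto
    show "H k \<in> borel_measurable (vil_measure m)" for k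
      unfolding H_def by measurable
  qed
  also have "\<dots> \<le> ennreal ?C * ?J"
  proof (rule SUP_least)
    fix k
    let ?L = "Suc k"
    interpret finite_martingale m B ?L f by (rule vil_martingale_finite[OF f])
    define h where "h x = Max ((\<lambda>n. sqr ?L n x (f ?L)) ` {1..?L})" for x
    have h0: "0 \<le> h x" for x
      unfolding h_def by (subst Max_ge_iff) (auto simp: sqr_def)
    have lev_h: "lev ?L h"
      unfolding lev_def
    proof (intro ballI impI)
      fix x y assume xy: "x \<in> X" "y \<in> X" "agree ?L x y"
      have "sqr ?L n x (f ?L) = sqr ?L n y (f ?L)" if "n \<le> ?L" for n
        unfolding sqr_def using levD[OF lev_riesz[OF that] xy(3,1,2)] by simp
      then show "h x = h y" unfolding h_def by (intro arg_cong[where f = Max] image_cong) auto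
    qed
    have "(\<integral>\<^sup>+x. H k x \<partial>vil_measure m) \<le> (\<integral>\<^sup>+x. ennreal (h x) \<partial>vil_measure m)"
    proof (rule nn_integral_mono)
      fix x show "H k x \<le> ennreal (h x)"
        unfolding H_def h_def
        by (intro SUP_least ennreal_leI Max_ge) (auto simp: r[of _ ?L])
    qed
    also have "\<dots> = ennreal (avg ?L h)"
      by (rule nn_integral_lev[OF lev_h h0])
    also have "\<dots> \<le> ennreal (?C * avg ?L (\<lambda>x. sqrt (fmax x)))"
      using maximal_bound unfolding h_def bound_const_def by (intro ennreal_leI) simp
    also have "\<dots> = ennreal ?C * ennreal (avg ?L (\<lambda>x. sqrt (fmax x)))"
      by (rule ennreal_mult) (auto intro!: avg_nonneg simp: fmax_nonneg)
    also have "\<dots> \<le> ennreal ?C * ?J"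
      by (intro mult_left_mono avg_sqrt_fmax_le) auto
    finally show "(\<integral>\<^sup>+x. H k x \<partial>vil_measure m) \<le> ennreal ?C * ?J" .
  qed
  finally show ?thesis .
qed

lemma riesz_maximal_bounded:
  "\<exists>c::real. \<forall>f \<in> vil_Hp m (1/2).
     vil_Lp_norm m (1/2) (riesz_maximal m (\<lambda>n. ln (real n + 1)) f) \<le> ennreal c * vil_Hp_norm m (1/2) f"
proof (intro exI ballI)
  let ?C = "sqrt (5 * B) + 6 * real B * (5 * real B + 18 * real B ^ 2)"
  fix f assume "f \<in> vil_Hp m (1/2)"
  then have f: "vil_martingale m f" by (simp add: vil_Hp_def)
  have C: "0 \<le> ?C" by (intro add_nonneg_nonneg mult_nonneg_nonneg) auto
  show "vil_Lp_norm m (1/2) (riesz_maximal m (\<lambda>n. ln (real n + 1)) f)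
      \<le> ennreal (?C * ?C) * vil_Hp_norm m (1/2) f"
    using epowr_two_le[OF nn_integral_riesz_maximal_le[OF f] C]
    by (simp add: vil_Hp_norm_def vil_Lp_norm_def)
qed

end

section \<open>Sharpness of the weight\<close>

context bounded_vilenkin
begin

lemma measurable_of_lev:
  fixes g :: "_ \<Rightarrow> 'b::{second_countable_topology, real_normed_vector}"
  assumes "lev n g"
  shows "g \<in> borel_measurable (vil_filtration m n)"
proof -
  have "g \<in> borel_measurable (vil_filtration m n) \<longleftrightarrow>
      (\<lambda>x. \<Sum>t<M n. indicat_real (vil_interval m n (vil_digit m t)) x *\<^sub>R g (vil_digit m t))
        \<in> borel_measurable (vil_filtration m n)"
    by (rule measurable_cong, subst lev_expand[OF assms])
      (auto simp: vil_interval_eq indicator_def intro!: sum.cong)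
  also have "\<dots>"
    using vil_interval_in_filtration[OF digit_in_X]
    by (intro borel_measurable_sum borel_measurable_scaleR borel_measurable_indicator) auto
  finally show ?thesis .
qed

section \<open>The extremal martingales\<close>

definition zero_pt :: "nat \<Rightarrow> nat" where
  "zero_pt k = 0"

lemma zero_pt_in_X [simp]: "zero_pt \<in> X"
  by (simp add: X_iff zero_pt_def)

lemma rad_upd: "rad k (x(k := c)) = rad k (\<lambda>_. 1) ^ c"
  unfolding vil_rademacher_def exp_of_nat_mult[symmetric] by (simp add: mult_ac)

lemma sum_rad_upd: "(\<Sum>c<m k. rad k (x(k := c))) = 0"
proof -
  let ?\<zeta> = "rad k (\<lambda>_. 1)"
  have "phase (\<lambda>_. 1) zero_pt k \<noteq> 1"
  proof (rule phase_neq_1)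
    show "(\<lambda>_. 1) \<in> X" unfolding X_iff
    proof
      fix k show "1 < m k" using m_ge[of k] by linarith
    qed
  qed (simp_all add: zero_pt_def)
  then have "?\<zeta> \<noteq> 1" by (simp add: phase_def vil_rademacher_def zero_pt_def)
  then have "(\<Sum>c<m k. ?\<zeta> ^ c) = 0" unfolding geometric_sum[OF \<open>?\<zeta> \<noteq> 1\<close>] by (simp add: rad_power)
  then show ?thesis unfolding rad_upd .
qed

lemma agree_Suc_upd: "agree (Suc n) (x(n := c)) y \<longleftrightarrow> agree n x y \<and> y n = c"
  by (auto simp: agree_def less_Suc_eq)

lemma avg_of_real: "avg L (\<lambda>x. complex_of_real (g x)) = complex_of_real (avg L g)"
  by (simp add: complex_eq_iff avg_Re avg_Im)

lemma avg_rad_cell: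
  assumes x: "x \<in> X" and n: "n < L"
  shows "avg L (\<lambda>y. of_bool (agree n x y) * rad n y) = 0"
proof -
  have "avg L (\<lambda>y. of_bool (agree n x y) * rad n y)
      = avg L (\<lambda>y. \<Sum>c<m n. rad n (x(n := c)) * complex_of_real (of_bool (agree (Suc n) (x(n := c)) y)))"
  proof (rule avg_cong)
    fix y assume "y \<in> X"
    then have y: "y n \<in> {..<m n}" by (simp add: X_iff)
    have "(\<Sum>c<m n. rad n (x(n := c)) * complex_of_real (of_bool (agree (Suc n) (x(n := c)) y)))
        = (\<Sum>c<m n. if c = y n then of_bool (agree n x y) * rad n (x(n := c)) else 0)"
      unfolding agree_Suc_upd by (intro sum.cong) auto
    also have "\<dots> = of_bool (agree n x y) * rad n (x(n := y n))"
      using y by simp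
    also have "rad n (x(n := y n)) = rad n y"
      by (simp add: vil_rademacher_def)
    finally show "of_bool (agree n x y) * rad n y
      = (\<Sum>c<m n. rad n (x(n := c)) * complex_of_real (of_bool (agree (Suc n) (x(n := c)) y)))" ..
  qed
  also have "\<dots> = (\<Sum>c<m n. rad n (x(n := c)) * complex_of_real (1 / M (Suc n)))"
    unfolding avg_sum avg_mult_left
  proof (intro sum.cong refl arg_cong2[where f = "(*)"])
    fix c assume "c \<in> {..<m n}"
    then have "x(n := c) \<in> X" using x by (simp add: X_iff)
    then have "avg L (\<lambda>y. of_bool (agree (Suc n) (x(n := c)) y) :: real) = 1 / M (Suc n)"
      using n by (intro avg_agree) auto
    then show "avg L (\<lambda>y. complex_of_real (of_bool (agree (Suc n) (x(n := c)) y)))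
        = complex_of_real (1 / M (Suc n))"
      by (simp only: avg_of_real)
  qed
  also have "\<dots> = 0"
    unfolding sum_distrib_right[symmetric] sum_rad_upd by simp
  finally show ?thesis .
qed

text \<open>The difference of the Dirichlet kernels of indices \<open>2 * M N\<close> and
  \<open>M N\<close>: its coefficients are 1 from \<open>M N\<close> up to
  \<open>2 * M N - 1\<close> and 0 below.\<close>

definition bad :: "nat \<Rightarrow> (nat \<Rightarrow> nat) \<Rightarrow> complex" where
  "bad N x = of_bool (agree N zero_pt x) * of_nat (M N) * rad N x"

definition bad_mart :: "nat \<Rightarrow> nat \<Rightarrow> (nat \<Rightarrow> nat) \<Rightarrow> complex" where
  "bad_mart N k = (if k \<le> N then (\<lambda>_. 0) else bad N)"

lemma lev_rad: "n < L \<Longrightarrow> lev L (rad n)"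
  by (simp add: lev_def agree_def vil_rademacher_def)

lemma lev_bad: "N < L \<Longrightarrow> lev L (bad N)"
  unfolding bad_def[abs_def] by (intro lev_mult lev_agree lev_const lev_rad) auto

lemma lev_bad_mart: "lev n (bad_mart N n)"
  by (simp add: bad_mart_def lev_bad lev_const)

lemma norm_rad [simp]: "norm (rad k x) = 1"
  using norm_unit_roots[of "\<lambda>k. rad k x" k] by (simp add: unit_roots_def rad_power)

lemma norm_bad: "norm (bad N x) = M N * of_bool (agree N zero_pt x)"
  by (simp add: bad_def norm_mult)

lemma avg_bad_mult:
  assumes "lev N h" "N < L"
  shows "avg L (\<lambda>x. h x * bad N x) = 0"
proof -
  have "avg L (\<lambda>x. (h x * (of_bool (agree N zero_pt x) * of_nat (M N))) * rad N x) = 0"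
    by (rule avg_lev_mult_eq_0[of N])
      (auto intro!: lev_mult assms lev_agree lev_const avg_rad_cell)
  then show ?thesis by (simp add: bad_def mult_ac)
qed

text \<open>Indicators of sets of the filtration are functions of level \<open>n \<le> N\<close>, to
  which \<open>bad N\<close> is orthogonal. The parameter \<open>p\<close> treats real and imaginary
  parts together.\<close>

lemma cond_exp_bad:
  fixes p :: "complex \<Rightarrow> real"
  assumes p: "p = Re \<or> p = Im" and n: "n \<le> N"
  shows "AE x in vil_measure m. real_cond_exp (vil_measure m) (vil_filtration m n) (\<lambda>y. p (bad N y)) x = 0"
proof -
  interpret sub: finite_measure_subalgebra "vil_measure m" "vil_filtration m n"
    by unfold_locales (rule subalgebra_vil_filtration)
  have lev: "lev (Suc N) (\<lambda>y. p (bad N y))" by (rule lev_comp[OF lev_bad[OF lessI]])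
  show ?thesis
  proof (rule sub.real_cond_exp_charact)
    fix A assume A: "A \<in> sets (vil_filtration m n)"
    have lev_A: "lev n (\<lambda>x. of_bool (x \<in> A))"
      unfolding lev_def using vil_filtration_closed[OF A] by simp
    have "(\<integral>x\<in>A. p (bad N x) \<partial>vil_measure m) = (\<integral>x. p (of_bool (x \<in> A) * bad N x) \<partial>vil_measure m)"
      unfolding set_lebesgue_integral_def using p
      by (intro Bochner_Integration.integral_cong) auto
    also have "\<dots> = avg (Suc N) (\<lambda>x. p (of_bool (x \<in> A) * bad N x))"
      using lev_mono[OF lev_A, of "Suc N"] n
      by (intro integral_lev lev_comp[of _ "\<lambda>x. of_bool (x \<in> A) * bad N x" p] lev_mult lev_bad) auto
    also have "\<dots> = p (avg (Suc N) (\<lambda>x. of_bool (x \<in> A) * bad N x))"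
      using p by (auto simp: avg_Re avg_Im)
    also have "avg (Suc N) (\<lambda>x. of_bool (x \<in> A) * bad N x) = 0"
      by (rule avg_bad_mult[OF lev_mono[OF lev_A n]]) simp
    finally show "(\<integral>x\<in>A. p (bad N x) \<partial>vil_measure m) = (\<integral>x\<in>A. 0 \<partial>vil_measure m)"
      using p by auto
  qed (use integrable_lev[OF lev] in auto)
qed

lemma vil_martingale_bad: "vil_martingale m (bad_mart N)"
  unfolding vil_martingale_def
proof (intro conjI allI impI)
  show "bad_mart N n \<in> borel_measurable (vil_filtration m n)" for n
    by (rule measurable_of_lev[OF lev_bad_mart])
  show "integrable (vil_measure m) (bad_mart N n)" for n
    by (rule integrable_lev[OF lev_bad_mart])
  fix n k :: nat assume nk: "n \<le> k"
  interpret sub: finite_measure_subalgebra "vil_measure m" "vil_filtration m n"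
    by unfold_locales (rule subalgebra_vil_filtration)
  have "AE x in vil_measure m.
      real_cond_exp (vil_measure m) (vil_filtration m n) (\<lambda>y. p (bad_mart N k y)) x = p (bad_mart N n x)"
    if p: "p = Re \<or> p = Im" for p
  proof (cases "n \<le> N \<and> N < k")
    case True
    then have "bad_mart N k = bad N" "bad_mart N n = (\<lambda>_. 0)" by (auto simp: bad_mart_def)
    then show ?thesis using cond_exp_bad[OF p, of n N] True p by auto
  next
    case False
    then have eq: "bad_mart N k = bad_mart N n" using nk by (auto simp: bad_mart_def)
    have lev: "lev n (\<lambda>x. p (bad_mart N n x))" by (rule lev_comp[OF lev_bad_mart])
    show ?thesis unfolding eq
      by (rule sub.real_cond_exp_F_meas[OF integrable_lev[OF lev] measurable_of_lev[OF lev]])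
  qed
  from this[of Re, OF disjI1[OF refl]] this[of Im, OF disjI2[OF refl]]
  show "AE x in vil_measure m. bad_mart N n x =
      Complex (real_cond_exp (vil_measure m) (vil_filtration m n) (\<lambda>y. Re (bad_mart N k y)) x)
              (real_cond_exp (vil_measure m) (vil_filtration m n) (\<lambda>y. Im (bad_mart N k y)) x)"
    by eventually_elim (simp add: complex_eq_iff)
qed

text \<open>The maximal function is at most \<open>M N\<close> on a cell of measure
  \<open>1 / M N\<close> and zero elsewhere; its root integrates to at most
  \<open>1 / sqrt (M N)\<close>, which is then squared.\<close>

lemma bad_norm: "vil_Hp_norm m (1/2) (bad_mart N) \<le> ennreal (1 / M N)"
proof -
  have "(\<integral>\<^sup>+x. epowr (martingale_maximal (bad_mart N) x) (1/2) \<partial>vil_measure m)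
      \<le> (\<integral>\<^sup>+x. ennreal (sqrt (M N) * of_bool (agree N zero_pt x)) \<partial>vil_measure m)"
  proof (rule nn_integral_mono)
    fix x
    have "martingale_maximal (bad_mart N) x \<le> ennreal (M N * of_bool (agree N zero_pt x))"
      unfolding martingale_maximal_def
      by (rule SUP_least, rule ennreal_leI) (simp add: bad_mart_def norm_bad)
    from epowr_half_mono[OF this]
    show "epowr (martingale_maximal (bad_mart N) x) (1/2) \<le> ennreal (sqrt (M N) * of_bool (agree N zero_pt x))"
      by (subst (asm) epowr_half_ennreal) (auto simp: real_sqrt_mult split: if_splits)
  qed
  also have "\<dots> = ennreal (avg N (\<lambda>x. sqrt (M N) * of_bool (agree N zero_pt x)))"
    by (rule nn_integral_lev) (auto intro!: lev_mult lev_const lev_agree)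
  also have "\<dots> = ennreal (sqrt (M N) / M N)"
    unfolding avg_mult_left by (simp add: avg_agree)
  finally have I: "(\<integral>\<^sup>+x. epowr (martingale_maximal (bad_mart N) x) (1/2) \<partial>vil_measure m)
      \<le> ennreal (sqrt (M N) / M N)" .
  have "vil_Hp_norm m (1/2) (bad_mart N) \<le> ennreal (sqrt (M N) / M N) * ennreal (sqrt (M N) / M N)"
    using mult_mono[OF I I] by (simp add: vil_Hp_norm_def vil_Lp_norm_def epowr_two)
  also have "\<dots> = ennreal (1 / M N)"
    by (simp flip: ennreal_mult)
  finally show ?thesis .
qed

lemma bad_in_Hp: "bad_mart N \<in> vil_Hp m (1/2)"
  using vil_martingale_bad bad_norm[of N] le_less_trans[OF _ ennreal_less_top]
  by (auto simp: vil_Hp_def)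

section \<open>Riesz means of the extremal martingales\<close>

lemma psi_near_zero: "agree s zero_pt x \<Longrightarrow> j < M s \<Longrightarrow> \<psi> j x = 1"
  using psi_agree[of s zero_pt x j] by (simp add: psi_eq_chi chi_def vil_rademacher_def zero_pt_def)

lemma psi_M_add:
  assumes "r < M N"
  shows "\<psi> (M N + r) x = rad N x * \<psi> r x"
proof -
  have "1 < m N" using m_ge[of N] by linarith
  then have "chi (\<lambda>k. rad k x) (1 * M N) = rad N x" by (subst chi_digit) auto
  then show ?thesis using chi_mult_add[OF assms, of "\<lambda>k. rad k x" 1] by (simp add: psi_eq_chi)
qed

text \<open>Characters of index below \<open>M N\<close> equal 1 on the support, so the coefficient
  is the mean of \<open>bad N\<close>.\<close>

lemma coef_bad_low:
  assumes j: "j < M N" and N: "N < L"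
  shows "coef L (bad N) j = 0"
proof -
  have "coef L (bad N) j = avg L (\<lambda>x. 1 * bad N x)"
    unfolding coef_def
    by (rule avg_cong) (auto simp: bad_def psi_near_zero[OF _ j])
  also have "\<dots> = 0" by (rule avg_bad_mult[OF lev_const N])
  finally show ?thesis .
qed

lemma coef_bad_high:
  assumes r: "r < M N" and N: "N < L"
  shows "coef L (bad N) (M N + r) = 1"
proof -
  have "coef L (bad N) (M N + r) = avg L (\<lambda>x. complex_of_real (real (M N) * of_bool (agree N zero_pt x)))"
    unfolding coef_def
  proof (rule avg_cong)
    fix x
    have "rad N x * cnj (rad N x) = 1" by (simp add: complex_norm_square[symmetric])
    then show "bad N x * cnj (\<psi> (M N + r) x) = complex_of_real (real (M N) * of_bool (agree N zero_pt x))"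
      by (simp add: bad_def psi_M_add[OF r] psi_near_zero[OF _ r] mult.assoc)
  qed
  also have "\<dots> = complex_of_real (avg L (\<lambda>x. real (M N) * of_bool (agree N zero_pt x)))"
    by (rule avg_of_real)
  also have "\<dots> = 1"
    unfolding avg_mult_left using N by (simp add: avg_agree)
  finally show ?thesis .
qed

lemma psum_bad:
  assumes s: "s \<le> N" and x: "agree s zero_pt x" and i: "i \<le> M s" and N: "N < L"
  shows "psum L (bad N) (M N + i) x = rad N x * of_nat i"
proof -
  have "r < M N" if "r < i" for r using that i M_mono[OF s] by linarith
  then show ?thesis
    unfolding psum_def sum_lessThan_add using i x
    by (simp add: coef_bad_low[OF _ N] coef_bad_high[OF _ N] psi_M_add psi_near_zero)
qed

text \<open>On the cell of level \<open>s\<close> the partial sums of index \<open>M N + i\<close>,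
  \<open>i \<le> M s\<close>, are \<open>i\<close> times one and the same unimodular number. Nothing
  cancels, and the denominators are at most \<open>2 * M N\<close>.\<close>

lemma norm_riesz_bad_ge:
  assumes s: "s \<le> N" and x: "agree s zero_pt x"
  defines "n \<equiv> M N + M s"
  shows "(real (M s))\<^sup>2 / (4 * real (M N) * harm n) \<le> norm (riesz_mean m (bad_mart N) n x)"
proof -
  have L: "N < n" using less_M[of N] by (simp add: n_def)
  have MN: "M s \<le> M N" by (rule M_mono[OF s])
  have low: "psum n (bad N) k x = 0" if "k \<le> M N" for k
    unfolding psum_def using that by (intro sum.neutral) (auto simp: coef_bad_low[OF _ L])
  have "(\<Sum>k=1..n. psum n (bad N) k x / of_nat k) = (\<Sum>k<M N + Suc (M s). psum n (bad N) k x / of_nat k)"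
    by (rule sum.mono_neutral_left) (auto simp: n_def not_le)
  also have "\<dots> = (\<Sum>i<Suc (M s). psum n (bad N) (M N + i) x / of_nat (M N + i))"
    unfolding sum_lessThan_add by (simp add: low)
  also have "\<dots> = rad N x * complex_of_real (\<Sum>i<Suc (M s). real i / real (M N + i))"
    unfolding of_real_sum sum_distrib_left by (intro sum.cong) (auto simp: psum_bad[OF s x _ L])
  finally have eq: "(\<Sum>k=1..n. psum n (bad N) k x / of_nat k)
      = rad N x * complex_of_real (\<Sum>i<Suc (M s). real i / real (M N + i))" .
  have "(real (M s))\<^sup>2 / (4 * real (M N)) \<le> (\<Sum>i<Suc (M s). real i / (2 * real (M N)))"
  proof -
    have "(\<Sum>i<Suc K. real i) = real K * (real K + 1) / 2" for K
      by (induction K) (simp_all add: field_simps)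
    from this[of "M s"]
    have "(\<Sum>i<Suc (M s). real i / (2 * real (M N))) = real (M s) * (real (M s) + 1) / (4 * real (M N))"
      by (simp only: sum_divide_distrib[symmetric] divide_divide_eq_left)
    then show ?thesis by (simp add: power2_eq_square divide_right_mono)
  qed
  also have "\<dots> \<le> (\<Sum>i<Suc (M s). real i / real (M N + i))"
  proof (rule sum_mono)
    fix i assume "i \<in> {..<Suc (M s)}"
    then have "real (M N + i) \<le> 2 * real (M N)" using MN by simp
    then show "real i / (2 * real (M N)) \<le> real i / real (M N + i)"
      by (intro divide_left_mono) (auto intro!: mult_pos_pos add_pos_nonneg)
  qed
  also have "\<dots> = norm (\<Sum>k=1..n. psum n (bad N) k x / of_nat k)"
    unfolding eq norm_mult norm_of_real by (simp add: sum_nonneg)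
  finally have "(real (M s))\<^sup>2 / (4 * real (M N)) / harm n \<le> norm (riesz n (bad N) n x)"
    unfolding norm_riesz_eq by (rule divide_right_mono) (rule harm_nonneg)
  moreover have "riesz_mean m (bad_mart N) n x = riesz n (bad N) n x"
    using riesz_mean_eq[OF vil_martingale_bad order_refl] L by (simp add: bad_mart_def)
  ultimately show ?thesis by simp
qed

lemma ln_M_le: "ln (real (M k)) \<le> real k * ln (real B)"
proof -
  have "real (M k) \<le> real B ^ k"
  proof (induction k)
    case (Suc k)
    then show ?case
      using M_Suc_real_le[of k] mult_left_mono[of "real (M k)" "real B ^ k" "real B"] by simp
  qed (simp add: vil_M_0)
  then have "ln (real (M k)) \<le> ln (real B ^ k)" using B_ge by (intro ln_mono) auto
  then show ?thesis using B_ge by (simp add: ln_realpow)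
qed

lemma harm_le:
  assumes "1 \<le> n"
  shows "harm n \<le> 1 + ln (real n)"
  using euler_mascheroni_sequence_decreasing[of 1 n] assms by (simp add: harm_expand)

text \<open>The deepest cell containing \<open>x\<close> dominates, since \<open>M\<close> at least
  doubles from level to level. This replaces a maximum over levels by a sum whose average is
  explicit.\<close>

lemma sum_nested_cells_le:
  "\<exists>s\<le>K. agree s zero_pt x \<and> (\<Sum>j\<le>K. real (M j) * of_bool (agree j zero_pt x)) \<le> 2 * real (M s)"
proof (induction K)
  case 0
  then show ?case by (simp add: vil_M_0)
next
  case (Suc K)
  then obtain s where s: "s \<le> K" "agree s zero_pt x"
    "(\<Sum>j\<le>K. real (M j) * of_bool (agree j zero_pt x)) \<le> 2 * real (M s)" by blast
  show ?case
  proof (cases "agree (Suc K) zero_pt x")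
    case True
    have "2 * M s \<le> M (Suc K)"
      using M_mono[OF s(1)] M_Suc_ge[of K] by linarith
    then have "real (2 * M s) \<le> real (M (Suc K))" by (simp only: of_nat_le_iff)
    then have "2 * real (M s) \<le> real (M (Suc K))" by (simp only: of_nat_mult of_nat_numeral)
    then show ?thesis using True s(3) by (intro exI[of _ "Suc K"]) simp
  next
    case False
    then show ?thesis using s by (intro exI[of _ s]) simp
  qed
qed

text \<open>On the cell of level \<open>s\<close> the index \<open>M N + M s\<close> gives the
  square of \<open>M s\<close> over \<open>4 * D\<close>, with \<open>D\<close> independent of
  \<open>s\<close>. The roots dominate the nested sum \<open>w\<close>, to whose integral all levels
  \<open>j \<le> N\<close> contribute equally; squaring \<open>N / (4 * sqrt D)\<close> yields the
  claim.\<close>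

lemma riesz_maximal_bad_ge:
  fixes \<phi> :: "nat \<Rightarrow> real"
  assumes \<phi>: "\<And>n. 1 \<le> n \<Longrightarrow> 1 \<le> \<phi> n" and mono: "mono_on {1..} \<phi>" and N: "1 \<le> N"
  defines "c \<equiv> 1 + 2 * ln (real B)"
  shows "ennreal (real N / (16 * c * real (M N) * \<phi> (M (Suc N))))
     \<le> vil_Lp_norm m (1/2) (riesz_maximal m \<phi> (bad_mart N))"
proof -
  let ?\<phi> = "\<phi> (M (Suc N))"
  have lnB: "0 \<le> ln (real B)" using B_ge by simp
  have c: "1 \<le> c" using lnB by (simp add: c_def)
  have phi1: "1 \<le> ?\<phi>" using M_pos[of "Suc N"] by (intro \<phi>) linarith
  \<comment> \<open>For the indices \<open>M N + M s\<close> used here, \<open>c * N\<close> bounds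
    \<open>harm n\<close> and the value of \<open>\<phi>\<close> at \<open>M (Suc N)\<close> bounds
    \<open>\<phi> n\<close>.\<close>
  define D where "D = real (M N) * c * N * ?\<phi>"
  have D: "0 < D" using c N phi1 by (auto simp: D_def intro!: mult_pos_pos)
  have point: "ennreal ((real (M s))\<^sup>2 / (4 * D)) \<le> riesz_maximal m \<phi> (bad_mart N) x"
    if s: "s \<le> N" and x: "agree s zero_pt x" for s x
  proof -
    define n where "n = M N + M s"
    have n1: "1 \<le> n" using M_pos[of N] unfolding n_def by linarith
    have nM: "n \<le> M (Suc N)" using M_mono[OF s] M_Suc_ge[of N] unfolding n_def by linarith
    have "ln (real n) \<le> ln (real (M (Suc N)))" using n1 nM by (intro ln_mono) auto
    then have "ln (real n) \<le> real (Suc N) * ln (real B)" using ln_M_le[of "Suc N"] by linarith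
    also have "\<dots> \<le> (2 * real N) * ln (real B)" using N lnB by (intro mult_right_mono) auto
    finally have "harm n \<le> 1 + 2 * real N * ln (real B)" using harm_le[OF n1] by linarith
    also have "\<dots> \<le> c * N" using N by (simp add: c_def algebra_simps)
    finally have harm: "harm n \<le> c * N" .
    have harm0: "0 < (harm n :: real)" using n1 by simp
    have "\<phi> n \<le> ?\<phi>" using mono_onD[OF mono, of n "M (Suc N)"] n1 nM by simp
    moreover have "1 \<le> \<phi> n" by (rule \<phi>[OF n1])
    ultimately have "(4 * real (M N) * harm n) * \<phi> n \<le> (4 * real (M N) * (c * N)) * ?\<phi>"
      using harm harm0 c by (intro mult_mono) (auto simp: harm_nonneg)
    then have "(real (M s))\<^sup>2 / (4 * D) \<le> (real (M s))\<^sup>2 / ((4 * real (M N) * harm n) * \<phi> n)"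
      using harm0 \<open>1 \<le> \<phi> n\<close> c N phi1 by (intro divide_left_mono) (auto simp: D_def mult_ac intro!: mult_pos_pos)
    also have "\<dots> = (real (M s))\<^sup>2 / (4 * real (M N) * harm n) / \<phi> n" by simp
    also have "\<dots> \<le> norm (riesz_mean m (bad_mart N) n x) / \<phi> n"
      using norm_riesz_bad_ge[OF s x] \<open>1 \<le> \<phi> n\<close> unfolding n_def by (intro divide_right_mono) auto
    finally have "ennreal ((real (M s))\<^sup>2 / (4 * D)) \<le> ennreal (norm (riesz_mean m (bad_mart N) n x) / \<phi> n)"
      by (rule ennreal_leI)
    also have "\<dots> \<le> riesz_maximal m \<phi> (bad_mart N) x"
      unfolding riesz_maximal_def by (rule SUP_upper) (use n1 in simp)
    finally show ?thesis .
  qed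
  \<comment> \<open>The factor makes \<open>2 * M s / (4 * sqrt D)\<close> the square root of the
    pointwise bound.\<close>
  define w where "w x = 1 / (4 * sqrt D) * (\<Sum>j\<le>N. real (M j) * of_bool (agree j zero_pt x))" for x
  have w0: "0 \<le> w x" for x unfolding w_def using D by (intro mult_nonneg_nonneg sum_nonneg) auto
  have "ennreal (real N / (4 * sqrt D)) \<le> ennreal (avg N w)"
  proof (rule ennreal_leI)
    have "avg N w = 1 / (4 * sqrt D) * (\<Sum>j\<le>N. real (M j) * (1 / M j))"
      unfolding w_def[abs_def] avg_mult_left avg_sum
      by (intro arg_cong2[where f = "(*)"] sum.cong refl) (simp add: avg_agree)
    also have "\<dots> = (real N + 1) / (4 * sqrt D)" by simp
    finally show "real N / (4 * sqrt D) \<le> avg N w" using D by (simp add: divide_right_mono)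
  qed
  also have "ennreal (avg N w) = (\<integral>\<^sup>+x. ennreal (w x) \<partial>vil_measure m)"
  proof (rule nn_integral_lev[symmetric])
    show "lev N w"
      unfolding lev_def w_def
    proof (intro ballI impI)
      fix x y assume "agree N x y"
      then have "agree j zero_pt x = agree j zero_pt y" if "j \<le> N" for j
        using that by (rule agree_cong)
      then show "1 / (4 * sqrt D) * (\<Sum>j\<le>N. real (M j) * of_bool (agree j zero_pt x))
          = 1 / (4 * sqrt D) * (\<Sum>j\<le>N. real (M j) * of_bool (agree j zero_pt y))"
        by (intro arg_cong2[where f = "(*)"] sum.cong refl) simp
    qed
  qed (rule w0)
  also have "\<dots> \<le> (\<integral>\<^sup>+x. epowr (riesz_maximal m \<phi> (bad_mart N) x) (1/2) \<partial>vil_measure m)"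
  proof (rule nn_integral_mono)
    fix x
    obtain s where s: "s \<le> N" "agree s zero_pt x"
      "(\<Sum>j\<le>N. real (M j) * of_bool (agree j zero_pt x)) \<le> 2 * real (M s)"
      using sum_nested_cells_le by blast
    have "w x \<le> 1 / (4 * sqrt D) * (2 * real (M s))"
      unfolding w_def using s(3) D by (intro mult_left_mono) auto
    also have "\<dots> = sqrt ((real (M s))\<^sup>2 / (4 * D))"
      by (simp add: real_sqrt_divide real_sqrt_mult)
    finally have "ennreal (w x) \<le> epowr (ennreal ((real (M s))\<^sup>2 / (4 * D))) (1/2)"
      using D by (subst epowr_half_ennreal) (auto intro: ennreal_leI)
    also have "\<dots> \<le> epowr (riesz_maximal m \<phi> (bad_mart N) x) (1/2)"
      by (rule epowr_half_mono[OF point[OF s(1,2)]])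
    finally show "ennreal (w x) \<le> epowr (riesz_maximal m \<phi> (bad_mart N) x) (1/2)" .
  qed
  finally have I: "ennreal (real N / (4 * sqrt D))
      \<le> (\<integral>\<^sup>+x. epowr (riesz_maximal m \<phi> (bad_mart N) x) (1/2) \<partial>vil_measure m)" .
  have "real N / (16 * c * real (M N) * ?\<phi>) = real N / (4 * sqrt D) * (real N / (4 * sqrt D))"
    using D N c phi1 by (simp add: D_def field_simps)
  then have "ennreal (real N / (16 * c * real (M N) * ?\<phi>))
      = ennreal (real N / (4 * sqrt D)) * ennreal (real N / (4 * sqrt D))"
    using D by (simp flip: ennreal_mult)
  also have "\<dots> \<le> vil_Lp_norm m (1/2) (riesz_maximal m \<phi> (bad_mart N))"
    using mult_mono[OF I I] by (simp add: vil_Lp_norm_def epowr_two)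
  finally show ?thesis .
qed

text \<open>Boundedness on the extremal martingales forces \<open>N / \<phi> (M (Suc N))\<close> to
  stay bounded. Monotonicity of \<open>\<phi>\<close> extends this from the indices
  \<open>M (Suc N)\<close> to all large \<open>n\<close>, contradicting the infinite limsup.\<close>

lemma riesz_maximal_unbounded:
  fixes \<phi> :: "nat \<Rightarrow> real"
  assumes \<phi>: "\<And>n. 1 \<le> n \<Longrightarrow> 1 \<le> \<phi> n" and mono: "mono_on {1..} \<phi>"
    and limsup: "limsup (\<lambda>n. ereal (ln (real n + 1) / \<phi> n)) = \<infinity>"
    and bound: "\<forall>f \<in> vil_Hp m (1/2).
      vil_Lp_norm m (1/2) (riesz_maximal m \<phi> f) \<le> ennreal C * vil_Hp_norm m (1/2) f"
  shows False
proof -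
  define c where "c = 1 + 2 * ln (real B)"
  have lnB: "0 \<le> ln (real B)" using B_ge by simp
  have c: "1 \<le> c" using lnB by (simp add: c_def)
  \<comment> \<open>\<open>ennreal\<close> sends negative reals to 0, so a negative \<open>C\<close>
    acts like 0.\<close>
  define C' where "C' = max C 0"
  have ratio: "real N / \<phi> (M (Suc N)) \<le> 16 * c * C'" if N: "1 \<le> N" for N
  proof -
    have phi1: "1 \<le> \<phi> (M (Suc N))" using M_pos[of "Suc N"] by (intro \<phi>) linarith
    have "ennreal (real N / (16 * c * real (M N) * \<phi> (M (Suc N))))
        \<le> ennreal C * vil_Hp_norm m (1/2) (bad_mart N)"
      using riesz_maximal_bad_ge[OF \<phi> mono N] bound bad_in_Hp[of N] unfolding c_def
      by (meson order_trans)
    also have "\<dots> \<le> ennreal C' * ennreal (1 / M N)"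
      by (intro mult_mono bad_norm ennreal_leI) (auto simp: C'_def)
    also have "\<dots> = ennreal (C' * (1 / M N))"
      by (rule ennreal_mult[symmetric]) (auto simp: C'_def)
    finally have "real N / (16 * c * real (M N) * \<phi> (M (Suc N))) \<le> C' * (1 / M N)"
      by (subst (asm) ennreal_le_iff) (auto simp: C'_def)
    then show ?thesis using c phi1 by (simp add: field_simps)
  qed
  define K where "K = 3 * ln (real B) * (16 * c * C')"
  have "eventually (\<lambda>n. ereal (ln (real n + 1) / \<phi> n) \<le> ereal K) sequentially"
  proof (rule eventually_sequentiallyI)
    fix n assume n: "M 2 \<le> n"
    define k where "k = (LEAST k. n < M k)"
    have k: "n < M k" unfolding k_def by (rule LeastI[of _ n]) (rule less_M)
    have "2 < k"
    proof (rule ccontr)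
      assume "\<not> 2 < k"
      then have "M k \<le> M 2" by (intro M_mono) simp
      then show False using k n by linarith
    qed
    \<comment> \<open>Thus \<open>n\<close> lies between \<open>M (Suc N)\<close> and
      \<open>M (N + 2)\<close>; the start at \<open>M 2\<close> ensures \<open>1 \<le> N\<close>,
      which \<open>ratio\<close> requires and which gives
      \<open>k = N + 2 \<le> 3 * N\<close>.\<close>
    then obtain N where N: "k = Suc (Suc N)" "1 \<le> N"
      by (metis One_nat_def Suc_1 Suc_lessE Suc_leI less_Suc_eq_0_disj zero_less_Suc)
    have "\<not> n < M (Suc N)" unfolding N(1) using not_less_Least[of "Suc N" "\<lambda>k. n < M k"] N(1) k_def by simp
    then have le: "M (Suc N) \<le> n" by simp
    have "1 \<le> M (Suc N)" using M_pos[of "Suc N"] by linarith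
    then have "M (Suc N) \<in> {1..}" "n \<in> {1..}" using le by simp_all
    then have "\<phi> (M (Suc N)) \<le> \<phi> n" "1 \<le> \<phi> (M (Suc N))"
      using mono_onD[OF mono _ _ le] \<phi> by auto
    have "ln (real n + 1) \<le> ln (real (M k))" using k by (intro ln_mono) auto
    also have "\<dots> \<le> real k * ln (real B)" by (rule ln_M_le)
    also have "\<dots> \<le> (3 * real N) * ln (real B)"
      using N lnB by (intro mult_right_mono) auto
    finally have "ln (real n + 1) / \<phi> n \<le> (3 * real N * ln (real B)) / \<phi> (M (Suc N))"
      using \<open>\<phi> (M (Suc N)) \<le> \<phi> n\<close> \<open>1 \<le> \<phi> (M (Suc N))\<close> lnB by (intro frac_le) auto
    also have "\<dots> = 3 * ln (real B) * (real N / \<phi> (M (Suc N)))" by simp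
    also have "\<dots> \<le> K" unfolding K_def using lnB by (intro mult_left_mono ratio N) auto
    finally show "ereal (ln (real n + 1) / \<phi> n) \<le> ereal K" by simp
  qed
  then have "limsup (\<lambda>n. ereal (ln (real n + 1) / \<phi> n)) \<le> ereal K"
    by (rule Limsup_bounded)
  then show False using limsup by simp
qed

end

theorem theorem2:
  fixes m :: "nat \<Rightarrow> nat"
  assumes "\<And>k. 2 \<le> m k"
    and "bdd_above (range m)"
  shows "(\<exists>c::real. \<forall>f \<in> vil_Hp m (1/2).
            vil_Lp_norm m (1/2) (riesz_maximal m (\<lambda>n. ln (real n + 1)) f)
              \<le> ennreal c * vil_Hp_norm m (1/2) f)
       \<and> (\<forall>\<phi> :: nat \<Rightarrow> real.
            (\<forall>n\<ge>1. 1 \<le> \<phi> n) \<longrightarrow>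
            mono_on {1..} \<phi> \<longrightarrow>
            limsup (\<lambda>n. ereal (ln (real n + 1) / \<phi> n)) = \<infinity> \<longrightarrow>
            \<not> (\<exists>C::real. \<forall>f \<in> vil_Hp m (1/2).
                 vil_Lp_norm m (1/2) (riesz_maximal m \<phi> f)
                   \<le> ennreal C * vil_Hp_norm m (1/2) f))"
proof -
  obtain B where B: "\<And>k. m k \<le> B"
    using assms(2) by (auto simp: bdd_above_def)
  interpret bounded_vilenkin m B
    by unfold_locales (use assms(1) B in auto)
  show ?thesis
    using riesz_maximal_bounded riesz_maximal_unbounded by blast
qed

end
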